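(* Let $\kappa,\kappa'\ge1$, $n=\kappa+\kappa'$, and let $R(z)$, $z=x/y$, be the quantum $R$ matrix of $\mathcal U_B=\mathcal U_B(1^\kappa,0^{\kappa'})$ on $\mathcal W\otimes\mathcal W$. With $P(u\otimes v)=v\otimes u$, the operator $PR(z)$ has the spectral decomposition $$PR(z)=\sum_{l=0}^\infty\ \prod_{j=1}^l\frac{z+q^j}{1+q^jz}\ \mathcal P_l,$$ where $\mathcal P_l$ is the projector on the subspace of $\mathcal W\otimes\mathcal W$ generated from $\xi_l$ over the subalgebra $\mathcal U_{B,\{1,\ldots,n\}}$.
   Context: $q^{1/2},x,y$ are generic (algebraically independent indeterminates over $\mathbb C$), vector spaces are over $\mathbb C(q^{1/2},x,y)$; $[m]=\frac{q^m-q^{-m}}{q-q^{-1}}$, $[m]!=\prod_{k=1}^m[k]$, ${l\brack m}=\frac{[l]!}{[m]![l-m]!}$; $p=\mathrm i q^{-1/2}$, $\mathrm i=\sqrt{-1}$. $F$ has basis $|m\rangle$, $m\in\mathbb Z_{\ge0}$; $V$ has basis $|0\rangle,|1\rangle$; $\mathcal W=V^{\otimes\kappa}\otimes F^{\otimes\kappa'}$ has basis $|\mathbf m\rangle=|m_1,\ldots,m_n\rangle$ ($m_i\in\{0,1\}$ for $i\le\kappa$, $m_i\in\mathbb Z_{\ge0}$ for $i>\kappa$). $\mathbf e_i$ is the $i$th standard basis vector of $\mathbb Z^n$. $(\epsilon_1,\ldots,\epsilon_n)=(1^\kappa,0^{\kappa'})$. $\mathcal U_B(\epsilon_1,\ldots,\epsilon_n)$: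 put $q_i=q$ if $\epsilon_i=0$ and $q_i=-q^{-1}$ if $\epsilon_i=1$; $\langle i\rangle=\{i,i+1\}\cap[1,n]$, $D_{i,j}=\prod_{k\in\langle i\rangle\cap\langle j\rangle}q_k^{2\delta_{i,j}-1}$; $r_0=r_n=p$, $r_i=q$ for $0<i<n$. Generators $e_i,f_i,k_i^{\pm1}$ ($0\le i\le n$), relations $k_ik_i^{-1}=k_i^{-1}k_i=1$, $[k_i,k_j]=0$, $k_ie_j=D_{i,j}e_jk_i$, $k_if_j=D_{i,j}^{-1}f_jk_i$, $[e_i,f_j]=\delta_{i,j}\frac{k_i-k_i^{-1}}{r_i-r_i^{-1}}$; coproduct $\Delta k_i^{\pm1}=k_i^{\pm1}\otimes k_i^{\pm1}$, $\Delta e_i=1\otimes e_i+e_i\otimes k_i$, $\Delta f_i=f_i\otimes1+k_i^{-1}\otimes f_i$; $\Delta'$ is the opposite coproduct. $\mathcal U_{B,\{1,\ldots,n\}}$ is the subalgebra generated by $e_i,f_i,k_i^{\pm1}$, $1\le i\le n$; its action on $\mathcal W\otimes\mathcal W$ via $(\pi_x\otimes\pi_y)\Delta$ is independent of $x,y$. Representation $\pi_x$ on $\mathcal W$ (vectors with indices out of range are zero): $e_0|\mathbf m\rangle=x|\mathbf m+\mathbf e_1\rangle$, $f_0|\mathbf m\rangle=x^{-1}[m_1]|\mathbf m-\mathbf e_1\rangle$, $k_0|\mathbf m\rangle=p^{-1}q_1^{m_1}|\mathbf m\rangle$; for $0<i<n$: $e_i|\mathbf m\rangle=[m_i]|\mathbf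 m-\mathbf e_i+\mathbf e_{i+1}\rangle$, $f_i|\mathbf m\rangle=[m_{i+1}]|\mathbf m+\mathbf e_i-\mathbf e_{i+1}\rangle$, $k_i|\mathbf m\rangle=q_i^{-m_i}q_{i+1}^{m_{i+1}}|\mathbf m\rangle$; $e_n|\mathbf m\rangle=[m_n]|\mathbf m-\mathbf e_n\rangle$, $f_n|\mathbf m\rangle=|\mathbf m+\mathbf e_n\rangle$, $k_n|\mathbf m\rangle=p\,q_n^{-m_n}|\mathbf m\rangle$. Quantum $R$ matrix: $R(z)\in\mathrm{End}(\mathcal W\otimes\mathcal W)$ is determined by $(\pi_x\otimes\pi_y)\Delta'(g)R(z)=R(z)(\pi_x\otimes\pi_y)\Delta(g)$ for all $g\in\mathcal U_B$ and $R(z)(|\mathbf 0\rangle\otimes|\mathbf 0\rangle)=|\mathbf 0\rangle\otimes|\mathbf 0\rangle$. Singular vectors: for $l\in\mathbb Z_{\ge0}$, $\xi_l=\sum_{m=0}^l(-p)^{-m}q^{m(l-(m+1)/2)}{l\brack m}\,|m\mathbf e_n\rangle\otimes|(l-m)\mathbf e_n\rangle$. "Projector" is with respect to the decomposition of $\mathcal W\otimes\mathcal W$ into the subspaces $\mathcal U_{B,\{1,\ldots,n\}}\xi_l$, $l\ge0$. *)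

theory Defs
  imports
    Complex_Main
    "HOL-Computational_Algebra.Fraction_Field"
    "HOL-Computational_Algebra.Polynomial"
    "HOL-Library.Poly_Mapping"
    "HOL-Library.Product_Plus"
    "HOL-Algebra.QuotRing"
begin

text \<open>
  Vectors of a space with basis indexed by \<open>'b\<close> are finitely supported functions
  \<open>'b \<Rightarrow>\<^sub>0 fld\<close>; for a monoid \<open>'b\<close> the library multiplication on this type is that of the monoid
  algebra.
\<close>

section \<open>The ground field and q-numbers\<close>

text \<open>The field \<open>\<complex>(q\<^sup>1\<^sup>/\<^sup>2, x, y)\<close>: the innermost polynomial variable is \<open>q\<^sup>1\<^sup>/\<^sup>2\<close>, the next one \<open>x\<close>,
  the outermost one \<open>y\<close>.\<close>

type_synonym fld = "complex poly poly poly fract"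

definition qhalf :: fld where "qhalf = Fraction_Field.Fract [:[:[:0, 1:]:]:] 1"
definition xvar :: fld where "xvar = Fraction_Field.Fract [:[:0, 1:]:] 1"
definition yvar :: fld where "yvar = Fraction_Field.Fract [:0, 1:] 1"
definition const :: "complex \<Rightarrow> fld" where "const c = Fraction_Field.Fract [:[:[:c:]:]:] 1"

definition q :: fld where "q = qhalf ^ 2"
definition p :: fld where "p = const \<i> * inverse qhalf"

definition qint :: "int \<Rightarrow> fld" where
  "qint m = (q powi m - q powi (- m)) / (q - inverse q)"

definition qfact :: "nat \<Rightarrow> fld" where
  "qfact m = (\<Prod>k = 1..m. qint (int k))"

definition qbinom :: "nat \<Rightarrow> nat \<Rightarrow> fld" where
  "qbinom l m = qfact l / (qfact m * qfact (l - m))"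


section \<open>Linear algebra over a basis\<close>

definition scl :: "fld \<Rightarrow> ('b \<Rightarrow>\<^sub>0 fld) \<Rightarrow> ('b \<Rightarrow>\<^sub>0 fld)" (infixr \<open>*\<^sub>K\<close> 75) where
  "c *\<^sub>K v = Poly_Mapping.map ((*) c) v"

definition bvec :: "'b \<Rightarrow> ('b \<Rightarrow>\<^sub>0 fld)" where
  "bvec b = Poly_Mapping.single b 1"

definition lin_ext :: "('b \<Rightarrow> ('c \<Rightarrow>\<^sub>0 fld)) \<Rightarrow> ('b \<Rightarrow>\<^sub>0 fld) \<Rightarrow> ('c \<Rightarrow>\<^sub>0 fld)" where
  "lin_ext f v = (\<Sum>b \<in> Poly_Mapping.keys v. Poly_Mapping.lookup v b *\<^sub>K f b)"

definition tens :: "('b \<Rightarrow>\<^sub>0 fld) \<Rightarrow> ('c \<Rightarrow>\<^sub>0 fld) \<Rightarrow> ('b \<times> 'c \<Rightarrow>\<^sub>0 fld)" where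
  "tens u v = lin_ext (\<lambda>b. lin_ext (\<lambda>c. bvec (b, c)) v) u"

definition tens_op ::
  "(('b \<Rightarrow>\<^sub>0 fld) \<Rightarrow> ('b \<Rightarrow>\<^sub>0 fld)) \<Rightarrow> (('c \<Rightarrow>\<^sub>0 fld) \<Rightarrow> ('c \<Rightarrow>\<^sub>0 fld)) \<Rightarrow>
    ('b \<times> 'c \<Rightarrow>\<^sub>0 fld) \<Rightarrow> ('b \<times> 'c \<Rightarrow>\<^sub>0 fld)" where
  "tens_op S T = lin_ext (\<lambda>(b, c). tens (S (bvec b)) (T (bvec c)))"

definition flip :: "('b \<times> 'b \<Rightarrow>\<^sub>0 fld) \<Rightarrow> ('b \<times> 'b \<Rightarrow>\<^sub>0 fld)" where
  "flip = lin_ext (\<lambda>(a, b). bvec (b, a))"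

definition endomorphisms :: "('b \<Rightarrow>\<^sub>0 fld) set \<Rightarrow> (('b \<Rightarrow>\<^sub>0 fld) \<Rightarrow> ('b \<Rightarrow>\<^sub>0 fld)) set" where
  "endomorphisms S = {T. (\<forall>v \<in> S. T v \<in> S)
     \<and> (\<forall>u \<in> S. \<forall>v \<in> S. T (u + v) = T u + T v)
     \<and> (\<forall>c. \<forall>v \<in> S. T (c *\<^sub>K v) = c *\<^sub>K T v)}"

text \<open>\<open>components M v c\<close>: \<open>v = \<Sum>\<^sub>l c l\<close> is a decomposition of \<open>v\<close> into finitely many nonzero
  vectors \<open>c l \<in> M l\<close>.\<close>

definition components ::
  "(nat \<Rightarrow> ('b \<Rightarrow>\<^sub>0 fld) set) \<Rightarrow> ('b \<Rightarrow>\<^sub>0 fld) \<Rightarrow> (nat \<Rightarrow> ('b \<Rightarrow>\<^sub>0 fld)) \<Rightarrow> bool" where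
  "components M v c \<longleftrightarrow>
     finite {l. c l \<noteq> 0} \<and> (\<forall>l. c l \<in> M l) \<and> v = Sum_any c"

definition is_direct_sum :: "('b \<Rightarrow>\<^sub>0 fld) set \<Rightarrow> (nat \<Rightarrow> ('b \<Rightarrow>\<^sub>0 fld) set) \<Rightarrow> bool" where
  "is_direct_sum S M \<longleftrightarrow>
     (\<forall>l. module.subspace scl (M l) \<and> M l \<subseteq> S) \<and> (\<forall>v \<in> S. \<exists>!c. components M v c)"

definition projector ::
  "(nat \<Rightarrow> ('b \<Rightarrow>\<^sub>0 fld) set) \<Rightarrow> nat \<Rightarrow> ('b \<Rightarrow>\<^sub>0 fld) \<Rightarrow> ('b \<Rightarrow>\<^sub>0 fld)" where
  "projector M l v = (THE c. components M v c) l"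


section \<open>The algebra\<close>

datatype gen = E nat | F nat | K nat | Kinv nat

fun gen_index :: "gen \<Rightarrow> nat" where
  "gen_index (E i) = i"
| "gen_index (F i) = i"
| "gen_index (K i) = i"
| "gen_index (Kinv i) = i"

datatype gword = Word (letters: "gen list")

instantiation gword :: monoid_add
begin

definition zero_gword :: gword where "0 = Word []"
definition plus_gword :: "gword \<Rightarrow> gword \<Rightarrow> gword" where
  "v + w = Word (letters v @ letters w)"

instance
  by standard (simp_all add: zero_gword_def plus_gword_def)

end

text \<open>Since \<open>+\<close> on words is concatenation, \<open>free\<close> carries the product of the free associative
  algebra, and \<open>free2\<close> the product \<open>(a \<otimes> b)(c \<otimes> d) = ac \<otimes> bd\<close> of its tensor square.\<close>

type_synonym free = "gword \<Rightarrow>\<^sub>0 fld"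
type_synonym free2 = "gword \<times> gword \<Rightarrow>\<^sub>0 fld"

definition fgen :: "gen \<Rightarrow> free" where "fgen g = bvec (Word [g])"

text \<open>The free algebra on the letters with index in \<open>J\<close>.\<close>

definition free_alg :: "nat set \<Rightarrow> free ring" where
  "free_alg J = \<lparr>carrier = {a. \<forall>w \<in> Poly_Mapping.keys a. \<forall>g \<in> set (letters w). gen_index g \<in> J},
     monoid.mult = (*), one = 1, ring.zero = 0, add = (+)\<rparr>"

text \<open>Below, \<open>\<kappa>\<close> and \<open>\<kappa>'\<close> are the multiplicities in \<open>(1\<^sup>\<kappa>, 0\<^sup>\<kappa>\<^sup>')\<close>, and \<open>n = \<kappa> + \<kappa>'\<close>.\<close>

definition qi :: "nat \<Rightarrow> nat \<Rightarrow> fld" where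
  "qi \<kappa> i = (if i \<le> \<kappa> then - inverse q else q)"

definition nbh :: "nat \<Rightarrow> nat \<Rightarrow> nat set" where
  "nbh n i = {i, i + 1} \<inter> {1..n}"

definition Dcoef :: "nat \<Rightarrow> nat \<Rightarrow> nat \<Rightarrow> nat \<Rightarrow> fld" where
  "Dcoef \<kappa> \<kappa>' i j = (\<Prod>k \<in> nbh (\<kappa> + \<kappa>') i \<inter> nbh (\<kappa> + \<kappa>') j.
     qi \<kappa> k powi (2 * (if i = j then 1 else 0) - 1))"

definition ri :: "nat \<Rightarrow> nat \<Rightarrow> fld" where
  "ri n i = (if i = 0 \<or> i = n then p else q)"

definition UB_relators :: "nat \<Rightarrow> nat \<Rightarrow> free set" where
  "UB_relators \<kappa> \<kappa>' = (let n = \<kappa> + \<kappa>' in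
     {fgen (K i) * fgen (Kinv i) - 1 | i. i \<le> n}
   \<union> {fgen (Kinv i) * fgen (K i) - 1 | i. i \<le> n}
   \<union> {fgen (K i) * fgen (K j) - fgen (K j) * fgen (K i) | i j. i \<le> n \<and> j \<le> n}
   \<union> {fgen (K i) * fgen (E j) - Dcoef \<kappa> \<kappa>' i j *\<^sub>K (fgen (E j) * fgen (K i)) | i j. i \<le> n \<and> j \<le> n}
   \<union> {fgen (K i) * fgen (F j) - inverse (Dcoef \<kappa> \<kappa>' i j) *\<^sub>K (fgen (F j) * fgen (K i))
        | i j. i \<le> n \<and> j \<le> n}
   \<union> {fgen (E i) * fgen (F j) - fgen (F j) * fgen (E i)
        - (if i = j then inverse (ri n i - inverse (ri n i)) *\<^sub>K (fgen (K i) - fgen (Kinv i)) else 0)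
        | i j. i \<le> n \<and> j \<le> n})"

definition UB_ideal :: "nat \<Rightarrow> nat \<Rightarrow> free set" where
  "UB_ideal \<kappa> \<kappa>' = genideal (free_alg {0..\<kappa> + \<kappa>'}) (UB_relators \<kappa> \<kappa>')"

definition UB :: "nat \<Rightarrow> nat \<Rightarrow> free set ring" where
  "UB \<kappa> \<kappa>' = free_alg {0..\<kappa> + \<kappa>'} Quot UB_ideal \<kappa> \<kappa>'"

text \<open>The subalgebra of \<open>UB \<kappa> \<kappa>'\<close> generated by the generators with index in \<open>J\<close>: the classes of
  noncommutative polynomials in these generators.\<close>

definition UB_sub :: "nat \<Rightarrow> nat \<Rightarrow> nat set \<Rightarrow> free set set" where
  "UB_sub \<kappa> \<kappa>' J =
     (\<lambda>a. UB_ideal \<kappa> \<kappa>' +>\<^bsub>free_alg {0..\<kappa> + \<kappa>'}\<^esub> a) ` carrier (free_alg J)"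

text \<open>The coproduct on representatives in the free algebra; \<open>1 \<otimes> e\<^sub>i\<close> is the basis element
  \<open>(0, Word [E i])\<close> since \<open>0\<close> is the empty word.\<close>

fun coprod_gen :: "gen \<Rightarrow> free2" where
  "coprod_gen (K i) = bvec (Word [K i], Word [K i])"
| "coprod_gen (Kinv i) = bvec (Word [Kinv i], Word [Kinv i])"
| "coprod_gen (E i) = bvec (0, Word [E i]) + bvec (Word [E i], Word [K i])"
| "coprod_gen (F i) = bvec (Word [F i], 0) + bvec (Word [Kinv i], Word [F i])"

definition coprod :: "free \<Rightarrow> free2" where
  "coprod = lin_ext (\<lambda>w. prod_list (map coprod_gen (letters w)))"

definition coprod_op :: "free \<Rightarrow> free2" where
  "coprod_op a = flip (coprod a)"


section \<open>The representation\<close>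

text \<open>A label \<open>m \<in> \<int>\<^sup>n\<close> is a finitely supported function whose entries sit at the positions \<open>1..n\<close>;
  only labels in \<open>labels \<kappa> \<kappa>'\<close> index basis vectors, and \<open>ket\<close> is zero on the others.\<close>

type_synonym label = "nat \<Rightarrow>\<^sub>0 int"
type_synonym vec = "label \<Rightarrow>\<^sub>0 fld"
type_synonym vec2 = "label \<times> label \<Rightarrow>\<^sub>0 fld"

definition labels :: "nat \<Rightarrow> nat \<Rightarrow> label set" where
  "labels \<kappa> \<kappa>' = {m. Poly_Mapping.keys m \<subseteq> {1..\<kappa> + \<kappa>'}
     \<and> (\<forall>i. 0 \<le> Poly_Mapping.lookup m i)
     \<and> (\<forall>i \<in> {1..\<kappa>}. Poly_Mapping.lookup m i \<in> {0, 1})}"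

definition unitv :: "nat \<Rightarrow> label" where
  "unitv i = Poly_Mapping.single i 1"

definition ket :: "nat \<Rightarrow> nat \<Rightarrow> label \<Rightarrow> vec" where
  "ket \<kappa> \<kappa>' m = (if m \<in> labels \<kappa> \<kappa>' then bvec m else 0)"

definition WW :: "nat \<Rightarrow> nat \<Rightarrow> vec2 set" where
  "WW \<kappa> \<kappa>' = {v. Poly_Mapping.keys v \<subseteq> labels \<kappa> \<kappa>' \<times> labels \<kappa> \<kappa>'}"

definition k_eigenvalue :: "nat \<Rightarrow> nat \<Rightarrow> nat \<Rightarrow> label \<Rightarrow> fld" where
  "k_eigenvalue \<kappa> \<kappa>' i m = (let n = \<kappa> + \<kappa>'; m' = Poly_Mapping.lookup m in
     if i = 0 then inverse p * qi \<kappa> 1 powi m' 1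
     else if i < n then qi \<kappa> i powi (- m' i) * qi \<kappa> (i + 1) powi m' (i + 1)
     else p * qi \<kappa> n powi (- m' n))"

text \<open>\<open>u\<close> is the spectral parameter; the generators have indices \<open>0..n\<close>, so the last case of each
  conditional is the index \<open>n\<close>.\<close>

fun rep_gen :: "nat \<Rightarrow> nat \<Rightarrow> fld \<Rightarrow> gen \<Rightarrow> label \<Rightarrow> vec" where
  "rep_gen \<kappa> \<kappa>' u (E i) m = (let n = \<kappa> + \<kappa>'; m' = Poly_Mapping.lookup m in
     if i = 0 then u *\<^sub>K ket \<kappa> \<kappa>' (m + unitv 1)
     else if i < n then qint (m' i) *\<^sub>K ket \<kappa> \<kappa>' (m - unitv i + unitv (i + 1))
     else qint (m' n) *\<^sub>K ket \<kappa> \<kappa>' (m - unitv n))"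
| "rep_gen \<kappa> \<kappa>' u (F i) m = (let n = \<kappa> + \<kappa>'; m' = Poly_Mapping.lookup m in
     if i = 0 then (inverse u * qint (m' 1)) *\<^sub>K ket \<kappa> \<kappa>' (m - unitv 1)
     else if i < n then qint (m' (i + 1)) *\<^sub>K ket \<kappa> \<kappa>' (m + unitv i - unitv (i + 1))
     else ket \<kappa> \<kappa>' (m + unitv n))"
| "rep_gen \<kappa> \<kappa>' u (K i) m = k_eigenvalue \<kappa> \<kappa>' i m *\<^sub>K ket \<kappa> \<kappa>' m"
| "rep_gen \<kappa> \<kappa>' u (Kinv i) m = inverse (k_eigenvalue \<kappa> \<kappa>' i m) *\<^sub>K ket \<kappa> \<kappa>' m"

definition rep_word :: "nat \<Rightarrow> nat \<Rightarrow> fld \<Rightarrow> gword \<Rightarrow> vec \<Rightarrow> vec" where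
  "rep_word \<kappa> \<kappa>' u w = foldr (\<lambda>g T. lin_ext (rep_gen \<kappa> \<kappa>' u g) \<circ> T) (letters w) id"

text \<open>\<open>\<pi>\<^sub>u \<otimes> \<pi>\<^sub>v\<close> on the tensor square of the free algebra.\<close>

definition rep2 :: "nat \<Rightarrow> nat \<Rightarrow> fld \<Rightarrow> fld \<Rightarrow> free2 \<Rightarrow> vec2 \<Rightarrow> vec2" where
  "rep2 \<kappa> \<kappa>' u v t \<psi> =
     lin_ext (\<lambda>(w1, w2). tens_op (rep_word \<kappa> \<kappa>' u w1) (rep_word \<kappa> \<kappa>' v w2) \<psi>) t"

text \<open>The actions \<open>(\<pi>\<^sub>u \<otimes> \<pi>\<^sub>v)\<Delta>\<close> and \<open>(\<pi>\<^sub>u \<otimes> \<pi>\<^sub>v)\<Delta>'\<close> of \<open>g \<in> UB \<kappa> \<kappa>'\<close> on \<open>\<psi> \<in> WW \<kappa> \<kappa>'\<close>. The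
  generators act on \<open>WW \<kappa> \<kappa>'\<close> by operators satisfying the defining relations (for \<open>u, v \<noteq> 0\<close>), so all
  representatives of the coset \<open>g\<close> give the same vector.\<close>

definition act :: "nat \<Rightarrow> nat \<Rightarrow> fld \<Rightarrow> fld \<Rightarrow> free set \<Rightarrow> vec2 \<Rightarrow> vec2" where
  "act \<kappa> \<kappa>' u v g \<psi> = the_elem ((\<lambda>a. rep2 \<kappa> \<kappa>' u v (coprod a) \<psi>) ` g)"

definition act_op :: "nat \<Rightarrow> nat \<Rightarrow> fld \<Rightarrow> fld \<Rightarrow> free set \<Rightarrow> vec2 \<Rightarrow> vec2" where
  "act_op \<kappa> \<kappa>' u v g \<psi> = the_elem ((\<lambda>a. rep2 \<kappa> \<kappa>' u v (coprod_op a) \<psi>) ` g)"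


section \<open>The quantum R matrix and the singular vectors\<close>

definition is_quantum_R :: "nat \<Rightarrow> nat \<Rightarrow> (vec2 \<Rightarrow> vec2) \<Rightarrow> bool" where
  "is_quantum_R \<kappa> \<kappa>' R \<longleftrightarrow>
     R \<in> endomorphisms (WW \<kappa> \<kappa>')
   \<and> (\<forall>g \<in> carrier (UB \<kappa> \<kappa>'). \<forall>\<psi> \<in> WW \<kappa> \<kappa>'.
        act_op \<kappa> \<kappa>' xvar yvar g (R \<psi>) = R (act \<kappa> \<kappa>' xvar yvar g \<psi>))
   \<and> R (tens (ket \<kappa> \<kappa>' 0) (ket \<kappa> \<kappa>' 0)) = tens (ket \<kappa> \<kappa>' 0) (ket \<kappa> \<kappa>' 0)"

text \<open>The exponent \<open>m(l - (m+1)/2)\<close> of \<open>q\<close> is written as the exponent \<open>m(2l - m - 1)\<close> of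
  \<open>q\<^sup>1\<^sup>/\<^sup>2\<close>.\<close>

definition sing_vec :: "nat \<Rightarrow> nat \<Rightarrow> nat \<Rightarrow> vec2" where
  "sing_vec \<kappa> \<kappa>' l = (let n = \<kappa> + \<kappa>' in
     \<Sum>m = 0..l. ((- p) powi (- int m) * qhalf powi (int m * (2 * int l - int m - 1)) * qbinom l m) *\<^sub>K
       tens (ket \<kappa> \<kappa>' (Poly_Mapping.single n (int m)))
            (ket \<kappa> \<kappa>' (Poly_Mapping.single n (int (l - m)))))"

definition sing_module :: "nat \<Rightarrow> nat \<Rightarrow> nat \<Rightarrow> vec2 set" where
  "sing_module \<kappa> \<kappa>' l =
     (\<lambda>g. act \<kappa> \<kappa>' xvar yvar g (sing_vec \<kappa> \<kappa>' l)) ` UB_sub \<kappa> \<kappa>' {1..\<kappa> + \<kappa>'}"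

end

theory Submission
  imports Defs
begin

text \<open>
  Let \<open>PR\<close> be the operator \<open>P R(z)\<close>. Since \<open>R(z)\<close> exchanges the coproduct with its opposite, \<open>PR\<close> turns
  the action with spectral parameters \<open>(x, y)\<close> into the one with \<open>(y, x)\<close>. Only the node \<open>0\<close> sees these
  parameters, so \<open>PR\<close> commutes with the nodes \<open>1, ..., n\<close>. The theorem follows from three facts.

  \<^item> \<open>\<xi>\<^sub>l\<close> is killed by \<open>e\<^sub>1, ..., e\<^sub>n\<close>, and every vector with this property and the same eigenvalue of \<open>k\<^sub>n\<close>
    is a multiple of it (\<open>sing_vec_singular\<close>, \<open>singular_proportional\<close>). Hence \<open>PR \<xi>\<^sub>l = \<rho>\<^sub>l \<xi>\<^sub>l\<close>, and \<open>PR\<close> is the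
    scalar \<open>\<rho>\<^sub>l\<close> on the module generated by \<open>\<xi>\<^sub>l\<close>.

  \<^item> The vectors \<open>|a e\<^sub>n\<rangle> \<otimes> |b e\<^sub>n\<rangle>\<close> with \<open>a + b = l\<close> span the sum of the line of \<open>\<xi>\<^sub>l\<close> and a subspace of the
    image of \<open>f\<^sub>n\<close>. A functional \<open>psi\<close> that vanishes on the image of \<open>f\<^sub>n\<close> and not on \<open>\<xi>\<^sub>l\<close>
    (\<open>psi_F_n\<close>, \<open>psi_sing_vec_nonzero\<close>) therefore reads off the component along \<open>\<xi>\<^sub>l\<close>. The product
    \<open>e\<^sub>n\<^sub>-\<^sub>1 ... e\<^sub>1 e\<^sub>0\<close> moves such vectors from \<open>l\<close> to \<open>l + 1\<close> and multiplies \<open>psi\<close> by \<open>y + q\<^sup>l\<^sup>+\<^sup>1 x\<close>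
    (\<open>affine_raise_in_span\<close>). As \<open>PR\<close> exchanges \<open>x\<close> and \<open>y\<close> in this product, comparing both sides gives
    \<open>\<rho>\<^sub>l\<^sub>+\<^sub>1 (y + q\<^sup>l\<^sup>+\<^sup>1 x) = \<rho>\<^sub>l (x + q\<^sup>l\<^sup>+\<^sup>1 y)\<close>, and \<open>\<rho>\<^sub>0 = 1\<close> by the normalisation of \<open>R(z)\<close>.

  \<^item> The modules generated by the \<open>\<xi>\<^sub>l\<close> are independent because the \<open>\<rho>\<^sub>l\<close> are pairwise distinct
    (\<open>modules_independent\<close>). They span because, modulo the images of \<open>f\<^sub>1, ..., f\<^sub>n\<close>, every basis vector
    reduces to a multiple of some \<open>|0\<rangle> \<otimes> |l e\<^sub>n\<rangle>\<close>, which in turn is a multiple of \<open>\<xi>\<^sub>l\<close>; an induction on a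
    grading raised by all \<open>f\<^sub>i\<close> concludes (\<open>spanned_by_singular_vectors\<close>).

  Underneath lies the fact that \<open>act\<close>, which is defined on classes modulo the ideal of relations, may be
  computed on any representative (\<open>act_coset\<close>). For this the generators are shown to satisfy all
  defining relations on \<open>\<W> \<otimes> \<W>\<close> (\<open>relators_act_zero\<close>).
\<close>

section \<open>Linear maps on finitely supported functions\<close>

lemma lookup_scl [simp]: "Poly_Mapping.lookup (c *\<^sub>K v) b = c * Poly_Mapping.lookup v b"
  by (simp add: scl_def Poly_Mapping.map.rep_eq when_def)

global_interpretation VS: vector_space "scl :: fld \<Rightarrow> ('b \<Rightarrow>\<^sub>0 fld) \<Rightarrow> _"
  by standard (auto intro!: poly_mapping_eqI simp: lookup_add algebra_simps)

lemma module_hom_fld_iff: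
  "module_hom (scl :: fld \<Rightarrow> ('b \<Rightarrow>\<^sub>0 fld) \<Rightarrow> _) (scl :: fld \<Rightarrow> ('c \<Rightarrow>\<^sub>0 fld) \<Rightarrow> _) T
    \<longleftrightarrow> (\<forall>u v. T (u + v) = T u + T v) \<and> (\<forall>c v. T (c *\<^sub>K v) = c *\<^sub>K T v)"
  by (auto simp: module_hom_iff VS.module_axioms)

abbreviation lin :: "(('b \<Rightarrow>\<^sub>0 fld) \<Rightarrow> ('c \<Rightarrow>\<^sub>0 fld)) \<Rightarrow> bool" where
  "lin T \<equiv> module_hom scl scl T"

lemma linI:
  assumes "\<And>u v. T (u + v) = T u + T v" "\<And>c v. T (c *\<^sub>K v) = c *\<^sub>K T v"
  shows "lin T"
  using assms by (simp add: module_hom_fld_iff)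

lemmas lin_add = module_hom.add and lin_scale = module_hom.scale and lin_zero = module_hom.zero
  and lin_diff = module_hom.diff and lin_sum = module_hom.sum and lin_neg = module_hom.neg

lemma lin_comp: "lin S \<Longrightarrow> lin T \<Longrightarrow> lin (\<lambda>v. S (T v))"
  by (auto simp: module_hom_fld_iff)

lemma lin_ident: "lin (\<lambda>v. v)"
  by (rule linI) simp_all

lemma lin_scl: "lin (\<lambda>v. c *\<^sub>K v)"
  by (rule linI) (simp_all add: VS.scale_right_distrib mult.commute)

lemma lin_plus: "lin S \<Longrightarrow> lin T \<Longrightarrow> lin (\<lambda>v. S v + T v)"
  by (auto simp: module_hom_fld_iff VS.scale_right_distrib)

text \<open>
  The linear functional with value \<open>w b\<close> on the basis vector \<open>b\<close>. Coordinates of \<open>lin_ext f v\<close> have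
  this form, so linearity is proved once for both.
\<close>

definition weighted_sum :: "('b \<Rightarrow> fld) \<Rightarrow> ('b \<Rightarrow>\<^sub>0 fld) \<Rightarrow> fld" where
  "weighted_sum w v = (\<Sum>b \<in> Poly_Mapping.keys v. Poly_Mapping.lookup v b * w b)"

lemma weighted_sum_superset:
  assumes "finite A" "Poly_Mapping.keys v \<subseteq> A"
  shows "weighted_sum w v = (\<Sum>b \<in> A. Poly_Mapping.lookup v b * w b)"
  unfolding weighted_sum_def
  by (rule sum.mono_neutral_left) (use assms in \<open>auto simp: in_keys_iff\<close>)

lemma weighted_sum_add: "weighted_sum w (u + v) = weighted_sum w u + weighted_sum w v"
proof -
  let ?A = "Poly_Mapping.keys u \<union> Poly_Mapping.keys v"
  show ?thesis
    using weighted_sum_superset[of ?A "u + v" w] weighted_sum_superset[of ?A u w]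
      weighted_sum_superset[of ?A v w] keys_add[of u v]
    by (simp add: lookup_add algebra_simps sum.distrib)
qed

lemma weighted_sum_scale: "weighted_sum w (c *\<^sub>K v) = c * weighted_sum w v"
proof -
  have "Poly_Mapping.keys (c *\<^sub>K v) \<subseteq> Poly_Mapping.keys v"
    by (auto simp: in_keys_iff)
  then show ?thesis
    using weighted_sum_superset[of "Poly_Mapping.keys v" "c *\<^sub>K v" w]
    by (simp add: weighted_sum_def sum_distrib_left mult.assoc)
qed

lemma weighted_sum_zero [simp]: "weighted_sum w 0 = 0"
  by (simp add: weighted_sum_def)

lemma weighted_sum_bvec [simp]: "weighted_sum w (bvec b) = w b"
  by (simp add: weighted_sum_def bvec_def)

lemma weighted_sum_sum: "weighted_sum w (sum f A) = (\<Sum>a\<in>A. weighted_sum w (f a))"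
  by (induction A rule: infinite_finite_induct) (auto simp: weighted_sum_add)

lemma weighted_sum_diff: "weighted_sum w (u - v) = weighted_sum w u - weighted_sum w v"
  using weighted_sum_add[of w "u - v" v] by simp

lemma lookup_bvec: "Poly_Mapping.lookup (bvec b) c = (if b = c then 1 else 0)"
  by (simp add: bvec_def lookup_single when_def)

lemma keys_bvec [simp]: "Poly_Mapping.keys (bvec b) = {b}"
  by (simp add: bvec_def)

lemma lookup_lin_ext:
  "Poly_Mapping.lookup (lin_ext f v) c = weighted_sum (\<lambda>b. Poly_Mapping.lookup (f b) c) v"
  by (simp add: lin_ext_def weighted_sum_def lookup_sum)

lemma lin_lin_ext [simp, intro]: "lin (lin_ext f)"
  by (rule linI; rule poly_mapping_eqI)
    (simp_all add: lookup_lin_ext weighted_sum_add weighted_sum_scale lookup_add)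

lemma lin_ext_bvec [simp]: "lin_ext f (bvec b) = f b"
  by (rule poly_mapping_eqI) (simp add: lookup_lin_ext)

lemma bvec_expansion: "v = (\<Sum>b \<in> Poly_Mapping.keys v. Poly_Mapping.lookup v b *\<^sub>K bvec b)"
proof (rule poly_mapping_eqI)
  fix c
  have "(\<Sum>b \<in> Poly_Mapping.keys v. Poly_Mapping.lookup v b * Poly_Mapping.lookup (bvec b) c)
      = (\<Sum>b \<in> Poly_Mapping.keys v. if b = c then Poly_Mapping.lookup v b else 0)"
    by (intro sum.cong) (auto simp: lookup_bvec)
  then show "Poly_Mapping.lookup v c = Poly_Mapping.lookup
      (\<Sum>b \<in> Poly_Mapping.keys v. Poly_Mapping.lookup v b *\<^sub>K bvec b) c"
    by (simp add: lookup_sum in_keys_iff)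
qed

lemma lin_eq_on_basis:
  assumes "lin S" "lin T" "\<And>b. b \<in> B \<Longrightarrow> S (bvec b) = T (bvec b)" "Poly_Mapping.keys v \<subseteq> B"
  shows "S v = T v"
proof -
  have "S v = (\<Sum>b \<in> Poly_Mapping.keys v. Poly_Mapping.lookup v b *\<^sub>K S (bvec b))"
    by (subst bvec_expansion) (simp add: lin_sum[OF assms(1)] lin_scale[OF assms(1)])
  also have "\<dots> = (\<Sum>b \<in> Poly_Mapping.keys v. Poly_Mapping.lookup v b *\<^sub>K T (bvec b))"
    by (rule sum.cong) (use assms in auto)
  also have "\<dots> = T v"
    by (subst (3) bvec_expansion) (simp add: lin_sum[OF assms(2)] lin_scale[OF assms(2)])
  finally show ?thesis .
qed

lemma lin_eqI:
  assumes "lin S" "lin T" "\<And>b. S (bvec b) = T (bvec b)"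
  shows "S v = T v"
  using lin_eq_on_basis[of S T UNIV v] assms by auto

lemma subspace_contains_support:
  assumes "VS.subspace N" "\<And>b. b \<in> Poly_Mapping.keys v \<Longrightarrow> bvec b \<in> N"
  shows "v \<in> N"
  by (subst bvec_expansion) (intro VS.subspace_sum VS.subspace_scale assms)

subsection \<open>Tensor products\<close>

lemma lookup_tens [simp]:
  "Poly_Mapping.lookup (tens u v) (a, b) = Poly_Mapping.lookup u a * Poly_Mapping.lookup v b"
proof -
  have inner: "weighted_sum (\<lambda>c. if (a', c) = (a, b) then 1 else 0) v
      = (if a' = a then Poly_Mapping.lookup v b else 0)" for a'
    by (auto simp: weighted_sum_def in_keys_iff if_distrib cong: if_cong)
  have "Poly_Mapping.lookup (tens u v) (a, b)
      = weighted_sum (\<lambda>a'. if a' = a then Poly_Mapping.lookup v b else 0) u"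
    unfolding tens_def lookup_lin_ext lookup_bvec inner ..
  also have "\<dots> = Poly_Mapping.lookup u a * Poly_Mapping.lookup v b"
    by (auto simp: weighted_sum_def in_keys_iff if_distrib cong: if_cong)
  finally show ?thesis .
qed

lemma pair_poly_mapping_eqI:
  "(\<And>a b. Poly_Mapping.lookup u (a, b) = Poly_Mapping.lookup v (a, b)) \<Longrightarrow> u = v"
  by (rule poly_mapping_eqI) auto

lemma tens_add_left: "tens (u + u') v = tens u v + tens u' v"
  and tens_add_right: "tens u (v + v') = tens u v + tens u v'"
  and tens_diff_left: "tens (u - u') v = tens u v - tens u' v"
  and tens_diff_right: "tens u (v - v') = tens u v - tens u v'"
  and tens_scale_left: "tens (c *\<^sub>K u) v = c *\<^sub>K tens u v"
  and tens_scale_right: "tens u (c *\<^sub>K v) = c *\<^sub>K tens u v"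
  by (rule pair_poly_mapping_eqI; simp add: lookup_add lookup_minus algebra_simps)+

lemma tens_zero [simp]: "tens 0 v = 0" "tens u 0 = 0"
  by (rule pair_poly_mapping_eqI; simp)+

lemma tens_bvec [simp]: "tens (bvec a) (bvec b) = bvec (a, b)"
  by (simp add: tens_def)

lemma lin_tens_left: "lin (\<lambda>u. tens u v)" and lin_tens_right: "lin (tens u)"
  by (rule linI; simp add: tens_add_left tens_add_right tens_scale_left tens_scale_right)+

lemma lin_tens_op [simp, intro]: "lin (tens_op S T)"
  by (simp add: tens_op_def)

lemma tens_op_bvec: "tens_op S T (bvec (a, b)) = tens (S (bvec a)) (T (bvec b))"
  by (simp add: tens_op_def)

lemma tens_op_tens:
  assumes "lin S" "lin T"
  shows "tens_op S T (tens u v) = tens (S u) (T v)"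
proof -
  have inner: "tens_op S T (tens (bvec a) v) = tens (S (bvec a)) (T v)" for a
    by (rule lin_eqI[OF lin_comp[OF lin_tens_op lin_tens_right] lin_comp[OF lin_tens_right assms(2)]])
      (simp add: tens_op_bvec)
  show ?thesis
    by (rule lin_eqI[OF lin_comp[OF lin_tens_op lin_tens_left] lin_comp[OF lin_tens_left assms(1)]])
      (rule inner)
qed

lemma tens_op_compose:
  assumes "lin S" "lin T"
  shows "tens_op S T (tens_op S' T' v) = tens_op (S \<circ> S') (T \<circ> T') v"
proof (rule lin_eqI[OF lin_comp[OF lin_tens_op lin_tens_op] lin_tens_op])
  fix b show "tens_op S T (tens_op S' T' (bvec b)) = tens_op (S \<circ> S') (T \<circ> T') (bvec b)"
    by (cases b) (simp add: tens_op_bvec tens_op_tens assms)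
qed

lemma tens_op_id [simp]: "tens_op id id v = v"
proof (rule lin_eqI[OF lin_tens_op lin_ident])
  fix b show "tens_op id id (bvec b) = bvec b"
    by (cases b) (simp add: tens_op_bvec)
qed

lemma lin_flip [simp, intro]: "lin flip"
  by (simp add: flip_def)

lemma flip_bvec [simp]: "flip (bvec (a, b)) = bvec (b, a)"
  by (simp add: flip_def)

lemma flip_flip [simp]: "flip (flip v) = v"
proof (rule lin_eqI[OF lin_comp[OF lin_flip lin_flip] lin_ident])
  fix b show "flip (flip (bvec b)) = bvec b"
    by (cases b) simp
qed

lemma lookup_flip: "Poly_Mapping.lookup (flip v) (a, b) = Poly_Mapping.lookup v (b, a)"
proof -
  have "(\<lambda>ba. Poly_Mapping.lookup (case ba of (a, b) \<Rightarrow> bvec (b, a)) (a, b))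
      = (\<lambda>ba. if ba = (b, a) then 1 else 0)"
    by (auto simp: lookup_bvec fun_eq_iff)
  then show ?thesis
    unfolding flip_def lookup_lin_ext
    by (auto simp: weighted_sum_def in_keys_iff if_distrib cong: if_cong)
qed

lemma flip_tens [simp]: "flip (tens u v) = tens v u"
  by (rule pair_poly_mapping_eqI) (simp add: lookup_flip)

lemma flip_tens_op: "flip (tens_op S T v) = tens_op T S (flip v)"
proof (rule lin_eqI[OF lin_comp[OF lin_flip lin_tens_op] lin_comp[OF lin_tens_op lin_flip]])
  fix b show "flip (tens_op S T (bvec b)) = tens_op T S (flip (bvec b))"
    by (cases b) (simp add: tens_op_bvec)
qed

section \<open>The free algebra and its action on a tensor square\<close>

lemma one_eq_bvec: "(1 :: 'b::monoid_add \<Rightarrow>\<^sub>0 fld) = bvec 0"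
  by (simp add: bvec_def)

lemma bvec_mult: "bvec v * bvec w = bvec (v + w :: 'b::monoid_add)"
  by (simp add: bvec_def mult_single)

lemma scale_mult_left: "(c *\<^sub>K a) * b = c *\<^sub>K (a * b :: 'b::monoid_add \<Rightarrow>\<^sub>0 fld)"
  by (simp add: scl_def mult_map_scale_conv_mult mult.assoc)

lemma lin_mult_left: "lin (\<lambda>a. a * b :: 'b::monoid_add \<Rightarrow>\<^sub>0 fld)"
  by (rule linI) (simp_all add: scale_mult_left distrib_right)

text \<open>
  Scalars are central: \<open>single 0 c\<close> commutes with every basis vector because \<open>0\<close> is the unit of the
  monoid, even if the monoid is not commutative.
\<close>

lemma scale_mult_right: "a * (c *\<^sub>K b) = c *\<^sub>K (a * b :: 'b::monoid_add \<Rightarrow>\<^sub>0 fld)"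
proof -
  have "a * Poly_Mapping.single 0 c = c *\<^sub>K a"
  proof (rule lin_eqI[OF lin_mult_left lin_scl])
    show "bvec w * Poly_Mapping.single 0 c = c *\<^sub>K bvec w" for w :: 'b
      by (simp add: bvec_def mult_single scl_def)
  qed
  then have "a * (c *\<^sub>K b) = (c *\<^sub>K a) * b"
    by (simp add: scl_def mult_map_scale_conv_mult flip: mult.assoc)
  then show ?thesis
    by (simp add: scale_mult_left)
qed

lemma lin_mult_right: "lin (\<lambda>b. a * b :: 'b::monoid_add \<Rightarrow>\<^sub>0 fld)"
  by (rule linI) (simp_all add: scale_mult_right distrib_left)

lemma lin_coprod [simp, intro]: "lin coprod"
  by (simp add: coprod_def)

lemma coprod_mult: "coprod (a * b) = coprod a * coprod b"
proof -
  have words: "coprod (bvec v * bvec w) = coprod (bvec v) * coprod (bvec w)" for v w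
    by (simp add: coprod_def bvec_mult plus_gword_def)
  have "coprod (bvec v * b) = coprod (bvec v) * coprod b" for v
    by (rule lin_eqI[OF lin_comp[OF lin_coprod lin_mult_right] lin_comp[OF lin_mult_right lin_coprod]])
      (rule words)
  then show ?thesis
    by (rule lin_eqI[OF lin_comp[OF lin_coprod lin_mult_left] lin_comp[OF lin_mult_left lin_coprod]])
qed

lemma coprod_one: "coprod 1 = 1"
  by (simp add: one_eq_bvec[where 'b = gword] coprod_def zero_gword_def)

lemma coprod_fgen: "coprod (fgen g) = coprod_gen g"
  by (simp add: fgen_def coprod_def)

abbreviation rep_op :: "nat \<Rightarrow> nat \<Rightarrow> fld \<Rightarrow> gen \<Rightarrow> vec \<Rightarrow> vec" where
  "rep_op \<kappa> \<kappa>' u g \<equiv> lin_ext (rep_gen \<kappa> \<kappa>' u g)"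

lemma rep_word_empty: "rep_word \<kappa> \<kappa>' u 0 = id"
  by (simp add: rep_word_def zero_gword_def)

lemma rep_word_single: "rep_word \<kappa> \<kappa>' u (Word [g]) = rep_op \<kappa> \<kappa>' u g"
  by (simp add: rep_word_def)

lemma rep_word_plus: "rep_word \<kappa> \<kappa>' u (v + w) = rep_word \<kappa> \<kappa>' u v \<circ> rep_word \<kappa> \<kappa>' u w"
proof -
  have "foldr (\<lambda>g T. rep_op \<kappa> \<kappa>' u g \<circ> T) gs S = foldr (\<lambda>g T. rep_op \<kappa> \<kappa>' u g \<circ> T) gs id \<circ> S"
    for gs S
    by (induction gs) auto
  then show ?thesis
    by (simp add: rep_word_def plus_gword_def)
qed

lemma lin_rep_word [simp, intro]: "lin (rep_word \<kappa> \<kappa>' u w)"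
proof -
  have "lin (foldr (\<lambda>g T. rep_op \<kappa> \<kappa>' u g \<circ> T) gs id)" for gs
  proof (induction gs)
    case Nil
    then show ?case using lin_ident by (simp add: id_def)
  next
    case (Cons g gs)
    then show ?case using lin_comp[OF lin_lin_ext Cons.IH] by (simp add: o_def)
  qed
  then show ?thesis
    by (simp add: rep_word_def)
qed

lemma lin_rep2_left: "lin (\<lambda>t. rep2 \<kappa> \<kappa>' u v t \<psi>)"
  by (simp add: rep2_def)

lemma rep2_bvec: "rep2 \<kappa> \<kappa>' u v (bvec (w1, w2)) \<psi>
    = tens_op (rep_word \<kappa> \<kappa>' u w1) (rep_word \<kappa> \<kappa>' v w2) \<psi>"
  by (simp add: rep2_def)

lemma lin_rep2 [simp, intro]: "lin (rep2 \<kappa> \<kappa>' u v t)"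
proof (rule linI)
  show "rep2 \<kappa> \<kappa>' u v t (\<psi> + \<phi>) = rep2 \<kappa> \<kappa>' u v t \<psi> + rep2 \<kappa> \<kappa>' u v t \<phi>" for \<psi> \<phi>
    by (rule lin_eqI[OF lin_rep2_left lin_plus[OF lin_rep2_left lin_rep2_left]])
      (auto simp: rep2_def lin_add[OF lin_tens_op])
  show "rep2 \<kappa> \<kappa>' u v t (c *\<^sub>K \<psi>) = c *\<^sub>K rep2 \<kappa> \<kappa>' u v t \<psi>" for c \<psi>
    by (rule lin_eqI[OF lin_rep2_left lin_comp[OF lin_scl lin_rep2_left]])
      (auto simp: rep2_def lin_scale[OF lin_tens_op])
qed

lemma rep2_mult: "rep2 \<kappa> \<kappa>' u v (s * t) \<psi> = rep2 \<kappa> \<kappa>' u v s (rep2 \<kappa> \<kappa>' u v t \<psi>)"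
proof -
  have words: "rep2 \<kappa> \<kappa>' u v (bvec a * bvec b) \<psi>
      = rep2 \<kappa> \<kappa>' u v (bvec a) (rep2 \<kappa> \<kappa>' u v (bvec b) \<psi>)" for a b
    by (cases a; cases b)
      (simp add: bvec_mult rep2_bvec rep_word_plus tens_op_compose)
  have "rep2 \<kappa> \<kappa>' u v (bvec a * t) \<psi> = rep2 \<kappa> \<kappa>' u v (bvec a) (rep2 \<kappa> \<kappa>' u v t \<psi>)" for a
    by (rule lin_eqI[OF lin_comp[OF lin_rep2_left lin_mult_right] lin_comp[OF lin_rep2 lin_rep2_left]])
      (rule words)
  then show ?thesis
    by (rule lin_eqI[OF lin_comp[OF lin_rep2_left lin_mult_left] lin_rep2_left])
qed

lemma rep2_one: "rep2 \<kappa> \<kappa>' u v 1 \<psi> = \<psi>"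
  by (simp add: one_eq_bvec zero_prod_def rep2_bvec rep_word_empty)

text \<open>
  Exchanging the tensor factors exchanges the two spectral parameters. This reduces the opposite
  coproduct to the coproduct.
\<close>

lemma rep2_flip: "rep2 \<kappa> \<kappa>' u v (flip t) \<psi> = flip (rep2 \<kappa> \<kappa>' v u t (flip \<psi>))"
proof (rule lin_eqI[OF lin_comp[OF lin_rep2_left lin_flip] lin_comp[OF lin_flip lin_rep2_left]])
  show "rep2 \<kappa> \<kappa>' u v (flip (bvec b)) \<psi> = flip (rep2 \<kappa> \<kappa>' v u (bvec b) (flip \<psi>))" for b
    by (cases b) (simp add: rep2_bvec flip_tens_op)
qed

text \<open>
  The counterpart of \<open>act\<close> on representatives in the free algebra; being given by a formula and
  not by a choice from a class, it is linear by construction.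
\<close>

definition free_act :: "nat \<Rightarrow> nat \<Rightarrow> fld \<Rightarrow> fld \<Rightarrow> free \<Rightarrow> vec2 \<Rightarrow> vec2" where
  "free_act \<kappa> \<kappa>' u v a \<psi> = rep2 \<kappa> \<kappa>' u v (coprod a) \<psi>"

lemma lin_free_act [simp, intro]: "lin (free_act \<kappa> \<kappa>' u v a)"
  using lin_rep2 by (simp add: free_act_def[abs_def])

lemma lin_free_act_left [simp, intro]: "lin (\<lambda>a. free_act \<kappa> \<kappa>' u v a \<psi>)"
  unfolding free_act_def by (rule lin_comp[OF lin_rep2_left lin_coprod])

lemma free_act_mult: "free_act \<kappa> \<kappa>' u v (a * b) \<psi> = free_act \<kappa> \<kappa>' u v a (free_act \<kappa> \<kappa>' u v b \<psi>)"
  by (simp add: free_act_def coprod_mult rep2_mult)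

lemma free_act_one: "free_act \<kappa> \<kappa>' u v 1 \<psi> = \<psi>"
  by (simp add: free_act_def coprod_one rep2_one)

lemma free_act_E: "free_act \<kappa> \<kappa>' u v (fgen (E i)) \<psi>
    = tens_op id (rep_op \<kappa> \<kappa>' v (E i)) \<psi> + tens_op (rep_op \<kappa> \<kappa>' u (E i)) (rep_op \<kappa> \<kappa>' v (K i)) \<psi>"
  and free_act_F: "free_act \<kappa> \<kappa>' u v (fgen (F i)) \<psi>
    = tens_op (rep_op \<kappa> \<kappa>' u (F i)) id \<psi> + tens_op (rep_op \<kappa> \<kappa>' u (Kinv i)) (rep_op \<kappa> \<kappa>' v (F i)) \<psi>"
  and free_act_K: "free_act \<kappa> \<kappa>' u v (fgen (K i)) \<psi>
    = tens_op (rep_op \<kappa> \<kappa>' u (K i)) (rep_op \<kappa> \<kappa>' v (K i)) \<psi>"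
  and free_act_Kinv: "free_act \<kappa> \<kappa>' u v (fgen (Kinv i)) \<psi>
    = tens_op (rep_op \<kappa> \<kappa>' u (Kinv i)) (rep_op \<kappa> \<kappa>' v (Kinv i)) \<psi>"
  by (simp_all add: free_act_def coprod_fgen lin_add[OF lin_rep2_left] rep2_bvec rep_word_empty
      rep_word_single)

lemma carrier_free_alg: "a \<in> carrier (free_alg J)
    \<longleftrightarrow> (\<forall>w \<in> Poly_Mapping.keys a. \<forall>g \<in> set (letters w). gen_index g \<in> J)"
  by (simp add: free_alg_def)

lemma free_alg_simps [simp]:
  "mult (free_alg J) = (*)" "one (free_alg J) = 1" "ring.zero (free_alg J) = 0"
  "add (free_alg J) = (+)"
  by (simp_all add: free_alg_def)

lemma free_alg_add: "a \<in> carrier (free_alg J) \<Longrightarrow> b \<in> carrier (free_alg J) \<Longrightarrow> a + b \<in> carrier (free_alg J)"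
  unfolding carrier_free_alg using keys_add[of a b] by blast

lemma free_alg_mult:
  assumes "a \<in> carrier (free_alg J)" "b \<in> carrier (free_alg J)"
  shows "a * b \<in> carrier (free_alg J)"
  unfolding carrier_free_alg
proof (intro ballI)
  fix w g assume "w \<in> Poly_Mapping.keys (a * b)" "g \<in> set (letters w)"
  then obtain v v' where "w = v + v'" "v \<in> Poly_Mapping.keys a" "v' \<in> Poly_Mapping.keys b"
    using keys_mult[of a b] by blast
  then show "gen_index g \<in> J"
    using assms \<open>g \<in> set (letters w)\<close> by (auto simp: carrier_free_alg plus_gword_def)
qed

lemma free_alg_scale: "a \<in> carrier (free_alg J) \<Longrightarrow> c *\<^sub>K a \<in> carrier (free_alg J)"
  by (auto simp: carrier_free_alg in_keys_iff)

lemma free_alg_zero: "0 \<in> carrier (free_alg J)" and free_alg_one: "1 \<in> carrier (free_alg J)"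
  by (auto simp: carrier_free_alg zero_gword_def)

lemma free_alg_uminus: "a \<in> carrier (free_alg J) \<Longrightarrow> - a \<in> carrier (free_alg J)"
  using free_alg_scale[of a J "-1"] by (simp add: carrier_free_alg in_keys_iff)

lemma free_alg_minus:
  "a \<in> carrier (free_alg J) \<Longrightarrow> b \<in> carrier (free_alg J) \<Longrightarrow> a - b \<in> carrier (free_alg J)"
  using free_alg_add[OF _ free_alg_uminus, of a J b] by simp

lemma free_alg_fgen: "gen_index g \<in> J \<Longrightarrow> fgen g \<in> carrier (free_alg J)"
  by (simp add: carrier_free_alg fgen_def)

lemma ring_free_alg: "ring (free_alg J)"
proof (rule ringI)
  show "abelian_group (free_alg J)"
  proof (rule abelian_groupI)
    show "\<exists>y\<in>carrier (free_alg J). y \<oplus>\<^bsub>free_alg J\<^esub> x = \<zero>\<^bsub>free_alg J\<^esub>"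
      if "x \<in> carrier (free_alg J)" for x
      using that by (intro bexI[of _ "- x"]) (auto intro: free_alg_uminus)
  qed (simp_all add: free_alg_add free_alg_zero add_ac)
  show "Group.monoid (free_alg J)"
    by (rule monoidI) (simp_all add: free_alg_mult free_alg_one mult.assoc)
qed (simp_all add: algebra_simps)

lemma free_alg_a_inv:
  assumes "a \<in> carrier (free_alg J)"
  shows "\<ominus>\<^bsub>free_alg J\<^esub> a = - a"
proof -
  interpret ring "free_alg J" by (rule ring_free_alg)
  show ?thesis
    using minus_equality[of "- a" a] assms free_alg_uminus by auto
qed

text \<open>
  Monomials are built from \<open>1\<close> by left multiplication with generators, so a property of all elements
  needs checking only for generators acting on elements that have it.
\<close>

lemma free_alg_induct:
  assumes "a \<in> carrier (free_alg J)" "VS.subspace N" "1 \<in> N"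
    "\<And>g b. gen_index g \<in> J \<Longrightarrow> b \<in> N \<Longrightarrow> fgen g * b \<in> N"
  shows "a \<in> N"
proof (rule subspace_contains_support[OF assms(2)])
  fix w assume "w \<in> Poly_Mapping.keys a"
  then have "\<forall>g \<in> set (letters w). gen_index g \<in> J"
    using assms(1) by (simp add: carrier_free_alg)
  then have "bvec (Word (letters w)) \<in> N"
  proof (induction "letters w" arbitrary: w)
    case Nil
    then show ?case using assms(3) by (simp add: one_eq_bvec zero_gword_def flip: Nil)
  next
    case (Cons g gs)
    have "bvec (Word (g # gs)) = fgen g * bvec (Word gs)"
      by (simp add: fgen_def bvec_mult plus_gword_def)
    moreover have "bvec (Word gs) \<in> N"
      using Cons.hyps(1)[of "Word gs"] Cons.prems Cons.hyps(2) by (metis gword.sel list.set_intros(2))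
    ultimately show ?case
      using assms(4) Cons.prems by (metis Cons.hyps(2) list.set_intros(1))
  qed
  then show "bvec w \<in> N" by simp
qed

section \<open>Generic parameters\<close>

definition emb :: "complex poly poly poly \<Rightarrow> fld" where
  "emb a = Fraction_Field.Fract a 1"

text \<open>
  Elements of the ground field are shown to be distinct by evaluating at \<open>y = 0\<close>, \<open>x = 1\<close>,
  \<open>q\<^sup>1\<^sup>/\<^sup>2 = 2\<close>. At this point \<open>x + q\<^sup>j y\<close> is \<open>1\<close> while \<open>y + q\<^sup>j x\<close> is \<open>4\<^sup>j\<close>.
\<close>

definition specialise :: "complex poly poly poly \<Rightarrow> complex" where
  "specialise a = poly (poly (poly a 0) 1) 2"

lemma emb_eq_iff [simp]: "emb a = emb b \<longleftrightarrow> a = b"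
  by (simp add: emb_def eq_fract)

lemma emb_one: "emb 1 = 1"
  by (simp add: emb_def One_fract_def)

lemma emb_zero: "emb 0 = 0"
  by (simp add: emb_def Zero_fract_def)

lemma emb_add: "emb (a + b) = emb a + emb b"
  and emb_mult: "emb (a * b) = emb a * emb b"
  by (simp_all add: emb_def)

lemma emb_power: "emb (a ^ k) = emb a ^ k"
  by (induction k) (simp_all add: emb_one emb_mult)

lemma emb_prod: "emb (prod f A) = (\<Prod>a\<in>A. emb (f a))"
  by (induction A rule: infinite_finite_induct) (simp_all add: emb_one emb_mult)

abbreviation (input) "qhalf_poly \<equiv> [:[:[:0, 1:]:]:] :: complex poly poly poly"
abbreviation (input) "x_poly \<equiv> [:[:0, 1:]:] :: complex poly poly poly"
abbreviation (input) "y_poly \<equiv> [:0, 1:] :: complex poly poly poly"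

lemma emb_generators: "qhalf = emb qhalf_poly" "xvar = emb x_poly" "yvar = emb y_poly"
  by (simp_all add: emb_def qhalf_def xvar_def yvar_def)

lemma specialise_simps:
  "specialise (a + b) = specialise a + specialise b"
  "specialise (a * b) = specialise a * specialise b"
  "specialise (a ^ k) = specialise a ^ k"
  "specialise (prod f A) = (\<Prod>a\<in>A. specialise (f a))"
  "specialise 1 = 1" "specialise 0 = 0"
  "specialise qhalf_poly = 2" "specialise x_poly = 1" "specialise y_poly = 0"
  by (simp_all add: specialise_def poly_prod)

lemma q_power_emb: "q ^ j = emb (qhalf_poly ^ (2 * j))"
  by (simp only: q_def emb_generators emb_power power_mult)

lemma qhalf_nonzero [simp]: "qhalf \<noteq> 0"
  unfolding emb_generators emb_zero[symmetric] emb_eq_iff by simp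

lemma xvar_nonzero [simp]: "xvar \<noteq> 0" and yvar_nonzero [simp]: "yvar \<noteq> 0"
  unfolding emb_generators emb_zero[symmetric] emb_eq_iff by simp_all

lemma q_nonzero [simp]: "q \<noteq> 0"
  by (simp add: q_def)

lemma qhalf_power_neq_one:
  assumes "k > 0" shows "qhalf ^ k \<noteq> 1"
proof
  assume "qhalf ^ k = 1"
  then have "emb (qhalf_poly ^ k) = emb 1"
    by (simp only: emb_power emb_one emb_generators)
  then have "specialise (qhalf_poly ^ k) = specialise 1"
    by (simp only: emb_eq_iff)
  then have "(2::complex) ^ k = 1"
    by (simp only: specialise_simps)
  then have "cmod (2 ^ k) = 1" by simp
  then have "(2::real) ^ k = 1" by (simp add: norm_power)
  then show False using assms one_less_power[of "2::real" k] by simp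
qed

lemma q_power_neq_one: "k > 0 \<Longrightarrow> q ^ k \<noteq> 1"
  using qhalf_power_neq_one[of "2 * k"] by (simp add: q_def power_mult)

lemma q_powi_neq_one: "k \<noteq> 0 \<Longrightarrow> q powi k \<noteq> 1"
  using q_power_neq_one[of "nat \<bar>k\<bar>"] 
  by (cases "k > 0") (auto simp: power_int_def power_inverse)

lemma q_powi_inj: "q powi a = q powi b \<longleftrightarrow> a = b"
proof
  assume "q powi a = q powi b"
  then have "q powi (a - b) = 1"
    by (simp add: power_int_diff)
  then show "a = b" using q_powi_neq_one[of "a - b"] by force
qed simp

lemma y_plus_qx_nonzero: "yvar + q ^ j * xvar \<noteq> 0"
proof
  assume "yvar + q ^ j * xvar = 0"
  then have "emb (y_poly + qhalf_poly ^ (2 * j) * x_poly) = emb 0"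
    by (simp only: emb_generators(2,3) q_power_emb emb_add emb_mult emb_zero)
  then have "specialise (y_poly + qhalf_poly ^ (2 * j) * x_poly) = specialise 0"
    by (simp only: emb_eq_iff)
  then show False by (simp only: specialise_simps) simp
qed

lemma x_plus_qy_nonzero: "xvar + q ^ j * yvar \<noteq> 0"
proof
  assume "xvar + q ^ j * yvar = 0"
  then have "emb (x_poly + qhalf_poly ^ (2 * j) * y_poly) = emb 0"
    by (simp only: emb_generators(2,3) q_power_emb emb_add emb_mult emb_zero)
  then have "specialise (x_poly + qhalf_poly ^ (2 * j) * y_poly) = specialise 0"
    by (simp only: emb_eq_iff)
  then show False by (simp only: specialise_simps) simp
qed

text \<open>
  At the chosen point the left side is \<open>1\<close> and the right side is a power of \<open>2\<close> with positive
  exponent. This is what makes the eigenvalues \<open>\<rho>\<^sub>l\<close> pairwise distinct.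
\<close>

lemma prod_x_qy_neq_prod_y_qx:
  assumes "finite S" "S \<noteq> {}" "0 \<notin> S"
  shows "(\<Prod>j\<in>S. xvar + q ^ j * yvar) \<noteq> (\<Prod>j\<in>S. yvar + q ^ j * xvar)"
proof
  assume "(\<Prod>j\<in>S. xvar + q ^ j * yvar) = (\<Prod>j\<in>S. yvar + q ^ j * xvar)"
  then have "emb (\<Prod>j\<in>S. x_poly + qhalf_poly ^ (2 * j) * y_poly)
      = emb (\<Prod>j\<in>S. y_poly + qhalf_poly ^ (2 * j) * x_poly)"
    by (simp only: emb_generators(2,3) q_power_emb emb_add emb_mult emb_prod)
  then have "specialise (\<Prod>j\<in>S. x_poly + qhalf_poly ^ (2 * j) * y_poly)
      = specialise (\<Prod>j\<in>S. y_poly + qhalf_poly ^ (2 * j) * x_poly)"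
    by (simp only: emb_eq_iff)
  then have "(\<Prod>j\<in>S. 2 ^ (2 * j)) = (1 :: complex)"
    by (simp only: specialise_simps) simp
  then have "2 ^ (\<Sum>j\<in>S. 2 * j) = (1 :: complex)"
    by (simp add: power_sum)
  then have "cmod (2 ^ (\<Sum>j\<in>S. 2 * j)) = 1" by simp
  then have "(2::real) ^ (\<Sum>j\<in>S. 2 * j) = 1" by (simp add: norm_power)
  then have "(\<Sum>j\<in>S. 2 * j) = 0" using one_less_power[of "2::real" "\<Sum>j\<in>S. 2 * j"] by fastforce
  then show False using assms by (metis (no_types, lifting) all_not_in_conv mult_eq_0_iff sum_eq_0_iff zero_neq_numeral)
qed

lemma const_i_square: "const \<i> * const \<i> = - 1"
proof -
  have "const \<i> * const \<i> = Fraction_Field.Fract (- 1) 1"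
    by (simp add: const_def one_pCons)
  then show ?thesis by (simp add: One_fract_def)
qed

lemma p_square: "p * p = - inverse q"
proof -
  have "p * p = (const \<i> * const \<i>) * inverse (qhalf * qhalf)"
    by (simp add: p_def mult_ac)
  then show ?thesis by (simp add: const_i_square q_def power2_eq_square)
qed

lemma p_nonzero [simp]: "p \<noteq> 0"
  using p_square by force

lemma inverse_p: "inverse p = - q * p"
proof -
  have "(- q * p) * p = 1" using p_square by (simp add: mult.assoc)
  then show ?thesis by (metis inverse_unique mult.commute)
qed

lemma q_neq_inverse [simp]: "q \<noteq> inverse q"
proof
  assume "q = inverse q"
  then have "q * q = inverse q * q" by (rule arg_cong)
  then have "q ^ 2 = 1" by (simp add: power2_eq_square)
  then show False using q_power_neq_one[of 2] by simp
qed

lemma one_plus_q_nonzero [simp]: "1 + q \<noteq> 0"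
proof
  assume "1 + q = 0"
  then have "q = - 1" by (simp add: add_eq_0_iff)
  have "q ^ 2 = (- 1) ^ 2" by (simp only: \<open>q = - 1\<close>)
  then have "q ^ 2 = 1" by simp
  then show False using q_power_neq_one[of 2] by simp
qed

lemma p_minus_inverse: "p - inverse p = p * (1 + q)"
  by (simp add: inverse_p algebra_simps)

lemma p_minus_inverse_nonzero [simp]: "p - inverse p \<noteq> 0"
  by (simp only: p_minus_inverse) simp

lemma qint_0 [simp]: "qint 0 = 0" and qint_1 [simp]: "qint 1 = 1"
  by (simp_all add: qint_def)

lemma qint_nonzero:
  assumes "m \<noteq> 0" shows "qint m \<noteq> 0"
proof
  assume "qint m = 0"
  then have "q powi m = q powi (- m)" by (simp add: qint_def)
  then show False using q_powi_inj assms by auto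
qed

lemma qint_eq_0_iff: "qint m = 0 \<longleftrightarrow> m = 0"
  using qint_nonzero by auto

text \<open>
  The commutator \<open>[e\<^sub>i, f\<^sub>i]\<close> on two neighbouring bosonic entries \<open>a\<close> and \<open>b\<close>.
\<close>

lemma qint_neighbours_diff:
  "qint (a + 1) * qint b - qint a * qint (b + 1) = qint (b - a)"
proof -
  define A where "A = q powi a"
  define B where "B = q powi b"
  define d where "d = q - inverse q"
  have nz: "A \<noteq> 0" "B \<noteq> 0" "d \<noteq> 0" by (simp_all add: A_def B_def d_def)
  have 1: "qint (a + 1) = (A * q - inverse A * inverse q) / d"
    "qint a = (A - inverse A) / d" "qint b = (B - inverse B) / d"
    "qint (b + 1) = (B * q - inverse B * inverse q) / d"
    "qint (b - a) = (B * inverse A - A * inverse B) / d"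
    by (simp_all add: qint_def A_def B_def d_def power_int_add power_int_diff power_int_minus
        divide_inverse mult.commute)
  have "(A * q - inverse A * inverse q) * (B - inverse B) - (A - inverse A) * (B * q - inverse B * inverse q)
      = d * (B * inverse A - A * inverse B)"
    using nz by (simp add: d_def algebra_simps)
  then have "(A * q - inverse A * inverse q) * (B - inverse B) / (d * d)
      - (A - inverse A) * (B * q - inverse B * inverse q) / (d * d) = (B * inverse A - A * inverse B) / d"
    using nz by (simp flip: diff_divide_distrib)
  then show ?thesis
    unfolding 1 by simp
qed

text \<open>
  The commutator \<open>[e\<^sub>n, f\<^sub>n]\<close> on the last entry; the particular value of \<open>p\<close> enters through
  \<open>p\<^sup>2 = - q\<^sup>-\<^sup>1\<close>.
\<close>

lemma qint_succ_diff: "(qint (m + 1) - qint m) * (p - inverse p) = p * q powi (- m) - inverse p * q powi m"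
proof -
  define A where "A = q powi m"
  define d where "d = q - inverse q"
  have nz: "A \<noteq> 0" "d \<noteq> 0" by (simp_all add: A_def d_def)
  have 1: "qint (m + 1) = (A * q - inverse A * inverse q) / d" "qint m = (A - inverse A) / d"
    by (simp_all add: qint_def A_def d_def power_int_add power_int_diff power_int_minus divide_inverse)
  have "(A * q - inverse A * inverse q - (A - inverse A)) * (1 + q) = d * (inverse A + q * A)"
    using nz by (simp add: d_def algebra_simps)
  then have "(qint (m + 1) - qint m) * (1 + q) = inverse A + q * A"
    unfolding 1 using nz by (simp flip: diff_divide_distrib)
  then have "(qint (m + 1) - qint m) * (p * (1 + q)) = p * (inverse A + q * A)"
    by (simp add: mult_ac)
  then show ?thesis
    unfolding p_minus_inverse
    by (simp add: inverse_p A_def power_int_minus algebra_simps)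
qed

section \<open>q-binomial sums\<close>

lemma qint_addition: "q powi a * qint (a + b) = qint b + q powi (a + b) * qint a"
proof -
  define A where "A = q powi a"
  define B where "B = q powi b"
  define d where "d = q - inverse q"
  have nz: "A \<noteq> 0" "B \<noteq> 0" by (simp_all add: A_def B_def)
  have 1: "qint (a + b) = (A * B - inverse A * inverse B) / d"
    "qint a = (A - inverse A) / d" "qint b = (B - inverse B) / d"
    by (simp_all add: qint_def A_def B_def d_def power_int_add power_int_diff power_int_minus divide_inverse)
  have "A * (A * B - inverse A * inverse B) = (B - inverse B) + A * B * (A - inverse A)"
    using nz by (simp add: field_simps)
  then show ?thesis
    unfolding 1 power_int_add[OF disjI1[OF q_nonzero]] A_def[symmetric] B_def[symmetric]
    by (simp flip: add_divide_distrib)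
qed

lemma qfact_Suc: "qfact (Suc k) = qint (int (Suc k)) * qfact k"
  by (simp add: qfact_def)

lemma qfact_0 [simp]: "qfact 0 = 1"
  by (simp add: qfact_def)

lemma qfact_nonzero [simp]: "qfact k \<noteq> 0"
  by (simp add: qfact_def qint_eq_0_iff)

lemma qbinom_0 [simp]: "qbinom l 0 = 1" and qbinom_self [simp]: "qbinom l l = 1"
  by (simp_all add: qbinom_def)

lemma qbinom_nonzero: "qbinom l m \<noteq> 0"
  by (simp add: qbinom_def)

lemma qbinom_absorb:
  assumes "m < l"
  shows "qbinom l (Suc m) * qint (int (Suc m)) = qbinom l m * qint (int (l - m))"
proof -
  have "qfact (l - m) = qint (int (l - m)) * qfact (l - Suc m)"
    using qfact_Suc[of "l - Suc m"] assms by (simp only: Suc_diff_Suc)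
  moreover have "qint (int (l - m)) \<noteq> 0" "qint (int (Suc m)) \<noteq> 0"
    using assms by (simp_all add: qint_eq_0_iff del: of_nat_Suc)
  ultimately show ?thesis
    unfolding qbinom_def qfact_Suc by (simp add: divide_inverse del: of_nat_Suc)
qed

lemma qbinom_pascal:
  assumes "m < l"
  shows "q ^ Suc m * qbinom (Suc l) (Suc m) = qbinom l (Suc m) + q ^ Suc l * qbinom l m"
proof -
  define X where "X = qfact l / (qfact (Suc m) * qfact (l - m))"
  have sm: "qint (int (Suc m)) \<noteq> 0" by (simp add: qint_eq_0_iff del: of_nat_Suc)
  have lm: "qint (int (l - m)) \<noteq> 0" using assms by (simp add: qint_eq_0_iff)
  have "qbinom (Suc l) (Suc m) = qint (int (Suc l)) * X"
    by (simp add: qbinom_def X_def qfact_Suc del: of_nat_Suc)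
  moreover have bm: "qbinom l m = qint (int (Suc m)) * X"
    using sm by (simp add: qbinom_def X_def qfact_Suc del: of_nat_Suc)
  moreover have "qbinom l (Suc m) = qint (int (l - m)) * X"
    using qbinom_absorb[OF assms] sm unfolding bm by (simp del: of_nat_Suc add: mult_ac)
  moreover have "q ^ Suc m * qint (int (Suc l)) = qint (int (l - m)) + q ^ Suc l * qint (int (Suc m))"
  proof -
    have "int (Suc m) + int (l - m) = int (Suc l)" using assms by simp
    then show ?thesis
      using qint_addition[of "int (Suc m)" "int (l - m)"] by (simp only: power_int_of_nat)
  qed
  ultimately show ?thesis
    by (simp add: algebra_simps del: of_nat_Suc power_Suc)
qed

text \<open>
  The q-binomial theorem at the argument that occurs in \<open>psi_sing_vec\<close>. The Pascal rule splits the sum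
  for \<open>l + 1\<close> into the sum for \<open>l\<close> and its multiple by \<open>- q\<^sup>2\<^sup>l\<^sup>+\<^sup>1\<close>.
\<close>

lemma alternating_qbinom_sum:
  "(\<Sum>m = 0..l. (- 1) ^ m * q ^ (m * l) * qbinom l m) = (\<Prod>j<l. 1 - q ^ (2 * j + 1))"
proof (induction l)
  case 0
  then show ?case by simp
next
  case (Suc l)
  \<comment> \<open>By the truncated difference, \<open>qbinom l (l + 1)\<close> is not \<open>0\<close>; the Pascal rule at the boundary needs
    this convention.\<close>
  define B where "B k m = (if m \<le> k then qbinom k m else 0)" for k m
  have pascal: "q ^ Suc m * B (Suc l) (Suc m) = B l (Suc m) + q ^ Suc l * B l m" if "m \<le> l" for m
    using that qbinom_pascal[of m l] by (cases "m = l") (auto simp: B_def)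
  have "(\<Sum>m = 0..Suc l. (- 1) ^ m * q ^ (m * Suc l) * qbinom (Suc l) m)
      = 1 + (\<Sum>m = 0..l. (- 1) ^ Suc m * q ^ (Suc m * Suc l) * B (Suc l) (Suc m))"
    by (subst sum.atLeast0_atMost_Suc_shift) (simp add: B_def)
  also have "(\<Sum>m = 0..l. (- 1) ^ Suc m * q ^ (Suc m * Suc l) * B (Suc l) (Suc m))
      = (\<Sum>m = 0..l. (- 1) ^ Suc m * q ^ (Suc m * l) * B l (Suc m))
        - q ^ (2 * l + 1) * (\<Sum>m = 0..l. (- 1) ^ m * q ^ (m * l) * B l m)"
    unfolding sum_distrib_left sum_subtractf[symmetric]
  proof (rule sum.cong[OF refl])
    fix m assume "m \<in> {0..l}"
    then have "(- 1) ^ Suc m * q ^ (Suc m * Suc l) * B (Suc l) (Suc m)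
        = (- 1) ^ Suc m * q ^ (Suc m * l) * (q ^ Suc m * B (Suc l) (Suc m))"
      by (simp add: power_add mult_ac)
    also have "\<dots> = (- 1) ^ Suc m * q ^ (Suc m * l) * (B l (Suc m) + q ^ Suc l * B l m)"
      using \<open>m \<in> {0..l}\<close> pascal by simp
    also have "\<dots> = (- 1) ^ Suc m * q ^ (Suc m * l) * B l (Suc m)
        - q ^ (2 * l + 1) * ((- 1) ^ m * q ^ (m * l) * B l m)"
      by (simp add: algebra_simps power_add mult_2 mult_2_right)
    finally show "(- 1) ^ Suc m * q ^ (Suc m * Suc l) * B (Suc l) (Suc m)
        = (- 1) ^ Suc m * q ^ (Suc m * l) * B l (Suc m)
          - q ^ (2 * l + 1) * ((- 1) ^ m * q ^ (m * l) * B l m)" .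
  qed
  also have "1 + ((\<Sum>m = 0..l. (- 1) ^ Suc m * q ^ (Suc m * l) * B l (Suc m))
        - q ^ (2 * l + 1) * (\<Sum>m = 0..l. (- 1) ^ m * q ^ (m * l) * B l m))
      = (\<Sum>m = 0..Suc l. (- 1) ^ m * q ^ (m * l) * B l m)
        - q ^ (2 * l + 1) * (\<Sum>m = 0..l. (- 1) ^ m * q ^ (m * l) * B l m)"
    by (subst sum.atLeast0_atMost_Suc_shift[of _ l]) (simp add: B_def)
  also have "(\<Sum>m = 0..Suc l. (- 1) ^ m * q ^ (m * l) * B l m) = (\<Sum>m = 0..l. (- 1) ^ m * q ^ (m * l) * B l m)"
    by (simp add: B_def)
  also have "(\<Sum>m = 0..l. (- 1) ^ m * q ^ (m * l) * B l m) = (\<Sum>m = 0..l. (- 1) ^ m * q ^ (m * l) * qbinom l m)"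
    by (rule sum.cong) (auto simp: B_def)
  finally show ?case
    unfolding Suc.IH by (simp add: algebra_simps)
qed

section \<open>The generators on one tensor factor\<close>

locale type_B =
  fixes \<kappa> \<kappa>' :: nat
  assumes fermion: "\<kappa> \<ge> 1" and boson: "\<kappa>' \<ge> 1"
begin

abbreviation "n \<equiv> \<kappa> + \<kappa>'"
abbreviation "L \<equiv> labels \<kappa> \<kappa>'"
abbreviation "kt \<equiv> ket \<kappa> \<kappa>'"

text \<open>
  The shift of labels by \<open>e\<^sub>i\<close>; \<open>f\<^sub>i\<close> shifts by its negative. Missing neighbours at the two ends are
  omitted, so that all nodes are treated alike.
\<close>

definition weight_step :: "nat \<Rightarrow> label" where
  "weight_step i = (if i < n then unitv (i + 1) else 0) - (if i \<ge> 1 then unitv i else 0)"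

definition E_coeff :: "fld \<Rightarrow> nat \<Rightarrow> label \<Rightarrow> fld" where
  "E_coeff u i m = (if i = 0 then u else qint (Poly_Mapping.lookup m i))"

definition F_coeff :: "fld \<Rightarrow> nat \<Rightarrow> label \<Rightarrow> fld" where
  "F_coeff u i m = (if i = 0 then inverse u else 1) * (if i < n then qint (Poly_Mapping.lookup m (i + 1)) else 1)"

abbreviation K_eig :: "nat \<Rightarrow> label \<Rightarrow> fld" where
  "K_eig \<equiv> k_eigenvalue \<kappa> \<kappa>'"

lemma lookup_weight_step:
  "Poly_Mapping.lookup (weight_step i) k
    = (if k = i + 1 \<and> i < n then 1 else 0) - (if k = i \<and> i \<ge> 1 then 1 else 0)"
  by (auto simp: weight_step_def lookup_minus unitv_def lookup_single when_def)

lemma label_iff: "m \<in> L \<longleftrightarrow> (\<forall>k. k \<notin> {1..n} \<longrightarrow> Poly_Mapping.lookup m k = 0)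
    \<and> (\<forall>k. 0 \<le> Poly_Mapping.lookup m k) \<and> (\<forall>k\<in>{1..\<kappa>}. Poly_Mapping.lookup m k \<le> 1)"
proof -
  have "Poly_Mapping.keys m \<subseteq> {1..n} \<longleftrightarrow> (\<forall>k. k \<notin> {1..n} \<longrightarrow> Poly_Mapping.lookup m k = 0)"
    by (auto simp: in_keys_iff)
  moreover have "i = 0 \<or> i = 1 \<longleftrightarrow> 0 \<le> i \<and> i \<le> 1" for i :: int
    by auto
  ultimately show ?thesis
    unfolding labels_def by auto
qed

lemma labelI:
  assumes "\<And>k. 0 \<le> Poly_Mapping.lookup m k" "\<And>k. k = 0 \<or> k > n \<Longrightarrow> Poly_Mapping.lookup m k = 0"
    "\<And>k. 1 \<le> k \<Longrightarrow> k \<le> \<kappa> \<Longrightarrow> Poly_Mapping.lookup m k \<le> 1"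
  shows "m \<in> L"
  using assms by (auto simp: label_iff Suc_le_eq not_le)

lemma labelD:
  assumes "m \<in> L"
  shows "0 \<le> Poly_Mapping.lookup m k" "k = 0 \<or> k > n \<Longrightarrow> Poly_Mapping.lookup m k = 0"
    "1 \<le> k \<Longrightarrow> k \<le> \<kappa> \<Longrightarrow> Poly_Mapping.lookup m k \<le> 1"
  using assms by (auto simp: label_iff)

lemma zero_label [simp]: "0 \<in> L"
  by (simp add: label_iff)

lemma rep_gen_E: "i \<le> n \<Longrightarrow> rep_gen \<kappa> \<kappa>' u (E i) m = E_coeff u i m *\<^sub>K kt (m + weight_step i)"
  using fermion by (auto simp: E_coeff_def weight_step_def Let_def algebra_simps)

lemma rep_gen_F: "i \<le> n \<Longrightarrow> rep_gen \<kappa> \<kappa>' u (F i) m = F_coeff u i m *\<^sub>K kt (m - weight_step i)"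
  using fermion by (auto simp: F_coeff_def weight_step_def Let_def algebra_simps)

lemma rep_gen_K: "m \<in> L \<Longrightarrow> rep_gen \<kappa> \<kappa>' u (K i) m = K_eig i m *\<^sub>K bvec m"
  and rep_gen_Kinv: "m \<in> L \<Longrightarrow> rep_gen \<kappa> \<kappa>' u (Kinv i) m = inverse (K_eig i m) *\<^sub>K bvec m"
  by (simp_all add: ket_def)

declare rep_gen.simps [simp del]

lemma ket_label: "m \<in> L \<Longrightarrow> kt m = bvec m" and ket_outside: "m \<notin> L \<Longrightarrow> kt m = 0"
  by (simp_all add: ket_def)

lemma qi_nonzero [simp]: "qi \<kappa> i \<noteq> 0"
  by (simp add: qi_def)

lemma K_eig_nonzero [simp]: "K_eig i m \<noteq> 0"
  by (simp add: k_eigenvalue_def Let_def)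

lemma Dcoef_cases:
  assumes "i \<le> n" "j \<le> n"
  shows "Dcoef \<kappa> \<kappa>' i j = (if i = j then (if i \<ge> 1 then qi \<kappa> i else 1) * (if i < n then qi \<kappa> (i + 1) else 1)
    else if j = i + 1 then inverse (qi \<kappa> j) else if i = j + 1 then inverse (qi \<kappa> i) else 1)"
proof -
  have nbh: "nbh n i = (if i \<ge> 1 then {i} else {}) \<union> (if i < n then {i + 1} else {})" if "i \<le> n" for i
    using that by (auto simp: nbh_def)
  consider "i = j" | "j = i + 1" | "i = j + 1" | "i \<noteq> j" "j \<noteq> i + 1" "i \<noteq> j + 1" by blast
  then show ?thesis
  proof cases
    case 1
    then show ?thesis using assms by (auto simp: Dcoef_def nbh)
  next
    case 2
    then have "nbh n i \<inter> nbh n j = {j}" using assms by (auto simp: nbh)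
    then show ?thesis using 2 by (simp add: Dcoef_def power_int_minus)
  next
    case 3
    then have "nbh n i \<inter> nbh n j = {i}" using assms by (auto simp: nbh)
    then show ?thesis using 3 by (simp add: Dcoef_def power_int_minus)
  next
    case 4
    then have "nbh n i \<inter> nbh n j = {}" using assms by (auto simp: nbh)
    then show ?thesis using 4 by (simp add: Dcoef_def)
  qed
qed

lemma Dcoef_nonzero: "i \<le> n \<Longrightarrow> j \<le> n \<Longrightarrow> Dcoef \<kappa> \<kappa>' i j \<noteq> 0"
  by (simp add: Dcoef_cases)

lemma Dcoef_commute: "i \<le> n \<Longrightarrow> j \<le> n \<Longrightarrow> Dcoef \<kappa> \<kappa>' i j = Dcoef \<kappa> \<kappa>' j i"
  by (simp add: Dcoef_cases)

lemma K_eig_step: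
  assumes "i \<le> n" "j \<le> n"
  shows "K_eig i (m + weight_step j) = Dcoef \<kappa> \<kappa>' i j * K_eig i m"
proof -
  have [simp]: "qi \<kappa> k powi (a + 1) = qi \<kappa> k powi a * qi \<kappa> k"
    "qi \<kappa> k powi (1 + a) = qi \<kappa> k powi a * qi \<kappa> k"
    "qi \<kappa> k powi (a - 1) = qi \<kappa> k powi a * inverse (qi \<kappa> k)"
    "qi \<kappa> k powi (1 - a) = qi \<kappa> k * qi \<kappa> k powi (- a)"
    "qi \<kappa> k powi (- 1 - a) = inverse (qi \<kappa> k) * qi \<kappa> k powi (- a)" for k a
    by (simp_all add: power_int_add power_int_diff power_int_minus divide_inverse)
  have K: "K_eig i m = (if i = 0 then inverse p else if i = n then p else 1)
      * (if i \<ge> 1 then qi \<kappa> i powi (- Poly_Mapping.lookup m i) else 1)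
      * (if i < n then qi \<kappa> (i + 1) powi Poly_Mapping.lookup m (i + 1) else 1)" if "i \<le> n" for i m
    using that fermion by (auto simp: k_eigenvalue_def Let_def)
  show ?thesis
    unfolding K[OF assms(1)] Dcoef_cases[OF assms] lookup_add lookup_weight_step
    using assms by auto
qed

lemma K_eig_step_minus:
  assumes "i \<le> n" "j \<le> n"
  shows "K_eig i (m - weight_step j) = inverse (Dcoef \<kappa> \<kappa>' i j) * K_eig i m"
  using K_eig_step[OF assms, of "m - weight_step j"] Dcoef_nonzero[OF assms] by (simp add: field_simps)

text \<open>
  For \<open>i \<noteq> j\<close> the operators \<open>e\<^sub>i\<close> and \<open>f\<^sub>j\<close> never change the same entry in opposite directions, and the
  labels form a box. Both intermediate labels lie between the two ends, entry by entry, so in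
  both orders of \<open>e\<^sub>i\<close> and \<open>f\<^sub>j\<close> only the final label can be inadmissible.
\<close>

lemma intermediate_labels:
  assumes "m \<in> L" "m + weight_step i - weight_step j \<in> L" "i \<noteq> j"
  shows "m + weight_step i \<in> L" "m - weight_step j \<in> L"
proof -
  let ?m = "Poly_Mapping.lookup m" and ?i = "Poly_Mapping.lookup (weight_step i)"
    and ?j = "Poly_Mapping.lookup (weight_step j)"
  let ?m' = "\<lambda>k. ?m k + ?i k - ?j k"
  \<comment> \<open>A common entry of opposite shifts would be \<open>k = i = j\<close> or \<open>k = i + 1 = j + 1\<close>.\<close>
  have sign: "(?i k \<ge> 0 \<and> ?j k \<le> 0) \<or> (?i k \<le> 0 \<and> ?j k \<ge> 0)" for k
    using assms(3) by (auto simp: lookup_weight_step)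
  have between: "min (?m k) (?m' k) \<le> ?m k + ?i k" "?m k + ?i k \<le> max (?m k) (?m' k)"
    "min (?m k) (?m' k) \<le> ?m k - ?j k" "?m k - ?j k \<le> max (?m k) (?m' k)" for k
    using sign[of k] by auto
  have box: "m' \<in> L" if "\<And>k. min (?m k) (?m' k) \<le> Poly_Mapping.lookup m' k"
    "\<And>k. Poly_Mapping.lookup m' k \<le> max (?m k) (?m' k)" for m'
    unfolding label_iff
  proof (intro conjI allI impI ballI)
    fix k
    have m: "k \<notin> {1..n} \<Longrightarrow> ?m k = 0" "0 \<le> ?m k" "k \<in> {1..\<kappa>} \<Longrightarrow> ?m k \<le> 1"
      using assms(1) by (auto simp only: label_iff)
    have m': "k \<notin> {1..n} \<Longrightarrow> ?m' k = 0" "0 \<le> ?m' k" "k \<in> {1..\<kappa>} \<Longrightarrow> ?m' k \<le> 1"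
      using assms(2) by (auto simp only: label_iff lookup_add lookup_minus)
    show "0 \<le> Poly_Mapping.lookup m' k"
      using that(1)[of k] m(2) m'(2) by linarith
    show "k \<notin> {1..n} \<Longrightarrow> Poly_Mapping.lookup m' k = 0"
      using that[of k] m(1) m'(1) by linarith
    show "k \<in> {1..\<kappa>} \<Longrightarrow> Poly_Mapping.lookup m' k \<le> 1"
      using that(2)[of k] m(3) m'(3) by linarith
  qed
  show "m + weight_step i \<in> L" "m - weight_step j \<in> L"
    using between by (intro box; simp only: lookup_add lookup_minus)+
qed

lemma label_minus_step_iff:
  assumes "m \<in> L" "i \<le> n"
  shows "m - weight_step i \<in> L \<longleftrightarrow>
     (i < n \<longrightarrow> Poly_Mapping.lookup m (i + 1) \<ge> 1) \<and> (i \<ge> 1 \<and> i \<le> \<kappa> \<longrightarrow> Poly_Mapping.lookup m i = 0)"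
proof
  assume *: "m - weight_step i \<in> L"
  show "(i < n \<longrightarrow> Poly_Mapping.lookup m (i + 1) \<ge> 1) \<and> (i \<ge> 1 \<and> i \<le> \<kappa> \<longrightarrow> Poly_Mapping.lookup m i = 0)"
    using labelD(1)[OF *, of "i + 1"] labelD(3)[OF *, of i] labelD(1)[OF assms(1), of i]
    by (auto simp: lookup_minus lookup_weight_step)
next
  assume *: "(i < n \<longrightarrow> Poly_Mapping.lookup m (i + 1) \<ge> 1) \<and> (i \<ge> 1 \<and> i \<le> \<kappa> \<longrightarrow> Poly_Mapping.lookup m i = 0)"
  show "m - weight_step i \<in> L"
  proof (rule labelI)
    fix k
    show "0 \<le> Poly_Mapping.lookup (m - weight_step i) k"
      using * labelD(1)[OF assms(1), of k] by (auto simp: lookup_minus lookup_weight_step)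
    show "k = 0 \<or> k > n \<Longrightarrow> Poly_Mapping.lookup (m - weight_step i) k = 0"
      using assms(2) labelD(2)[OF assms(1), of k] by (auto simp: lookup_minus lookup_weight_step)
    show "1 \<le> k \<Longrightarrow> k \<le> \<kappa> \<Longrightarrow> Poly_Mapping.lookup (m - weight_step i) k \<le> 1"
      using * labelD(3)[OF assms(1), of k] by (auto simp: lookup_minus lookup_weight_step)
  qed
qed

lemma label_plus_step_iff:
  assumes "m \<in> L" "i \<le> n"
  shows "m + weight_step i \<in> L \<longleftrightarrow>
     (i \<ge> 1 \<longrightarrow> Poly_Mapping.lookup m i \<ge> 1) \<and> (i < \<kappa> \<longrightarrow> Poly_Mapping.lookup m (i + 1) = 0)"
proof
  assume *: "m + weight_step i \<in> L"
  show "(i \<ge> 1 \<longrightarrow> Poly_Mapping.lookup m i \<ge> 1) \<and> (i < \<kappa> \<longrightarrow> Poly_Mapping.lookup m (i + 1) = 0)"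
    using labelD(1)[OF *, of i] labelD(3)[OF *, of "i + 1"] labelD(1)[OF assms(1), of "i + 1"]
    by (auto simp: lookup_add lookup_weight_step)
next
  assume *: "(i \<ge> 1 \<longrightarrow> Poly_Mapping.lookup m i \<ge> 1) \<and> (i < \<kappa> \<longrightarrow> Poly_Mapping.lookup m (i + 1) = 0)"
  show "m + weight_step i \<in> L"
  proof (rule labelI)
    fix k
    show "0 \<le> Poly_Mapping.lookup (m + weight_step i) k"
      using * labelD(1)[OF assms(1), of k] by (auto simp: lookup_add lookup_weight_step)
    show "k = 0 \<or> k > n \<Longrightarrow> Poly_Mapping.lookup (m + weight_step i) k = 0"
      using assms(2) labelD(2)[OF assms(1), of k] by (auto simp: lookup_add lookup_weight_step)
    show "1 \<le> k \<Longrightarrow> k \<le> \<kappa> \<Longrightarrow> Poly_Mapping.lookup (m + weight_step i) k \<le> 1"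
      using * labelD(3)[OF assms(1), of k] by (auto simp: lookup_add lookup_weight_step)
  qed
qed

lemma EF_commute_distinct:
  assumes "i \<le> n" "j \<le> n" "i \<noteq> j" "m \<in> L"
  shows "rep_op \<kappa> \<kappa>' u (E i) (rep_op \<kappa> \<kappa>' u (F j) (bvec m))
    = rep_op \<kappa> \<kappa>' u (F j) (rep_op \<kappa> \<kappa>' u (E i) (bvec m))"
proof (cases "m + weight_step i - weight_step j \<in> L")
  case True
  then have L: "m + weight_step i \<in> L" "m - weight_step j \<in> L"
    using intermediate_labels assms by blast+
  have "E_coeff u i (m - weight_step j) * F_coeff u j m = F_coeff u j (m + weight_step i) * E_coeff u i m"
    using assms by (auto simp: E_coeff_def F_coeff_def lookup_minus lookup_add lookup_weight_step)
  then show ?thesis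
    using assms L by (simp add: rep_gen_E rep_gen_F ket_label lin_scale[OF lin_lin_ext] diff_add_eq mult.commute)
next
  case False
  have "rep_op \<kappa> \<kappa>' u (E i) (kt (m - weight_step j)) = 0"
  proof (cases "m - weight_step j \<in> L")
    case True
    then show ?thesis using False assms
      by (simp add: ket_label rep_gen_E ket_outside diff_add_eq)
  qed (simp add: ket_outside lin_zero[OF lin_lin_ext])
  moreover have "rep_op \<kappa> \<kappa>' u (F j) (kt (m + weight_step i)) = 0"
  proof (cases "m + weight_step i \<in> L")
    case True
    then show ?thesis using False assms
      by (simp add: ket_label rep_gen_F ket_outside)
  qed (simp add: ket_outside lin_zero[OF lin_lin_ext])
  ultimately show ?thesis
    using assms by (simp add: rep_gen_E rep_gen_F lin_scale[OF lin_lin_ext])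
qed

text \<open>
  An entry at a fermionic position is \<open>0\<close> or \<open>1\<close> and can be treated by cases. At a bosonic position the
  coefficient \<open>[0] = 0\<close> replaces the condition that the intermediate label be admissible, and the
  identity becomes one of q-numbers.
\<close>

lemma EF_commutator:
  assumes "i \<le> n" "m \<in> L" "u \<noteq> 0"
  shows "rep_op \<kappa> \<kappa>' u (E i) (rep_op \<kappa> \<kappa>' u (F i) (bvec m))
      - rep_op \<kappa> \<kappa>' u (F i) (rep_op \<kappa> \<kappa>' u (E i) (bvec m))
    = ((K_eig i m - inverse (K_eig i m)) / (ri n i - inverse (ri n i))) *\<^sub>K bvec m"
proof -
  let ?m = "Poly_Mapping.lookup m"
  let ?ef = "if m - weight_step i \<in> L then F_coeff u i m * E_coeff u i (m - weight_step i) else 0"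
  let ?fe = "if m + weight_step i \<in> L then E_coeff u i m * F_coeff u i (m + weight_step i) else 0"
  note m = labelD[OF assms(2)]
  note minus = label_minus_step_iff[OF assms(2,1)] and plus = label_plus_step_iff[OF assms(2,1)]
  define r where "r = ri n i"
  define c where "c = K_eig i m"
  have r: "r - inverse r \<noteq> 0"
    using p_minus_inverse_nonzero by (simp add: r_def ri_def)
  consider (zero) "i = 0" | (last) "i = n" | (ff) "i \<ge> 1" "i + 1 \<le> \<kappa>" | (fb) "i = \<kappa>" "i < n" "i \<ge> 1"
    | (bb) "i > \<kappa>" "i < n" "i \<ge> 1"
    using assms(1) fermion by force
  then have "(?ef - ?fe) * (r - inverse r) = c - inverse c"
  proof cases
    case zero
    have "?m 1 = 0 \<or> ?m 1 = 1" using m(1,3)[of 1] fermion by auto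
    then show ?thesis
    proof
      assume m1: "?m 1 = 0"
      have "?ef = 0" "?fe = 1"
        using zero fermion m1 assms(3)
        by (auto simp: minus[unfolded zero] plus[unfolded zero] F_coeff_def E_coeff_def lookup_add lookup_weight_step)
      moreover have "c = inverse p"
        using zero m1 by (simp add: c_def k_eigenvalue_def)
      ultimately show ?thesis
        using zero by (simp add: r_def ri_def)
    next
      assume m1: "?m 1 = 1"
      have "?ef = 1" "?fe = 0"
        using zero fermion m1 assms(3)
        by (auto simp: minus[unfolded zero] plus[unfolded zero] F_coeff_def E_coeff_def lookup_minus lookup_weight_step)
      moreover have "c = inverse p * - inverse q"
        using zero m1 fermion by (simp add: c_def k_eigenvalue_def qi_def)
      then have "c = p"
        by (simp add: inverse_p)
      ultimately show ?thesis
        using zero by (simp add: r_def ri_def)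
    qed
  next
    case last
    have "?m n \<ge> 0" using m(1) .
    have "?fe = qint (?m n)"
      using last fermion boson \<open>?m n \<ge> 0\<close>
      by (auto simp: plus[unfolded last] F_coeff_def E_coeff_def qint_eq_0_iff)
    moreover have "?ef = qint (?m n + 1)"
      using last fermion boson
      by (auto simp: minus[unfolded last] F_coeff_def E_coeff_def lookup_minus lookup_weight_step)
    moreover have "c = p * q powi (- ?m n)"
      using last fermion boson by (auto simp: c_def k_eigenvalue_def qi_def)
    ultimately show ?thesis
      using last fermion boson
      by (simp add: qint_succ_diff r_def ri_def power_int_minus)
  next
    case ff
    have "?m i = 0 \<or> ?m i = 1" "?m (i + 1) = 0 \<or> ?m (i + 1) = 1"
      using m(1,3)[of i] m(1,3)[of "i + 1"] ff by auto
    then show ?thesis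
      using ff boson
      by (auto simp: minus plus F_coeff_def E_coeff_def lookup_minus lookup_add lookup_weight_step
          r_def ri_def c_def k_eigenvalue_def qi_def)
  next
    case fb
    have "?m i = 0 \<or> ?m i = 1" using m(1,3)[of i] fb by auto
    then show ?thesis
    proof
      assume mi: "?m i = 0"
      have "?fe = 0" using fb mi by (auto simp: plus[unfolded fb(1)])
      moreover have "?ef = qint (?m (i + 1))"
        using fb mi m(1)[of "i + 1"]
        by (auto simp: minus[unfolded fb(1)] F_coeff_def E_coeff_def lookup_minus lookup_weight_step qint_eq_0_iff)
      moreover have "c = q powi ?m (i + 1)"
        using fb mi by (auto simp: c_def k_eigenvalue_def qi_def)
      ultimately show ?thesis
        using fb by (simp add: r_def ri_def qint_def power_int_minus)
    next
      assume mi: "?m i = 1"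
      have "?ef = 0" using fb mi by (auto simp: minus[unfolded fb(1)])
      moreover have "?fe = qint (?m (i + 1) + 1)"
        using fb mi by (auto simp: plus[unfolded fb(1)] F_coeff_def E_coeff_def lookup_add lookup_weight_step qint_eq_0_iff)
      moreover have "c = - (q powi (?m (i + 1) + 1))"
        using fb mi by (auto simp: c_def k_eigenvalue_def qi_def power_int_add)
      moreover have "inverse (q powi (?m (i + 1) + 1)) = q powi (- (?m (i + 1) + 1))"
        by (simp only: power_int_minus)
      ultimately show ?thesis
        using fb by (simp only: qint_def r_def ri_def inverse_minus_eq) simp
    qed
  next
    case bb
    have "?m i \<ge> 0" "?m (i + 1) \<ge> 0" using m(1) by blast+
    have "?fe = qint (?m i) * qint (?m (i + 1) + 1)"
      using bb \<open>?m i \<ge> 0\<close>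
      by (auto simp: plus F_coeff_def E_coeff_def lookup_add lookup_weight_step qint_eq_0_iff)
    moreover have "?ef = qint (?m i + 1) * qint (?m (i + 1))"
      using bb \<open>?m (i + 1) \<ge> 0\<close>
      by (auto simp: minus F_coeff_def E_coeff_def lookup_minus lookup_weight_step qint_eq_0_iff)
    moreover have "c = q powi (?m (i + 1) - ?m i)"
      using bb by (simp add: c_def k_eigenvalue_def qi_def Let_def power_int_diff power_int_minus divide_inverse mult.commute)
    ultimately have "?ef - ?fe = qint (?m (i + 1) - ?m i)" "c = q powi (?m (i + 1) - ?m i)"
      by (simp_all only: qint_neighbours_diff)
    moreover have "qint k * (q - inverse q) = q powi k - inverse (q powi k)" for k
      by (simp add: qint_def power_int_minus)
    moreover have "r = q"
      using bb by (simp add: r_def ri_def)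
    ultimately show ?thesis
      by simp
  qed
  then have "?ef - ?fe = (c - inverse c) / (r - inverse r)"
    using r by (simp only: eq_divide_eq) simp
  moreover have "rep_op \<kappa> \<kappa>' u (E i) (rep_op \<kappa> \<kappa>' u (F i) (bvec m)) = ?ef *\<^sub>K bvec m"
    using assms by (auto simp: rep_gen_E rep_gen_F ket_label ket_outside lin_scale[OF lin_lin_ext] lin_zero[OF lin_lin_ext])
  moreover have "rep_op \<kappa> \<kappa>' u (F i) (rep_op \<kappa> \<kappa>' u (E i) (bvec m)) = ?fe *\<^sub>K bvec m"
    using assms by (auto simp: rep_gen_E rep_gen_F ket_label ket_outside lin_scale[OF lin_lin_ext] lin_zero[OF lin_lin_ext])
  ultimately show ?thesis
    by (simp only: c_def r_def flip: VS.scale_left_diff_distrib)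
qed

section \<open>The defining relations on the tensor square\<close>

abbreviation "W2 \<equiv> WW \<kappa> \<kappa>'"
abbreviation "Act \<equiv> free_act \<kappa> \<kappa>'"

lemma subspace_W2: "VS.subspace W2"
proof (rule VS.subspaceI)
  show "\<psi> + \<phi> \<in> W2" if "\<psi> \<in> W2" "\<phi> \<in> W2" for \<psi> \<phi>
    using that keys_add[of \<psi> \<phi>] by (auto simp: WW_def)
  show "c *\<^sub>K \<psi> \<in> W2" if "\<psi> \<in> W2" for c \<psi>
    using that by (auto simp: WW_def in_keys_iff)
qed (simp add: WW_def)

lemma bvec_in_W2: "a \<in> L \<Longrightarrow> b \<in> L \<Longrightarrow> bvec (a, b) \<in> W2"
  by (simp add: WW_def)

lemma W2_induct:
  assumes "\<psi> \<in> W2" "VS.subspace N" "\<And>a b. a \<in> L \<Longrightarrow> b \<in> L \<Longrightarrow> bvec (a, b) \<in> N"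
  shows "\<psi> \<in> N"
proof (rule subspace_contains_support[OF assms(2)])
  fix k assume "k \<in> Poly_Mapping.keys \<psi>"
  then have "fst k \<in> L" "snd k \<in> L" using assms(1) by (auto simp: WW_def)
  then show "bvec k \<in> N" using assms(3)[of "fst k" "snd k"] by simp
qed

lemma flip_in_W2: "\<psi> \<in> W2 \<Longrightarrow> flip \<psi> \<in> W2"
  by (auto simp: WW_def in_keys_iff lookup_flip subset_iff)

lemma lin_eq_on_W2:
  assumes "lin S" "lin T" "\<psi> \<in> W2" "\<And>a b. a \<in> L \<Longrightarrow> b \<in> L \<Longrightarrow> S (bvec (a, b)) = T (bvec (a, b))"
  shows "S \<psi> = T \<psi>"
  by (rule lin_eq_on_basis[OF assms(1,2), of "L \<times> L"]) (use assms in \<open>auto simp: WW_def\<close>)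

lemma tens_in_W2:
  assumes "Poly_Mapping.keys s \<subseteq> L" "Poly_Mapping.keys t \<subseteq> L" shows "tens s t \<in> W2"
  using assms by (auto simp: WW_def in_keys_iff subset_iff)

lemma keys_rep_op: 
  assumes "m \<in> L" "gen_index g \<le> n" shows "Poly_Mapping.keys (rep_op \<kappa> \<kappa>' u g (bvec m)) \<subseteq> L"
proof (cases g)
qed (use assms in \<open>auto simp: rep_gen_E rep_gen_F rep_gen_K rep_gen_Kinv ket_def in_keys_iff lookup_bvec split: if_splits\<close>)

lemma K_tens: "Act u v (fgen (K i)) (tens s t) = tens (rep_op \<kappa> \<kappa>' u (K i) s) (rep_op \<kappa> \<kappa>' v (K i) t)"
  and Kinv_tens: "Act u v (fgen (Kinv i)) (tens s t) = tens (rep_op \<kappa> \<kappa>' u (Kinv i) s) (rep_op \<kappa> \<kappa>' v (Kinv i) t)"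
  and E_tens: "Act u v (fgen (E i)) (tens s t)
    = tens s (rep_op \<kappa> \<kappa>' v (E i) t) + tens (rep_op \<kappa> \<kappa>' u (E i) s) (rep_op \<kappa> \<kappa>' v (K i) t)"
  and F_tens: "Act u v (fgen (F i)) (tens s t)
    = tens (rep_op \<kappa> \<kappa>' u (F i) s) t + tens (rep_op \<kappa> \<kappa>' u (Kinv i) s) (rep_op \<kappa> \<kappa>' v (F i) t)"
proof -
  have id: "lin id" using lin_ident by (simp add: id_def)
  show "Act u v (fgen (K i)) (tens s t) = tens (rep_op \<kappa> \<kappa>' u (K i) s) (rep_op \<kappa> \<kappa>' v (K i) t)"
   "Act u v (fgen (Kinv i)) (tens s t) = tens (rep_op \<kappa> \<kappa>' u (Kinv i) s) (rep_op \<kappa> \<kappa>' v (Kinv i) t)"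
   "Act u v (fgen (E i)) (tens s t)
    = tens s (rep_op \<kappa> \<kappa>' v (E i) t) + tens (rep_op \<kappa> \<kappa>' u (E i) s) (rep_op \<kappa> \<kappa>' v (K i) t)"
  "Act u v (fgen (F i)) (tens s t)
    = tens (rep_op \<kappa> \<kappa>' u (F i) s) t + tens (rep_op \<kappa> \<kappa>' u (Kinv i) s) (rep_op \<kappa> \<kappa>' v (F i) t)"
    by (simp_all add: free_act_K free_act_Kinv free_act_E free_act_F tens_op_tens[OF id]
        tens_op_tens[OF _ id] tens_op_tens)
qed

lemma K_pair: "a \<in> L \<Longrightarrow> b \<in> L \<Longrightarrow> Act u v (fgen (K i)) (bvec (a, b)) = (K_eig i a * K_eig i b) *\<^sub>K bvec (a, b)"
  and Kinv_pair: "a \<in> L \<Longrightarrow> b \<in> L \<Longrightarrow>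
    Act u v (fgen (Kinv i)) (bvec (a, b)) = inverse (K_eig i a * K_eig i b) *\<^sub>K bvec (a, b)"
  using K_tens[of u v i "bvec a" "bvec b"] Kinv_tens[of u v i "bvec a" "bvec b"]
  by (simp_all add: rep_gen_K rep_gen_Kinv tens_scale_left tens_scale_right mult.commute)

lemma E_pair: "a \<in> L \<Longrightarrow> b \<in> L \<Longrightarrow> i \<le> n \<Longrightarrow> Act u v (fgen (E i)) (bvec (a, b))
    = tens (bvec a) (rep_op \<kappa> \<kappa>' v (E i) (bvec b)) + K_eig i b *\<^sub>K tens (rep_op \<kappa> \<kappa>' u (E i) (bvec a)) (bvec b)"
  and F_pair: "a \<in> L \<Longrightarrow> b \<in> L \<Longrightarrow> i \<le> n \<Longrightarrow> Act u v (fgen (F i)) (bvec (a, b))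
    = tens (rep_op \<kappa> \<kappa>' u (F i) (bvec a)) (bvec b)
      + inverse (K_eig i a) *\<^sub>K tens (bvec a) (rep_op \<kappa> \<kappa>' v (F i) (bvec b))"
  using E_tens[of u v i "bvec a" "bvec b"] F_tens[of u v i "bvec a" "bvec b"]
  by (simp_all add: rep_gen_K rep_gen_Kinv tens_scale_left tens_scale_right)

lemma K_rep_E:
  assumes "m \<in> L" "i \<le> n" "j \<le> n"
  shows "rep_op \<kappa> \<kappa>' u' (K i) (rep_op \<kappa> \<kappa>' u (E j) (bvec m))
      = (Dcoef \<kappa> \<kappa>' i j * K_eig i m) *\<^sub>K rep_op \<kappa> \<kappa>' u (E j) (bvec m)"
    and "rep_op \<kappa> \<kappa>' u' (Kinv i) (rep_op \<kappa> \<kappa>' u (E j) (bvec m))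
      = inverse (Dcoef \<kappa> \<kappa>' i j * K_eig i m) *\<^sub>K rep_op \<kappa> \<kappa>' u (E j) (bvec m)"
  using assms
  by (cases "m + weight_step j \<in> L";
      simp add: rep_gen_E ket_label ket_outside rep_gen_K rep_gen_Kinv lin_scale[OF lin_lin_ext]
        lin_zero[OF lin_lin_ext] K_eig_step mult.commute mult.left_commute)+

lemma K_rep_F:
  assumes "m \<in> L" "i \<le> n" "j \<le> n"
  shows "rep_op \<kappa> \<kappa>' u' (K i) (rep_op \<kappa> \<kappa>' u (F j) (bvec m))
      = (inverse (Dcoef \<kappa> \<kappa>' i j) * K_eig i m) *\<^sub>K rep_op \<kappa> \<kappa>' u (F j) (bvec m)"
  using assms
  by (cases "m - weight_step j \<in> L";
      simp add: rep_gen_F ket_label ket_outside rep_gen_K lin_scale[OF lin_lin_ext]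
        lin_zero[OF lin_lin_ext] K_eig_step_minus mult.commute mult.left_commute)

lemma Act_fgen_in_W2:
  assumes "gen_index g \<le> n" "\<psi> \<in> W2" shows "Act u v (fgen g) \<psi> \<in> W2"
proof -
  have "VS.subspace {\<psi>. Act u v (fgen g) \<psi> \<in> W2}"
    by (rule module_hom.subspace_linear_preimage[OF lin_free_act subspace_W2])
  moreover have "Act u v (fgen g) (bvec (a, b)) \<in> W2" if "a \<in> L" "b \<in> L" for a b
  proof (cases g)
    case (E i)
    then show ?thesis
      using that assms keys_rep_op[of a "E i" u] keys_rep_op[of b "E i" v]
      by (auto simp: E_pair simp del: lin_ext_bvec intro!: VS.subspace_add[OF subspace_W2] VS.subspace_scale[OF subspace_W2] tens_in_W2)
  next
    case (F i)
    then show ?thesis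
      using that assms keys_rep_op[of a "F i" u] keys_rep_op[of b "F i" v]
      by (auto simp: F_pair simp del: lin_ext_bvec intro!: VS.subspace_add[OF subspace_W2] VS.subspace_scale[OF subspace_W2] tens_in_W2)
  qed (use that in \<open>auto simp: K_pair Kinv_pair intro!: VS.subspace_scale[OF subspace_W2] bvec_in_W2\<close>)
  ultimately have "\<psi> \<in> {\<psi>. Act u v (fgen g) \<psi> \<in> W2}"
    using W2_induct[OF assms(2)] by blast
  then show ?thesis by simp
qed

lemma Act_in_W2:
  assumes "a \<in> carrier (free_alg {0..n})" "\<psi> \<in> W2" shows "Act u v a \<psi> \<in> W2"
proof -
  have "a \<in> {a. Act u v a \<psi> \<in> W2}"
    by (rule free_alg_induct[OF assms(1)
        module_hom.subspace_linear_preimage[OF lin_free_act_left subspace_W2]])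
      (auto simp: free_act_one free_act_mult assms(2) intro: Act_fgen_in_W2)
  then show ?thesis by simp
qed

text \<open>
  Besides the commutators on the two factors there are mixed terms in \<open>e\<^sub>i \<otimes> f\<^sub>j\<close>. They cancel because
  moving \<open>k\<^sub>i\<close> past \<open>f\<^sub>j\<close> and \<open>k\<^sub>j\<^sup>-\<^sup>1\<close> past \<open>e\<^sub>i\<close> produces the same scalar, \<open>D\<close> being symmetric. For \<open>i = j\<close> the
  remaining terms telescope.
\<close>

lemma EF_pair_commutator:
  assumes "i \<le> n" "j \<le> n" "a \<in> L" "b \<in> L" "u \<noteq> 0" "v \<noteq> 0"
  shows "Act u v (fgen (E i)) (Act u v (fgen (F j)) (bvec (a, b)))
      - Act u v (fgen (F j)) (Act u v (fgen (E i)) (bvec (a, b)))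
    = (if i = j then (K_eig i a * K_eig i b - inverse (K_eig i a * K_eig i b)) / (ri n i - inverse (ri n i))
       else 0) *\<^sub>K bvec (a, b)"
proof -
  let ?Ea = "rep_op \<kappa> \<kappa>' u (E i) (bvec a)" and ?Fa = "rep_op \<kappa> \<kappa>' u (F j) (bvec a)"
  let ?Eb = "rep_op \<kappa> \<kappa>' v (E i) (bvec b)" and ?Fb = "rep_op \<kappa> \<kappa>' v (F j) (bvec b)"
  let ?D = "Dcoef \<kappa> \<kappa>' i j"
  have KE: "rep_op \<kappa> \<kappa>' u (Kinv j) ?Ea = inverse (?D * K_eig j a) *\<^sub>K ?Ea"
    using K_rep_E(2)[of a j i u u] assms by (simp only: Dcoef_commute)
  have KF: "rep_op \<kappa> \<kappa>' v (K i) ?Fb = (inverse ?D * K_eig i b) *\<^sub>K ?Fb"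
    using K_rep_F[of b i j v v] assms by simp
  have K: "rep_op \<kappa> \<kappa>' v (K i) (bvec b) = K_eig i b *\<^sub>K bvec b"
    "rep_op \<kappa> \<kappa>' u (Kinv j) (bvec a) = inverse (K_eig j a) *\<^sub>K bvec a"
    using assms by (simp_all add: rep_gen_K rep_gen_Kinv)
  note lin = lin_add[OF lin_free_act] lin_scale[OF lin_free_act]
  have EF: "Act u v (fgen (E i)) (Act u v (fgen (F j)) (bvec (a, b)))
      = tens ?Fa ?Eb + K_eig i b *\<^sub>K tens (rep_op \<kappa> \<kappa>' u (E i) ?Fa) (bvec b)
        + inverse (K_eig j a) *\<^sub>K (tens (bvec a) (rep_op \<kappa> \<kappa>' v (E i) ?Fb)
        + (inverse ?D * K_eig i b) *\<^sub>K tens ?Ea ?Fb)"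
    using assms
    by (simp only: F_pair lin E_tens KF K tens_scale_right)
  have FE: "Act u v (fgen (F j)) (Act u v (fgen (E i)) (bvec (a, b)))
      = tens ?Fa ?Eb + inverse (K_eig j a) *\<^sub>K tens (bvec a) (rep_op \<kappa> \<kappa>' v (F j) ?Eb)
        + K_eig i b *\<^sub>K (tens (rep_op \<kappa> \<kappa>' u (F j) ?Ea) (bvec b)
        + inverse (?D * K_eig j a) *\<^sub>K tens ?Ea ?Fb)"
    using assms
    by (simp only: E_pair lin F_tens KE K tens_scale_left)
  \<comment> \<open>The terms in \<open>?Ea \<otimes> ?Fb\<close> carry the same scalar in both products.\<close>
  have commutators: "Act u v (fgen (E i)) (Act u v (fgen (F j)) (bvec (a, b)))
      - Act u v (fgen (F j)) (Act u v (fgen (E i)) (bvec (a, b)))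
    = K_eig i b *\<^sub>K tens (rep_op \<kappa> \<kappa>' u (E i) ?Fa - rep_op \<kappa> \<kappa>' u (F j) ?Ea) (bvec b)
      + inverse (K_eig j a) *\<^sub>K tens (bvec a) (rep_op \<kappa> \<kappa>' v (E i) ?Fb - rep_op \<kappa> \<kappa>' v (F j) ?Eb)"
    unfolding EF FE tens_diff_left tens_diff_right
    by (simp only: VS.scale_right_distrib VS.scale_right_diff_distrib VS.scale_scale) 
      (simp add: algebra_simps)
  show ?thesis
  proof (cases "i = j")
    case True
    have "K_eig i b * ((K_eig i a - inverse (K_eig i a)) / (ri n i - inverse (ri n i)))
        + inverse (K_eig i a) * ((K_eig i b - inverse (K_eig i b)) / (ri n i - inverse (ri n i)))
      = (K_eig i a * K_eig i b - inverse (K_eig i a * K_eig i b)) / (ri n i - inverse (ri n i))"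
      by (simp add: algebra_simps flip: add_divide_distrib)
    then show ?thesis
      unfolding commutators using True assms EF_commutator[of i a u] EF_commutator[of i b v]
      by (simp del: lin_ext_bvec add: tens_scale_left tens_scale_right flip: VS.scale_left_distrib)
  next
    case False
    then show ?thesis
      unfolding commutators using assms EF_commute_distinct[of i j a u] EF_commute_distinct[of i j b v]
      by (simp del: lin_ext_bvec)
  qed
qed

lemma relators_act_zero:
  assumes "r \<in> UB_relators \<kappa> \<kappa>'" "u \<noteq> 0" "v \<noteq> 0" "\<psi> \<in> W2"
  shows "Act u v r \<psi> = 0"
proof (rule lin_eq_on_W2[where T = "\<lambda>_. 0", OF lin_free_act _ assms(4)])
  show "lin (\<lambda>_. 0 :: vec2)" by (rule linI) simp_all
  fix a b assume L: "a \<in> L" "b \<in> L"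
  note lin = lin_add[OF lin_free_act] lin_scale[OF lin_free_act] lin_diff[OF lin_free_act]
    lin_diff[OF lin_free_act_left] lin_scale[OF lin_free_act_left]
    lin_zero[OF lin_free_act_left] lin_zero[OF lin_free_act]
  have inv1 [simp]: "inverse s * inverse t * (s * t) = 1" and inv2 [simp]: "s * t * (inverse s * inverse t) = 1"
    if "s \<noteq> 0" "t \<noteq> 0" for s t :: fld
    using that by (simp_all add: field_simps)
  consider (KKinv) i where "i \<le> n" "r = fgen (K i) * fgen (Kinv i) - 1"
    | (KinvK) i where "i \<le> n" "r = fgen (Kinv i) * fgen (K i) - 1"
    | (KK) i j where "i \<le> n" "j \<le> n" "r = fgen (K i) * fgen (K j) - fgen (K j) * fgen (K i)"
    | (KE) i j where "i \<le> n" "j \<le> n" "r = fgen (K i) * fgen (E j) - Dcoef \<kappa> \<kappa>' i j *\<^sub>K (fgen (E j) * fgen (K i))"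
    | (KF) i j where "i \<le> n" "j \<le> n"
      "r = fgen (K i) * fgen (F j) - inverse (Dcoef \<kappa> \<kappa>' i j) *\<^sub>K (fgen (F j) * fgen (K i))"
    | (EF) i j where "i \<le> n" "j \<le> n" "r = fgen (E i) * fgen (F j) - fgen (F j) * fgen (E i)
        - (if i = j then inverse (ri n i - inverse (ri n i)) *\<^sub>K (fgen (K i) - fgen (Kinv i)) else 0)"
    using assms(1) unfolding UB_relators_def Let_def by blast
  then show "Act u v r (bvec (a, b)) = 0"
  proof cases
    case KKinv
    then show ?thesis using L
      by (simp add: lin free_act_mult free_act_one K_pair Kinv_pair)
  next
    case KinvK
    then show ?thesis using L
      by (simp add: lin free_act_mult free_act_one K_pair Kinv_pair)
  next
    case KK
    then show ?thesis using L
      by (simp add: lin free_act_mult K_pair mult.commute)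
  next
    case KE
    then show ?thesis using L
      by (simp add: lin free_act_mult K_pair E_pair K_tens K_rep_E
          rep_gen_K tens_scale_left tens_scale_right VS.scale_right_distrib mult_ac del: lin_ext_bvec)
        (simp add: rep_gen_K tens_scale_left tens_scale_right mult_ac)
  next
    case KF
    then show ?thesis using L
      by (simp add: lin free_act_mult K_pair F_pair K_tens K_rep_F
          rep_gen_K tens_scale_left tens_scale_right VS.scale_right_distrib mult_ac del: lin_ext_bvec)
        (simp add: rep_gen_K tens_scale_left tens_scale_right mult_ac)
  next
    case EF
    show ?thesis
    proof (cases "i = j")
      case True
      then show ?thesis using EF L EF_pair_commutator[OF EF(1,2) L assms(2,3)]
        by (simp add: lin free_act_mult K_pair Kinv_pair divide_inverse mult.commute flip: VS.scale_left_diff_distrib)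
    next
      case False
      then show ?thesis using EF L EF_pair_commutator[OF EF(1,2) L assms(2,3)]
        by (simp add: lin free_act_mult)
    qed
  qed
qed

text \<open>
  Once the relators are known to act by zero, the ideal that they generate is contained in this one.
\<close>

lemma ideal_acting_by_zero:
  "ideal {a \<in> carrier (free_alg {0..n}). \<forall>\<psi>\<in>W2. Act u v a \<psi> = 0} (free_alg {0..n})"
    (is "ideal ?I ?R")
proof (rule idealI[OF ring_free_alg])
  show "subgroup ?I (add_monoid ?R)"
  proof (rule subgroup.intro)
    show "inv\<^bsub>add_monoid ?R\<^esub> a \<in> ?I" if "a \<in> ?I" for a
    proof -
      have "inv\<^bsub>add_monoid ?R\<^esub> a = - a"
        using that free_alg_a_inv by (simp only: mem_Collect_eq flip: a_inv_def)
      then show ?thesis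
        using that free_alg_uminus by (simp only: mem_Collect_eq lin_neg[OF lin_free_act_left]) auto
    qed
  qed (auto simp: free_alg_add free_alg_zero lin_add[OF lin_free_act_left] lin_zero[OF lin_free_act_left])
qed (auto simp: free_alg_mult free_act_mult Act_in_W2 lin_zero[OF lin_free_act])

lemma relators_in_carrier: "UB_relators \<kappa> \<kappa>' \<subseteq> carrier (free_alg {0..n})"
  unfolding UB_relators_def Let_def
  by (auto intro!: free_alg_minus free_alg_mult free_alg_scale free_alg_fgen free_alg_one free_alg_zero)

lemma UB_ideal_acts_zero:
  assumes "a \<in> UB_ideal \<kappa> \<kappa>'" "u \<noteq> 0" "v \<noteq> 0" "\<psi> \<in> W2"
  shows "Act u v a \<psi> = 0"
proof -
  interpret ring "free_alg {0..n}" by (rule ring_free_alg)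
  have "UB_relators \<kappa> \<kappa>' \<subseteq> {a \<in> carrier (free_alg {0..n}). \<forall>\<psi>\<in>W2. Act u v a \<psi> = 0}"
    using relators_in_carrier relators_act_zero assms by blast
  from genideal_minimal[OF ideal_acting_by_zero this] show ?thesis
    using assms unfolding UB_ideal_def by blast
qed

lemma zero_in_UB_ideal: "0 \<in> UB_ideal \<kappa> \<kappa>'"
proof -
  interpret ring "free_alg {0..n}" by (rule ring_free_alg)
  have "ideal (UB_ideal \<kappa> \<kappa>') (free_alg {0..n})"
    unfolding UB_ideal_def by (rule genideal_ideal[OF relators_in_carrier])
  then show ?thesis
    using additive_subgroup.zero_closed[OF ideal.axioms(1)] by force
qed

abbreviation coset :: "free \<Rightarrow> free set" where
  "coset a \<equiv> UB_ideal \<kappa> \<kappa>' +>\<^bsub>free_alg {0..n}\<^esub> a"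

lemma coset_eq: "coset a = {h + a | h. h \<in> UB_ideal \<kappa> \<kappa>'}"
  by (auto simp: a_r_coset_def')

lemma rep2_coprod_op: "rep2 \<kappa> \<kappa>' u v (coprod_op a) \<psi> = flip (Act v u a (flip \<psi>))"
  by (simp add: coprod_op_def free_act_def rep2_flip)

text \<open>
  Elements of the ideal act by zero, so the image that defines \<open>act\<close> is a singleton.
\<close>

lemma act_coset:
  assumes "u \<noteq> 0" "v \<noteq> 0" "\<psi> \<in> W2"
  shows "act \<kappa> \<kappa>' u v (coset a) \<psi> = Act u v a \<psi>"
proof -
  have "(\<lambda>a. rep2 \<kappa> \<kappa>' u v (coprod a) \<psi>) ` coset a = {Act u v a \<psi>}"
  proof -
    have "Act u v (h + a) \<psi> = Act u v a \<psi>" if "h \<in> UB_ideal \<kappa> \<kappa>'" for h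
      using UB_ideal_acts_zero[OF that assms] by (simp add: lin_add[OF lin_free_act_left])
    then show ?thesis
      using zero_in_UB_ideal unfolding coset_eq free_act_def[symmetric] by (auto simp: image_iff)
  qed
  then show ?thesis by (simp add: act_def)
qed

lemma act_op_coset:
  assumes "u \<noteq> 0" "v \<noteq> 0" "\<psi> \<in> W2"
  shows "act_op \<kappa> \<kappa>' u v (coset a) \<psi> = flip (Act v u a (flip \<psi>))"
proof -
  have "(\<lambda>a. rep2 \<kappa> \<kappa>' u v (coprod_op a) \<psi>) ` coset a = {flip (Act v u a (flip \<psi>))}"
  proof -
    have "Act v u (h + a) (flip \<psi>) = Act v u a (flip \<psi>)" if "h \<in> UB_ideal \<kappa> \<kappa>'" for h
      using UB_ideal_acts_zero[OF that assms(2,1) flip_in_W2[OF assms(3)]]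
      by (simp add: lin_add[OF lin_free_act_left])
    then show ?thesis
      using zero_in_UB_ideal unfolding coset_eq rep2_coprod_op by (auto simp: image_iff)
  qed
  then show ?thesis by (simp add: act_op_def)
qed

lemma coset_in_UB: "a \<in> carrier (free_alg {0..n}) \<Longrightarrow> coset a \<in> carrier (UB \<kappa> \<kappa>')"
  by (auto simp: UB_def FactRing_def A_RCOSETS_def')

lemma free_alg_mono: "I \<subseteq> J \<Longrightarrow> carrier (free_alg I) \<subseteq> carrier (free_alg J)"
  unfolding carrier_free_alg subset_iff by blast

abbreviation "nonaffine \<equiv> carrier (free_alg {1..n})"

lemma nonaffine_in_carrier: "a \<in> nonaffine \<Longrightarrow> a \<in> carrier (free_alg {0..n})"
  using free_alg_mono[of "{1..n}" "{0..n}"] by auto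

text \<open>
  Only \<open>e\<^sub>0\<close> and \<open>f\<^sub>0\<close> involve the spectral parameters.
\<close>

lemma nonaffine_act_independent:
  assumes "a \<in> nonaffine" shows "Act u v a \<psi> = Act u' v' a \<psi>"
proof -
  have op: "rep_op \<kappa> \<kappa>' u g = rep_op \<kappa> \<kappa>' u' g" if "gen_index g \<in> {1..n}" for g u u'
  proof -
    have "rep_gen \<kappa> \<kappa>' u g m = rep_gen \<kappa> \<kappa>' u' g m" for m
      using that by (cases g) (auto simp: rep_gen.simps)
    then show ?thesis by presburger
  qed
  have gen: "Act u v (fgen g) \<psi> = Act u' v' (fgen g) \<psi>" if "gen_index g \<in> {1..n}" for g \<psi>
  proof (cases g)
    case (E i)
    then show ?thesis using op[of "E i" u u'] op[of "E i" v v'] op[of "K i" v v'] that by (simp add: free_act_E)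
  next
    case (F i)
    then show ?thesis using op[of "F i" u u'] op[of "F i" v v'] op[of "Kinv i" u u'] that by (simp add: free_act_F)
  next
    case (K i)
    then show ?thesis using op[of "K i" u u'] op[of "K i" v v'] that by (simp add: free_act_K)
  next
    case (Kinv i)
    then show ?thesis using op[of "Kinv i" u u'] op[of "Kinv i" v v'] that by (simp add: free_act_Kinv)
  qed
  have "a \<in> {a. Act u v a \<psi> = Act u' v' a \<psi>}"
    by (rule free_alg_induct[OF assms VS.subspaceI])
      (auto simp: lin_zero[OF lin_free_act_left] lin_add[OF lin_free_act_left]
        lin_scale[OF lin_free_act_left] free_act_one free_act_mult gen)
  then show ?thesis by simp
qed

section \<open>The modules generated by the singular vectors\<close>

abbreviation \<xi> :: "nat \<Rightarrow> vec2" where "\<xi> \<equiv> sing_vec \<kappa> \<kappa>'"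
abbreviation M :: "nat \<Rightarrow> vec2 set" where "M \<equiv> sing_module \<kappa> \<kappa>'"

text \<open>
  The label \<open>m e\<^sub>n\<close>; every vector occurring in \<open>\<xi>\<^sub>l\<close> is a tensor product of two of these.
\<close>

definition col :: "nat \<Rightarrow> label" where "col m = Poly_Mapping.single n (int m)"

lemma lookup_col: "Poly_Mapping.lookup (col m) k = (if k = n then int m else 0)"
  by (simp add: col_def lookup_single when_def)

lemma col_label [simp]: "col m \<in> L"
  using boson by (intro labelI) (auto simp: lookup_col)

lemma col_0: "col 0 = 0"
  by (simp add: col_def)

lemma col_inj [simp]: "col a = col b \<longleftrightarrow> a = b"
  by (metis lookup_col of_nat_eq_iff)

definition sing_coeff :: "nat \<Rightarrow> nat \<Rightarrow> fld" where
  "sing_coeff l m = (- p) powi (- int m) * qhalf powi (int m * (2 * int l - int m - 1)) * qbinom l m"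

lemma sing_vec_eq: "\<xi> l = (\<Sum>m = 0..l. sing_coeff l m *\<^sub>K bvec (col m, col (l - m)))"
proof -
  have "tens (kt (Poly_Mapping.single n (int m))) (kt (Poly_Mapping.single n (int m')))
      = bvec (col m, col m')" for m m'
    using ket_label[OF col_label] by (simp add: col_def)
  then show ?thesis
    by (simp only: sing_vec_def sing_coeff_def Let_def)
qed

lemma sing_vec_in_W2: "\<xi> l \<in> W2"
  unfolding sing_vec_eq
  by (rule VS.subspace_sum[OF subspace_W2] VS.subspace_scale[OF subspace_W2] bvec_in_W2 col_label)+

lemma sing_module_eq: "M l = (\<lambda>a. Act xvar yvar a (\<xi> l)) ` nonaffine"
  unfolding sing_module_def UB_sub_def image_image
  by (rule image_cong) (simp_all add: act_coset sing_vec_in_W2)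

lemma subspace_sing_module: "VS.subspace (M l)"
proof (rule VS.subspaceI)
  show "0 \<in> M l"
    unfolding sing_module_eq using free_alg_zero lin_zero[OF lin_free_act_left] by (metis image_eqI)
  show "\<psi> + \<phi> \<in> M l" if "\<psi> \<in> M l" "\<phi> \<in> M l" for \<psi> \<phi>
    using that unfolding sing_module_eq by (auto simp flip: lin_add[OF lin_free_act_left] intro: free_alg_add)
  show "c *\<^sub>K \<psi> \<in> M l" if "\<psi> \<in> M l" for c \<psi>
    using that unfolding sing_module_eq by (auto simp flip: lin_scale[OF lin_free_act_left] intro: free_alg_scale)
qed

lemma sing_module_in_W2: "M l \<subseteq> W2"
  unfolding sing_module_eq using Act_in_W2[OF nonaffine_in_carrier sing_vec_in_W2] by blast

lemma sing_vec_in_module: "\<xi> l \<in> M l"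
  unfolding sing_module_eq by (rule image_eqI[of _ _ 1]) (simp_all add: free_act_one free_alg_one)

lemma sing_module_closed: "\<psi> \<in> M l \<Longrightarrow> a \<in> nonaffine \<Longrightarrow> Act xvar yvar a \<psi> \<in> M l"
  unfolding sing_module_eq by (auto simp flip: free_act_mult intro: free_alg_mult)

section \<open>Classification of the singular vectors\<close>

text \<open>
  A grading with finitely many labels in each degree; the weights \<open>n + 1 - k\<close> are chosen so that each of
  \<open>e\<^sub>1, ..., e\<^sub>n\<close> lowers it by exactly one.
\<close>

definition height :: "label \<Rightarrow> int" where
  "height m = (\<Sum>k = 1..n. int (n + 1 - k) * Poly_Mapping.lookup m k)"

lemma height_nonneg: "m \<in> L \<Longrightarrow> height m \<ge> 0"
  by (auto simp: height_def labelD(1) intro!: sum_nonneg)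

lemma height_add: "height (m + m') = height m + height m'"
  by (simp only: height_def lookup_add distrib_left sum.distrib)

lemma height_minus: "height (m - m') = height m - height m'"
  using height_add[of "m - m'" m'] by simp

lemma height_unitv: "1 \<le> k \<Longrightarrow> k \<le> n \<Longrightarrow> height (unitv k) = int (n + 1 - k)"
proof -
  assume k: "1 \<le> k" "k \<le> n"
  have "height (unitv k) = (\<Sum>j = 1..n. if j = k then int (n + 1 - j) else 0)"
    unfolding height_def unitv_def lookup_single when_def by (intro sum.cong) auto
  then show ?thesis using k by simp
qed

lemma height_weight_step:
  assumes "1 \<le> i" "i \<le> n" shows "height (weight_step i) = - 1"
proof (cases "i < n")
  case True
  then show ?thesis
    using assms by (simp add: weight_step_def height_minus height_unitv)
next
  case False
  have "height 0 = 0" by (simp add: height_def)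
  then show ?thesis
    using False assms height_minus[of 0 "unitv i"] by (simp add: weight_step_def height_unitv)
qed

text \<open>
  Moving the last occupied position \<open>i \<le> j\<close> to the right leads to a label, because the entry that
  receives it is empty, or bosonic, or beyond the end. The choice \<open>j = n\<close> serves labels other than
  \<open>0\<close>, the choice \<open>j = n - 1\<close> labels other than the multiples of \<open>e\<^sub>n\<close>.
\<close>

lemma movable_entry:
  assumes "m \<in> L" "Poly_Mapping.lookup m k > 0" "k \<le> j" "j = n \<or> j + 1 = n"
  obtains i where "1 \<le> i" "i \<le> j" "Poly_Mapping.lookup m i > 0" "m + weight_step i \<in> L"
proof -
  define i where "i = Max {i. i \<le> j \<and> Poly_Mapping.lookup m i > 0}"
  have fin: "finite {i. i \<le> j \<and> Poly_Mapping.lookup m i > 0}" by simp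
  have i: "i \<le> j" "Poly_Mapping.lookup m i > 0"
    using Max_in[OF fin] assms unfolding i_def by blast+
  have larger: "Poly_Mapping.lookup m i' = 0" if "i < i'" "i' \<le> j" for i'
  proof (rule ccontr)
    assume "Poly_Mapping.lookup m i' \<noteq> 0"
    then have "Poly_Mapping.lookup m i' > 0" using labelD(1)[OF assms(1), of i'] by linarith
    then have "i' \<le> i" unfolding i_def using that by (intro Max_ge[OF fin]) auto
    then show False using that by simp
  qed
  have "1 \<le> i" using labelD(2)[OF assms(1), of i] i by (cases i) auto
  moreover have "m + weight_step i \<in> L"
    using i larger[of "i + 1"] assms(4) boson by (subst label_plus_step_iff[OF assms(1)]) auto
  ultimately show ?thesis using that i by blast
qed

lemma nonzero_label_entry:
  assumes "m \<in> L" "m \<noteq> 0" shows "\<exists>k\<le>n. Poly_Mapping.lookup m k > 0"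
proof -
  obtain k where "Poly_Mapping.lookup m k \<noteq> 0"
    using assms(2) by (metis lookup_zero poly_mapping_eqI)
  then show ?thesis
    using labelD(1,2)[OF assms(1), of k] by (intro exI[of _ k]) force
qed

lemma non_col_entry:
  assumes "m \<in> L" "m \<notin> range col" shows "\<exists>k<n. Poly_Mapping.lookup m k > 0"
proof (rule ccontr)
  assume "\<not> ?thesis"
  then have "Poly_Mapping.lookup m k = 0" if "k \<noteq> n" for k
    using that labelD(1,2)[OF assms(1), of k] by (cases "k < n") force+
  then have "m = col (nat (Poly_Mapping.lookup m n))"
    using labelD(1)[OF assms(1), of n] by (intro poly_mapping_eqI) (auto simp: lookup_col)
  then show False using assms(2) by blast
qed

lemma lookup_ket: "Poly_Mapping.lookup (kt m) c = (if m \<in> L \<and> m = c then 1 else 0)"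
  by (auto simp: ket_def lookup_bvec)

lemma lookup_Act_E:
  assumes "\<psi> \<in> W2" "a \<in> L" "b \<in> L" "1 \<le> i" "i \<le> n"
  shows "Poly_Mapping.lookup (Act u v (fgen (E i)) \<psi>) (a, b)
    = Poly_Mapping.lookup \<psi> (a, b - weight_step i) * qint (Poly_Mapping.lookup (b - weight_step i) i)
      + Poly_Mapping.lookup \<psi> (a - weight_step i, b) * qint (Poly_Mapping.lookup (a - weight_step i) i) * K_eig i b"
    (is "?P \<psi>")
proof -
  have "\<psi> \<in> Collect ?P"
  proof (rule W2_induct[OF assms(1)])
    show "VS.subspace (Collect ?P)"
      by (rule VS.subspaceI)
        (auto simp: lin_zero[OF lin_free_act] lin_add[OF lin_free_act] lin_scale[OF lin_free_act]
          lookup_add algebra_simps)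
    show "bvec (c, d) \<in> Collect ?P" if "c \<in> L" "d \<in> L" for c d
      using assms that
      by (auto simp: E_pair rep_gen_E E_coeff_def lookup_add lookup_bvec lookup_ket)
  qed
  then show ?thesis by simp
qed

lemma lookup_Act_K:
  assumes "\<psi> \<in> W2" "a \<in> L" "b \<in> L"
  shows "Poly_Mapping.lookup (Act u v (fgen (K i)) \<psi>) (a, b) = K_eig i a * K_eig i b * Poly_Mapping.lookup \<psi> (a, b)"
    (is "?P \<psi>")
proof -
  have "\<psi> \<in> Collect ?P"
  proof (rule W2_induct[OF assms(1)])
    show "VS.subspace (Collect ?P)"
      by (rule VS.subspaceI)
        (auto simp: lin_zero[OF lin_free_act] lin_add[OF lin_free_act] lin_scale[OF lin_free_act]
          lookup_add algebra_simps)
    show "bvec (c, d) \<in> Collect ?P" if "c \<in> L" "d \<in> L" for c d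
      using assms that by (auto simp: K_pair lookup_bvec)
  qed
  then show ?thesis by simp
qed

lemma keys_W2: "\<psi> \<in> W2 \<Longrightarrow> Poly_Mapping.lookup \<psi> (a, b) \<noteq> 0 \<Longrightarrow> a \<in> L \<and> b \<in> L"
  by (auto simp: WW_def in_keys_iff subset_iff)

text \<open>
  Take \<open>|a\<rangle> \<otimes> |b\<rangle>\<close> in the support with \<open>a\<close> of maximal height. In \<open>e\<^sub>i \<psi> = 0\<close> the terms with left factor
  \<open>|a\<rangle>\<close> come only from \<open>1 \<otimes> e\<^sub>i\<close>, since \<open>e\<^sub>i \<otimes> k\<^sub>i\<close> would have to start from a higher left factor. So
  every \<open>e\<^sub>i\<close> kills \<open>|b\<rangle>\<close>, which forces \<open>b = 0\<close>.
\<close>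

lemma singular_determined_by_left:
  assumes "\<psi> \<in> W2" "\<And>i. 1 \<le> i \<Longrightarrow> i \<le> n \<Longrightarrow> Act u v (fgen (E i)) \<psi> = 0"
    "\<And>a. Poly_Mapping.lookup \<psi> (a, 0) = 0"
  shows "\<psi> = 0"
proof (rule ccontr)
  assume "\<psi> \<noteq> 0"
  \<comment> \<open>A pair of labels in the support of \<open>\<psi>\<close> whose left label has maximal height.\<close>
  let ?S = "(\<lambda>(a, b). height a) ` Poly_Mapping.keys \<psi>"
  have S: "finite ?S" "?S \<noteq> {}"
    using \<open>\<psi> \<noteq> 0\<close> by (auto simp: poly_mapping_eq_iff in_keys_iff fun_eq_iff)
  obtain a b where ab: "(a, b) \<in> Poly_Mapping.keys \<psi>" and max: "height a = Max ?S"
    using Max_in[OF S] by auto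
  have maximal: "height a' \<le> height a" if "Poly_Mapping.lookup \<psi> (a', b') \<noteq> 0" for a' b'
    unfolding max using that S by (intro Max_ge) (auto simp: image_iff in_keys_iff intro!: bexI[of _ "(a', b')"])
  have L: "a \<in> L" "b \<in> L" and nz: "Poly_Mapping.lookup \<psi> (a, b) \<noteq> 0"
    using ab keys_W2[OF assms(1)] by (auto simp: in_keys_iff)
  have "b \<noteq> 0" using nz assms(3) by auto
  then obtain k where "k \<le> n" "Poly_Mapping.lookup b k > 0" using nonzero_label_entry L by blast
  then obtain i where i: "1 \<le> i" "i \<le> n" "Poly_Mapping.lookup b i > 0" "b + weight_step i \<in> L"
    using movable_entry[OF L(2), of k n] by blast
  have "Poly_Mapping.lookup \<psi> (a - weight_step i, b + weight_step i) = 0"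
    using maximal[of "a - weight_step i" "b + weight_step i"] height_weight_step[OF i(1,2)]
    by (auto simp: height_minus)
  then have "0 = Poly_Mapping.lookup \<psi> (a, b) * qint (Poly_Mapping.lookup b i)"
    using lookup_Act_E[OF assms(1) L(1) i(4,1,2), of u v] assms(2)[OF i(1,2)] by simp
  then show False using nz i(3) by (simp add: qint_eq_0_iff)
qed

text \<open>
  If \<open>e\<^sub>i\<close> moves an entry of \<open>a\<close>, then the coefficient of \<open>e\<^sub>i \<psi>\<close> at the shifted left label and the right
  label \<open>0\<close> comes from \<open>|a\<rangle> \<otimes> |0\<rangle>\<close> alone: for \<open>i < n\<close> no label is sent to \<open>0\<close> by \<open>e\<^sub>i\<close>.
\<close>

lemma singular_left_label:
  assumes "\<psi> \<in> W2" "\<And>i. 1 \<le> i \<Longrightarrow> i < n \<Longrightarrow> Act u v (fgen (E i)) \<psi> = 0"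
    "Poly_Mapping.lookup \<psi> (a, 0) \<noteq> 0"
  shows "a \<in> range col"
proof (rule ccontr)
  assume "a \<notin> range col"
  have L: "a \<in> L" using keys_W2[OF assms(1,3)] by simp
  then obtain k where "k < n" "Poly_Mapping.lookup a k > 0" using non_col_entry \<open>a \<notin> range col\<close> by blast
  then obtain i where i: "1 \<le> i" "i \<le> n - 1" "Poly_Mapping.lookup a i > 0" "a + weight_step i \<in> L"
    using movable_entry[OF L, of k "n - 1"] fermion by force
  then have i': "i < n" "i \<le> n" using fermion by auto
  have "0 - weight_step i \<notin> L"
    using labelD(1)[of "0 - weight_step i" "i + 1"] i' by (auto simp: lookup_weight_step lookup_minus)
  then have "Poly_Mapping.lookup \<psi> (a + weight_step i, 0 - weight_step i) = 0"
    using keys_W2[OF assms(1)] by blast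
  then have "0 = Poly_Mapping.lookup \<psi> (a, 0) * qint (Poly_Mapping.lookup a i) * K_eig i 0"
    using lookup_Act_E[OF assms(1) i(4) zero_label i(1) i'(2), of u v] assms(2)[OF i(1) i'(1)] by simp
  then show False using assms(3) i(3) by (simp add: qint_eq_0_iff)
qed

lemma K_eig_col: "K_eig n (col a) = p * q powi (- int a)"
  using boson by (simp add: k_eigenvalue_def qi_def lookup_col power_int_minus)

lemma weight_step_n: "weight_step n = - unitv n"
  using fermion by (simp add: weight_step_def)

lemma col_Suc: "col (Suc a) = col a + unitv n"
  by (rule poly_mapping_eqI) (simp add: lookup_col lookup_add unitv_def lookup_single when_def)

text \<open>
  The recursion that makes the two parts of \<open>e\<^sub>n \<xi>\<^sub>l\<close> cancel.
\<close>

lemma sing_coeff_Suc: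
  assumes "m < l"
  shows "sing_coeff l (Suc m) * qint (int (Suc m)) * (p * q powi (- int (l - Suc m)))
    = - (sing_coeff l m * qint (int (l - m)))"
proof -
  have "int (Suc m) * (2 * int l - int (Suc m) - 1)
      = int m * (2 * int l - int m - 1) + 2 * int (l - Suc m)"
    using assms by (simp add: of_nat_diff algebra_simps)
  then have "qhalf powi (int (Suc m) * (2 * int l - int (Suc m) - 1))
      = qhalf powi (int m * (2 * int l - int m - 1)) * q powi int (l - Suc m)"
    by (simp add: power_int_add q_def power_int_mult)
  moreover have "(- p) powi (- int (Suc m)) * p = - ((- p) powi (- int m))"
    using power_int_add_1[of "- p" "- int (Suc m)"] by simp
  moreover have "q powi int (l - Suc m) * q powi (- int (l - Suc m)) = 1"
    by (simp add: power_int_minus)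
  ultimately have "((- p) powi (- int (Suc m)) * qhalf powi (int (Suc m) * (2 * int l - int (Suc m) - 1)))
      * (p * q powi (- int (l - Suc m)))
      = - ((- p) powi (- int m) * qhalf powi (int m * (2 * int l - int m - 1)))"
    by (smt (verit) mult.assoc mult.commute mult_minus_left mult.right_neutral)
  then show ?thesis
    unfolding sing_coeff_def using qbinom_absorb[OF assms]
    by (smt (verit) mult.assoc mult.commute mult_minus_left)
qed

text \<open>
  For \<open>i < n\<close> the moved entry is \<open>0\<close>. For \<open>i = n\<close> the contribution of \<open>e\<^sub>n \<otimes> k\<^sub>n\<close> to the term \<open>m + 1\<close> of
  \<open>\<xi>\<^sub>l\<close> cancels that of \<open>1 \<otimes> e\<^sub>n\<close> to the term \<open>m\<close>.
\<close>

lemma sing_vec_singular: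
  assumes "1 \<le> i" "i \<le> n" shows "Act u v (fgen (E i)) (\<xi> l) = 0"
proof (cases "i = n")
  case False
  then have "Act u v (fgen (E i)) (bvec (col a, col b)) = 0" for a b
    using assms by (simp add: E_pair rep_gen_E E_coeff_def lookup_col)
  then show ?thesis
    by (simp add: sing_vec_eq lin_sum[OF lin_free_act] lin_scale[OF lin_free_act])
next
  case True
  have E0: "rep_gen \<kappa> \<kappa>' u (E n) (col 0) = 0" for u
    using fermion by (simp add: rep_gen_E E_coeff_def lookup_col)
  have ES: "rep_gen \<kappa> \<kappa>' u (E n) (col (Suc a)) = qint (int (Suc a)) *\<^sub>K bvec (col a)" for u a
    using fermion by (simp add: rep_gen_E E_coeff_def lookup_col lookup_add unitv_def weight_step_n col_Suc ket_label[OF col_label] add.commute)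
  show ?thesis
  proof (cases l)
    case 0
    then show ?thesis using True
      by (simp add: sing_vec_eq lin_scale[OF lin_free_act] E_pair E0)
  next
    case (Suc k)
    have "Act u v (fgen (E n)) (\<xi> l) = (\<Sum>m = 0..Suc k. sing_coeff l m *\<^sub>K
        tens (bvec (col m)) (rep_gen \<kappa> \<kappa>' v (E n) (col (Suc k - m))))
      + (\<Sum>m = 0..Suc k. (sing_coeff l m * K_eig n (col (Suc k - m))) *\<^sub>K
        tens (rep_gen \<kappa> \<kappa>' u (E n) (col m)) (bvec (col (Suc k - m))))"
      by (simp only: sing_vec_eq Suc lin_sum[OF lin_free_act] lin_scale[OF lin_free_act] E_pair col_label
          order_refl VS.scale_right_distrib sum.distrib lin_ext_bvec VS.scale_scale)
    also have "(\<Sum>m = 0..Suc k. sing_coeff l m *\<^sub>K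
        tens (bvec (col m)) (rep_gen \<kappa> \<kappa>' v (E n) (col (Suc k - m))))
      = (\<Sum>m = 0..k. (sing_coeff l m * qint (int (l - m))) *\<^sub>K bvec (col m, col (k - m)))"
      by (simp add: E0) (intro sum.cong; simp add: Suc_diff_le ES tens_scale_right Suc)
    also have "(\<Sum>m = 0..Suc k. (sing_coeff l m * K_eig n (col (Suc k - m))) *\<^sub>K
        tens (rep_gen \<kappa> \<kappa>' u (E n) (col m)) (bvec (col (Suc k - m))))
      = (\<Sum>m = 0..k. (sing_coeff l (Suc m) * K_eig n (col (k - m)) * qint (int (Suc m))) *\<^sub>K
          bvec (col m, col (k - m)))"
      by (subst sum.atLeast0_atMost_Suc_shift) (simp add: E0 ES tens_scale_left del: of_nat_Suc)
    also have "\<dots> = (\<Sum>m = 0..k. - (sing_coeff l m * qint (int (l - m))) *\<^sub>K bvec (col m, col (k - m)))"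
    proof (intro sum.cong refl arg_cong2[where f = scl])
      fix m assume "m \<in> {0..k}"
      then show "sing_coeff l (Suc m) * K_eig n (col (k - m)) * qint (int (Suc m))
          = - (sing_coeff l m * qint (int (l - m)))"
        using sing_coeff_Suc[of m l] Suc by (simp only: K_eig_col) (simp add: mult_ac)
    qed
    finally show ?thesis
      using True by (simp add: sum_negf)
  qed
qed

lemma sing_vec_weight: "Act u v (fgen (K n)) (\<xi> l) = (p * p * q powi (- int l)) *\<^sub>K \<xi> l"
proof -
  have "Act u v (fgen (K n)) (bvec (col m, col (l - m))) = (p * p * q powi (- int l)) *\<^sub>K bvec (col m, col (l - m))"
    if "m \<le> l" for m
  proof -
    have "q powi (- int m) * q powi (- int (l - m)) = q powi (- int l)"
      using that by (simp flip: power_int_add)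
    then show ?thesis
      by (simp only: K_pair col_label K_eig_col) (simp add: mult_ac)
  qed
  then show ?thesis
    unfolding sing_vec_eq
    by (simp add: lin_sum[OF lin_free_act] lin_scale[OF lin_free_act] VS.scale_sum_right mult.commute)
qed

lemma sing_coeff_nonzero: "sing_coeff l m \<noteq> 0"
  by (simp add: sing_coeff_def qbinom_nonzero)

lemma lookup_sing_vec: "m \<le> l \<Longrightarrow> Poly_Mapping.lookup (\<xi> l) (col m, col (l - m)) = sing_coeff l m"
proof -
  assume "m \<le> l"
  have "Poly_Mapping.lookup (\<xi> l) (col m, col (l - m)) = (\<Sum>k = 0..l. if k = m then sing_coeff l k else 0)"
    unfolding sing_vec_eq lookup_sum by (intro sum.cong) (auto simp: lookup_bvec)
  then show ?thesis using \<open>m \<le> l\<close> by simp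
qed

text \<open>
  A singular vector is determined by its coefficients at \<open>|a\<rangle> \<otimes> |0\<rangle>\<close>; these live at multiples of \<open>e\<^sub>n\<close>,
  and the eigenvalue of \<open>k\<^sub>n\<close> leaves only \<open>a = l e\<^sub>n\<close>. Subtracting the multiple of \<open>\<xi>\<^sub>l\<close> with the same
  coefficient there leaves \<open>0\<close>.
\<close>

lemma singular_proportional:
  assumes "\<psi> \<in> W2" "\<And>i. 1 \<le> i \<Longrightarrow> i \<le> n \<Longrightarrow> Act u v (fgen (E i)) \<psi> = 0"
    "Act u v (fgen (K n)) \<psi> = (p * p * q powi (- int l)) *\<^sub>K \<psi>"
  shows "\<exists>c. \<psi> = c *\<^sub>K \<xi> l"
proof -
  have lz: "Poly_Mapping.lookup \<phi> (a, 0) = 0"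
    if A: "\<phi> \<in> W2" "\<And>i. 1 \<le> i \<Longrightarrow> i \<le> n \<Longrightarrow> Act u v (fgen (E i)) \<phi> = 0"
      "Act u v (fgen (K n)) \<phi> = (p * p * q powi (- int l)) *\<^sub>K \<phi>" "a \<noteq> col l" for \<phi> a
  proof (rule ccontr)
    assume nz: "Poly_Mapping.lookup \<phi> (a, 0) \<noteq> 0"
    then obtain k where k: "a = col k"
      using singular_left_label[OF A(1), of u v a] A(2) by auto
    have "K_eig n (col k) * K_eig n (col 0) = p * p * q powi (- int l)"
      using lookup_Act_K[OF A(1) col_label col_label, of u v n k 0] nz
      unfolding A(3) k by (simp add: col_0)
    then have "q powi (- int k) = q powi (- int l)"
      by (simp add: K_eig_col)
    then show False using A(4) k by (simp add: q_powi_inj)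
  qed
  define c where "c = Poly_Mapping.lookup \<psi> (col l, 0) / sing_coeff l l"
  have "\<psi> - c *\<^sub>K \<xi> l = 0"
  proof (rule singular_determined_by_left)
    show W: "\<psi> - c *\<^sub>K \<xi> l \<in> W2"
      by (intro VS.subspace_diff VS.subspace_scale subspace_W2 assms(1) sing_vec_in_W2)
    show E: "Act u v (fgen (E i)) (\<psi> - c *\<^sub>K \<xi> l) = 0" if "1 \<le> i" "i \<le> n" for i
      using that assms(2) sing_vec_singular by (simp add: lin_diff[OF lin_free_act] lin_scale[OF lin_free_act])
    have K: "Act u v (fgen (K n)) (\<psi> - c *\<^sub>K \<xi> l) = (p * p * q powi (- int l)) *\<^sub>K (\<psi> - c *\<^sub>K \<xi> l)"
      by (simp add: lin_diff[OF lin_free_act] lin_scale[OF lin_free_act] assms(3) sing_vec_weight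
          VS.scale_right_diff_distrib mult.commute)
    show "Poly_Mapping.lookup (\<psi> - c *\<^sub>K \<xi> l) (a, 0) = 0" for a
    proof (cases "a = col l")
      case True
      then show ?thesis
        using lookup_sing_vec[of l l] sing_coeff_nonzero by (simp add: lookup_minus c_def col_0)
    next
      case False
      then show ?thesis using lz[OF W E K] by blast
    qed
  qed
  then show ?thesis by (intro exI[of _ c]) simp
qed

end

section \<open>Coinvariants and spanning\<close>

text \<open>
  Modulo the image of \<open>f\<^sub>n\<close> one has \<open>|(a+1) e\<^sub>n\<rangle> \<otimes> |b e\<^sub>n\<rangle> = - p\<^sup>-\<^sup>1 q\<^sup>a |a e\<^sub>n\<rangle> \<otimes> |(b+1) e\<^sub>n\<rangle>\<close>. The numbers
  \<open>psi_coeff a\<close> accumulate these factors until the left label is \<open>0\<close>.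
\<close>

primrec psi_coeff :: "nat \<Rightarrow> fld" where
  "psi_coeff 0 = 1"
| "psi_coeff (Suc a) = - inverse p * q ^ a * psi_coeff a"

context type_B
begin

definition psi_weight :: "label \<times> label \<Rightarrow> fld" where
  "psi_weight ab = (if fst ab \<in> range col \<and> snd ab \<in> range col
     then psi_coeff (nat (Poly_Mapping.lookup (fst ab) n)) else 0)"

abbreviation psi :: "vec2 \<Rightarrow> fld" where "psi \<equiv> weighted_sum psi_weight"

lemma psi_bvec_col: "psi (bvec (col a, col b)) = psi_coeff a"
  by (simp add: psi_weight_def lookup_col)

lemma label_plus_unitv_n: "a \<in> L \<Longrightarrow> a + unitv n \<in> L"
  using label_minus_step_iff[of a n] boson by (simp add: weight_step_n)

lemma plus_unitv_n_col_iff: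
  assumes "a \<in> L" shows "a + unitv n \<in> range col \<longleftrightarrow> a \<in> range col"
proof
  assume "a + unitv n \<in> range col"
  then obtain k where k: "a + unitv n = col k" by blast
  then have "Poly_Mapping.lookup a n + 1 = int k"
    using lookup_add[of a "unitv n" n] by (simp add: lookup_col unitv_def)
  then have "k = Suc (nat (Poly_Mapping.lookup a n))"
    using labelD(1)[OF assms, of n] by simp
  then show "a \<in> range col" using k col_Suc by (metis add_right_cancel rangeI)
qed (auto simp flip: col_Suc)

lemma F_n_pair:
  assumes "a \<in> L" "b \<in> L"
  shows "Act u v (fgen (F n)) (bvec (a, b)) = bvec (a + unitv n, b) + inverse (K_eig n a) *\<^sub>K bvec (a, b + unitv n)"
  using assms fermion
  by (simp add: F_pair rep_gen_F F_coeff_def weight_step_n ket_label label_plus_unitv_n)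

lemma psi_F_n:
  assumes "\<psi> \<in> W2" shows "psi (Act u v (fgen (F n)) \<psi>) = 0"
proof -
  have "\<psi> \<in> {\<psi>. psi (Act u v (fgen (F n)) \<psi>) = 0}"
  proof (rule W2_induct[OF assms])
    show "VS.subspace {\<psi>. psi (Act u v (fgen (F n)) \<psi>) = 0}"
      by (rule VS.subspaceI)
        (auto simp: lin_zero[OF lin_free_act] lin_add[OF lin_free_act] lin_scale[OF lin_free_act]
          weighted_sum_add weighted_sum_scale)
    show "bvec (a, b) \<in> {\<psi>. psi (Act u v (fgen (F n)) \<psi>) = 0}" if L: "a \<in> L" "b \<in> L" for a b
    proof (cases "a \<in> range col \<and> b \<in> range col")
      case True
      then obtain k j where kj: "a = col k" "b = col j" by blast
      have "psi (Act u v (fgen (F n)) (bvec (a, b))) = psi_coeff (Suc k) + inverse (K_eig n (col k)) * psi_coeff k"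
        unfolding kj F_n_pair[OF col_label col_label] weighted_sum_add weighted_sum_scale col_Suc[symmetric] psi_bvec_col ..
      also have "\<dots> = 0"
        by (simp add: K_eig_col power_int_minus)
      finally show ?thesis by simp
    next
      case False
      then have "psi_weight (a + unitv n, b) = 0" "psi_weight (a, b + unitv n) = 0"
        using plus_unitv_n_col_iff L by (auto simp: psi_weight_def)
      then show ?thesis
        by (simp add: F_n_pair[OF L] weighted_sum_add weighted_sum_scale)
    qed
  qed
  then show ?thesis by simp
qed

lemma sing_coeff_psi_coeff:
  "m \<le> l \<Longrightarrow> sing_coeff l m * psi_coeff m = (- 1) ^ m * q ^ (m * l) * qbinom l m"
proof -
  assume "m \<le> l"
  define s where "s k = (- p) powi (- int k) * qhalf powi (int k * (2 * int l - int k - 1)) * psi_coeff k" for k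
  have "s k = (- 1) ^ k * q ^ (k * l)" if "k \<le> l" for k
    using that
  proof (induction k)
    case 0
    then show ?case by (simp add: s_def)
  next
    case (Suc k)
    have "int (Suc k) * (2 * int l - int (Suc k) - 1)
        = int k * (2 * int l - int k - 1) + 2 * int (l - Suc k)"
      using Suc.prems by (simp add: of_nat_diff algebra_simps)
    then have "qhalf powi (int (Suc k) * (2 * int l - int (Suc k) - 1))
        = qhalf powi (int k * (2 * int l - int k - 1)) * q ^ (l - Suc k)"
      by (simp add: power_int_add q_def power_int_mult)
    moreover have "(- p) powi (- int (Suc k)) = (- p) powi (- int k) * inverse (- p)"
      using power_int_add_1[of "- p" "- int (Suc k)"] by (simp add: field_simps)
    ultimately have "s (Suc k) = s k * (inverse p * inverse p * (q ^ (l - Suc k) * q ^ k))"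
      by (simp add: s_def mult_ac)
    also have "inverse p * inverse p = - q"
      using p_square by (simp flip: inverse_mult_distrib)
    also have "q ^ (l - Suc k) * q ^ k = q ^ (l - 1)"
      using Suc.prems by (simp flip: power_add)
    also have "- q * q ^ (l - 1) = - (q ^ l)"
      using Suc.prems by (cases l) auto
    finally show ?case
      using Suc by (simp add: power_add mult_ac)
  qed
  from this[OF \<open>m \<le> l\<close>] show ?thesis
    by (simp add: s_def sing_coeff_def mult_ac)
qed

lemma psi_sing_vec: "psi (\<xi> l) = (\<Prod>j<l. 1 - q ^ (2 * j + 1))"
proof -
  have "psi (\<xi> l) = (\<Sum>m = 0..l. sing_coeff l m * psi_coeff m)"
    by (simp only: sing_vec_eq weighted_sum_sum weighted_sum_scale psi_bvec_col)
  also have "\<dots> = (\<Sum>m = 0..l. (- 1) ^ m * q ^ (m * l) * qbinom l m)"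
    by (rule sum.cong) (simp_all add: sing_coeff_psi_coeff)
  finally show ?thesis by (simp only: alternating_qbinom_sum)
qed

text \<open>
  No factor vanishes as \<open>q\<close> is not a root of unity. Hence \<open>\<xi>\<^sub>l\<close> is not in the image of \<open>f\<^sub>n\<close>;
  modulo that image it is a nonzero multiple of \<open>|0\<rangle> \<otimes> |l e\<^sub>n\<rangle>\<close>.
\<close>

lemma psi_sing_vec_nonzero: "psi (\<xi> l) \<noteq> 0"
proof -
  have "1 - q ^ (2 * j + 1) \<noteq> 0" for j
    using q_power_neq_one[of "2 * j + 1"] by (metis add_gr_0 right_minus_eq zero_less_one)
  then show ?thesis
    by (simp only: psi_sing_vec prod_zero_iff finite_lessThan) blast
qed

text \<open>
  The subspace \<open>N\<close> is kept abstract: it will be the image of \<open>f\<^sub>n\<close> in one application, and a subspace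
  about which membership is known only in lower degree in the other.
\<close>

lemma reduce_to_right:
  assumes "VS.subspace N" "\<And>a b. Suc (a + b) = l \<Longrightarrow> Act u v (fgen (F n)) (bvec (col a, col b)) \<in> N"
    "a + b = l"
  shows "bvec (col a, col b) - psi_coeff a *\<^sub>K bvec (0, col l) \<in> N"
  using assms(3)
proof (induction a arbitrary: b)
  case 0
  then show ?case using VS.subspace_0[OF assms(1)] by (simp add: col_0)
next
  case (Suc a)
  let ?c = "inverse p * q ^ a"
  have F: "Act u v (fgen (F n)) (bvec (col a, col b)) = bvec (col (Suc a), col b) + ?c *\<^sub>K bvec (col a, col (Suc b))"
    by (simp add: F_n_pair K_eig_col power_int_minus flip: col_Suc)
  have in_N: "Act u v (fgen (F n)) (bvec (col a, col b)) \<in> N"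
    using assms(2) Suc.prems by simp
  have IH: "bvec (col a, col (Suc b)) - psi_coeff a *\<^sub>K bvec (0, col l) \<in> N"
    using Suc by simp
  have "(bvec (col (Suc a), col b) + ?c *\<^sub>K bvec (col a, col (Suc b)))
      - ?c *\<^sub>K (bvec (col a, col (Suc b)) - psi_coeff a *\<^sub>K bvec (0, col l)) \<in> N"
    using VS.subspace_diff[OF assms(1) in_N VS.subspace_scale[OF assms(1) IH, of ?c]] unfolding F .
  then show ?case
    by (simp add: VS.scale_right_diff_distrib)
qed

lemma reduce_span_to_right:
  assumes "VS.subspace N" "\<And>a b. Suc (a + b) = l \<Longrightarrow> Act u v (fgen (F n)) (bvec (col a, col b)) \<in> N"
    "\<psi> \<in> VS.span {bvec (col a, col b) | a b. a + b = l}"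
  shows "\<psi> - psi \<psi> *\<^sub>K bvec (0, col l) \<in> N"
proof (rule VS.span_induct[OF assms(3)])
  show "VS.subspace {\<psi>. \<psi> - psi \<psi> *\<^sub>K bvec (0, col l) \<in> N}"
  proof (rule VS.subspaceI; clarsimp)
    show "0 \<in> N" by (rule VS.subspace_0[OF assms(1)])
  next
    fix \<psi> \<phi> assume "\<psi> - psi \<psi> *\<^sub>K bvec (0, col l) \<in> N" "\<phi> - psi \<phi> *\<^sub>K bvec (0, col l) \<in> N"
    from VS.subspace_add[OF assms(1) this]
    show "\<psi> + \<phi> - psi (\<psi> + \<phi>) *\<^sub>K bvec (0, col l) \<in> N"
      by (simp add: weighted_sum_add VS.scale_left_distrib algebra_simps)
  next
    fix c \<psi> assume "\<psi> - psi \<psi> *\<^sub>K bvec (0, col l) \<in> N"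
    from VS.subspace_scale[OF assms(1) this, of c]
    show "c *\<^sub>K \<psi> - psi (c *\<^sub>K \<psi>) *\<^sub>K bvec (0, col l) \<in> N"
      by (simp add: weighted_sum_scale VS.scale_right_diff_distrib)
  qed
  show "\<phi> - psi \<phi> *\<^sub>K bvec (0, col l) \<in> N"
    if "\<phi> \<in> {bvec (col a, col b) | a b. a + b = l}" for \<phi>
  proof -
    from that obtain a b where "\<phi> = bvec (col a, col b)" "a + b = l" by blast
    then show ?thesis using reduce_to_right[OF assms(1,2), of l a b] by (simp only: psi_bvec_col)
  qed
qed

lemma sing_vec_in_span: "\<xi> l \<in> VS.span {bvec (col a, col b) | a b. a + b = l}"
proof -
  have "bvec (col m, col (l - m)) \<in> {bvec (col a, col b) | a b. a + b = l}" if "m \<in> {0..l}" for m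
    unfolding mem_Collect_eq by (rule exI[of _ m], rule exI[of _ "l - m"]) (use that in simp)
  then show ?thesis
    unfolding sing_vec_eq by (intro VS.span_sum VS.span_scale VS.span_base)
qed

text \<open>
  Induction on the height of \<open>|a\<rangle> \<otimes> |b\<rangle>\<close>, and then on that of \<open>a\<close>. By induction \<open>N\<close> contains the images
  under \<open>f\<^sub>1, ..., f\<^sub>n\<close> of everything of smaller height. Modulo these images \<open>f\<^sub>i |a'\<rangle> \<otimes> |b\<rangle>\<close> is a multiple
  of \<open>|a'\<rangle> \<otimes> f\<^sub>i |b\<rangle>\<close>, so the left factor can be brought to \<open>|0\<rangle>\<close>; then the right factor must be some
  \<open>|l e\<^sub>n\<rangle>\<close>, and \<open>\<xi>\<^sub>l\<close> supplies this last vector.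
\<close>

lemma spanned_by_singular_vectors:
  assumes N: "VS.subspace N"
    and F: "\<And>i \<psi>. 1 \<le> i \<Longrightarrow> i \<le> n \<Longrightarrow> \<psi> \<in> N \<Longrightarrow> Act u v (fgen (F i)) \<psi> \<in> N"
    and \<xi>: "\<And>l. \<xi> l \<in> N"
  shows "W2 \<subseteq> N"
proof -
  have cancel: "\<phi> \<in> N" if "c *\<^sub>K \<phi> \<in> N" "c \<noteq> 0" for c and \<phi> :: vec2
    using VS.subspace_scale[OF N that(1), of "inverse c"] that(2) by simp
  have "bvec (a, b) \<in> N" if "a \<in> L" "b \<in> L" for a b
    using that
  proof (induction "(a, b)" arbitrary: a b rule: wf_induct[OF wf_measures[of "[\<lambda>(a, b). nat (height a + height b), \<lambda>(a, b). nat (height a)]"]])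
    case 1
    have IH: "bvec (a', b') \<in> N" if "a' \<in> L" "b' \<in> L"
      "height a' + height b' < height a + height b \<or>
        height a' + height b' = height a + height b \<and> height a' < height a" for a' b'
      using 1(1) that height_nonneg[of a'] height_nonneg[of b'] by auto
    have L: "a \<in> L" "b \<in> L" by fact+
    consider "a \<noteq> 0" | "a = 0" "b \<notin> range col" | l where "a = 0" "b = col l" by blast
    then show ?case
    proof cases
      \<comment> \<open>\<open>|a\<rangle>\<close> is proportional to \<open>f\<^sub>i |a'\<rangle>\<close>, and \<open>f\<^sub>i\<close> is transferred to the right factor.\<close>
      case 1
      obtain k where "k \<le> n" "Poly_Mapping.lookup a k > 0" using nonzero_label_entry L 1 by blast
      then obtain i where i: "1 \<le> i" "i \<le> n" "Poly_Mapping.lookup a i > 0" "a + weight_step i \<in> L"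
        using movable_entry[OF L(1), of k n] by blast
      let ?a = "a + weight_step i"
      note h = height_weight_step[OF i(1,2)]
      have "height ?a = height a - 1" "height (b - weight_step i) = height b + 1"
        by (simp_all add: height_add height_minus h)
      then have in_N: "bvec (?a, b) \<in> N" "b - weight_step i \<in> L \<Longrightarrow> bvec (?a, b - weight_step i) \<in> N"
        using IH i(4) L by auto
      have right: "tens (bvec ?a) (rep_op \<kappa> \<kappa>' v (F i) (bvec b)) \<in> N"
        using i in_N(2) VS.subspace_0[OF N] VS.subspace_scale[OF N]
        by (cases "b - weight_step i \<in> L") (simp_all add: rep_gen_F ket_label ket_outside tens_scale_right)
      have "Act u v (fgen (F i)) (bvec (?a, b)) = F_coeff u i ?a *\<^sub>K bvec (a, b)
          + inverse (K_eig i ?a) *\<^sub>K tens (bvec ?a) (rep_op \<kappa> \<kappa>' v (F i) (bvec b))"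
        using i L by (simp add: F_pair rep_gen_F ket_label tens_scale_left)
      then have "F_coeff u i ?a *\<^sub>K bvec (a, b) = Act u v (fgen (F i)) (bvec (?a, b))
          - inverse (K_eig i ?a) *\<^sub>K tens (bvec ?a) (rep_op \<kappa> \<kappa>' v (F i) (bvec b))"
        by simp
      moreover have "\<dots> \<in> N"
        by (rule VS.subspace_diff[OF N F[OF i(1,2) in_N(1)] VS.subspace_scale[OF N right]])
      moreover have "F_coeff u i ?a \<noteq> 0"
        using i labelD(1)[OF L(1), of "i + 1"] by (simp add: F_coeff_def lookup_add lookup_weight_step qint_eq_0_iff)
      ultimately show ?thesis using cancel by metis
    next
      \<comment> \<open>\<open>f\<^sub>i |0\<rangle> = 0\<close> for \<open>i < n\<close>, so \<open>|0\<rangle> \<otimes> f\<^sub>i |b'\<rangle>\<close> is itself in the image of \<open>f\<^sub>i\<close>.\<close>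
      case 2
      obtain k where "k < n" "Poly_Mapping.lookup b k > 0" using non_col_entry L 2 by blast
      then obtain i where i: "1 \<le> i" "i \<le> n - 1" "Poly_Mapping.lookup b i > 0" "b + weight_step i \<in> L"
        using movable_entry[OF L(2), of k "n - 1"] fermion by force
      then have i': "i < n" "i \<le> n" using fermion by auto
      let ?b = "b + weight_step i"
      have "bvec (0, ?b) \<in> N"
        using IH[of 0 ?b] i(4) 2 height_weight_step[OF i(1) i'(2)] by (simp add: height_add)
      then have "Act u v (fgen (F i)) (bvec (0, ?b)) \<in> N" by (rule F[OF i(1) i'(2)])
      moreover have "Act u v (fgen (F i)) (bvec (0, ?b)) = (inverse (K_eig i 0) * F_coeff v i ?b) *\<^sub>K bvec (0, b)"
        using i i' L by (simp add: F_pair rep_gen_F ket_label tens_scale_right F_coeff_def[of u])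
      moreover have "F_coeff v i ?b \<noteq> 0"
        using i i' labelD(1)[OF L(2), of "i + 1"] by (simp add: F_coeff_def lookup_add lookup_weight_step qint_eq_0_iff)
      ultimately show ?thesis using cancel 2(1) by (metis K_eig_nonzero inverse_nonzero_iff_nonzero mult_eq_0_iff)
    next
      \<comment> \<open>\<open>\<xi>\<^sub>l\<close> and \<open>psi (\<xi>\<^sub>l) |0\<rangle> \<otimes> |l e\<^sub>n\<rangle>\<close> agree up to the image of \<open>f\<^sub>n\<close>.\<close>
      case (3 l)
      have hc: "height (col (Suc k)) = height (col k) + 1" for k
        using boson by (simp add: col_Suc height_add height_unitv)
      have h0: "height 0 = 0" by (simp add: height_def)
      have hl: "height (col k) = int k" for k
        by (induction k) (simp_all add: hc col_0 h0)
      have "\<xi> l - psi (\<xi> l) *\<^sub>K bvec (0, col l) \<in> N"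
      proof (rule reduce_span_to_right[OF N _ sing_vec_in_span])
        fix k j assume "Suc (k + j) = l"
        then have "bvec (col k, col j) \<in> N"
          using IH[of "col k" "col j"] 3 by (simp add: hl h0)
        then show "Act u v (fgen (F n)) (bvec (col k, col j)) \<in> N"
          using F[of n] fermion by simp
      qed
      from VS.subspace_diff[OF N \<xi>[of l] this] have "psi (\<xi> l) *\<^sub>K bvec (0, col l) \<in> N"
        by simp
      then show ?thesis using cancel psi_sing_vec_nonzero 3 by blast
    qed
  qed
  then show ?thesis using W2_induct[OF _ N] by blast
qed

section \<open>Raising through the affine node\<close>

text \<open>
  The product \<open>e\<^sub>i ... e\<^sub>1 e\<^sub>0\<close>: the node \<open>0\<close> creates a particle at position \<open>1\<close>, which is then carried to
  the position \<open>i + 1\<close>. For \<open>i = n - 1\<close> the label \<open>l e\<^sub>n\<close> becomes \<open>(l+1) e\<^sub>n\<close>.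
\<close>

primrec affine_raise :: "nat \<Rightarrow> free" where
  "affine_raise 0 = fgen (E 0)"
| "affine_raise (Suc i) = fgen (E (Suc i)) * affine_raise i"

lemma affine_raise_in_carrier: "i \<le> n \<Longrightarrow> affine_raise i \<in> carrier (free_alg {0..n})"
  by (induction i) (auto intro!: free_alg_mult free_alg_fgen)

lemma col_plus_unitv_label: "1 \<le> k \<Longrightarrow> k \<le> n \<Longrightarrow> col a + unitv k \<in> L"
  using boson by (intro labelI) (auto simp: lookup_add lookup_col unitv_def lookup_single when_def)

lemma affine_raise_pair:
  assumes "i < n"
  shows "Act u v (affine_raise i) (bvec (col a, col b)) = v *\<^sub>K bvec (col a, col b + unitv (Suc i))
    + (u * inverse p * (if Suc i = n then q ^ b else 1)) *\<^sub>K bvec (col a + unitv (Suc i), col b)"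
  using assms
proof (induction i)
  case 0
  have "Suc 0 \<noteq> n" using fermion boson by simp
  moreover have "K_eig 0 (col b) = inverse p"
    using fermion boson by (simp add: k_eigenvalue_def lookup_col)
  moreover have "col c + unitv (Suc 0) \<in> L" for c
    using col_plus_unitv_label[of 1 c] fermion by simp
  ultimately show ?case
    using 0 by (simp add: E_pair rep_gen_E E_coeff_def weight_step_def ket_label
        tens_scale_left tens_scale_right mult.commute)
next
  case (Suc i)
  let ?j = "Suc i"
  have j: "?j < n" "?j \<noteq> n" using Suc.prems by simp_all
  have step: "unitv ?j + weight_step ?j = unitv (Suc ?j)"
    using j by (simp add: weight_step_def)
  have K: "K_eig ?j (col b) = (if Suc ?j = n then q ^ b else 1)"
    using j boson by (auto simp: k_eigenvalue_def lookup_col qi_def Let_def)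
  have zero: "rep_gen \<kappa> \<kappa>' w (E ?j) (col c) = 0" for w c
    using j by (simp add: rep_gen_E E_coeff_def lookup_col)
  have one: "rep_gen \<kappa> \<kappa>' w (E ?j) (col c + unitv ?j) = bvec (col c + unitv (Suc ?j))" for w c
  proof -
    have "Poly_Mapping.lookup (col c + unitv ?j) ?j = 1"
      using j by (simp add: lookup_add lookup_col unitv_def)
    then show ?thesis
      using j col_plus_unitv_label[of "Suc ?j" c]
      by (simp add: rep_gen_E E_coeff_def add.assoc step ket_label)
  qed
  have L: "col c + unitv ?j \<in> L" for c using col_plus_unitv_label[of ?j c] j by simp
  have "Act u v (affine_raise ?j) (bvec (col a, col b))
      = Act u v (fgen (E ?j)) (v *\<^sub>K bvec (col a, col b + unitv ?j)
        + (u * inverse p) *\<^sub>K bvec (col a + unitv ?j, col b))"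
    using Suc.IH j by (simp add: free_act_mult)
  also have "\<dots> = v *\<^sub>K bvec (col a, col b + unitv (Suc ?j))
    + (u * inverse p * K_eig ?j (col b)) *\<^sub>K bvec (col a + unitv (Suc ?j), col b)"
    using j L by (simp add: lin_add[OF lin_free_act] lin_scale[OF lin_free_act] E_pair zero one)
  finally show ?case unfolding K .
qed

lemma affine_raise_last:
  "Act u v (affine_raise (n - 1)) (bvec (col a, col b)) = v *\<^sub>K bvec (col a, col (Suc b))
    + (u * inverse p * q ^ b) *\<^sub>K bvec (col (Suc a), col b)"
  using affine_raise_pair[of "n - 1" u v a b] fermion by (simp add: col_Suc)

text \<open>
  On \<open>|a e\<^sub>n\<rangle> \<otimes> |b e\<^sub>n\<rangle>\<close> the particle ends in the right factor with coefficient \<open>v\<close>, or in the left factor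
  with coefficient \<open>u p\<^sup>-\<^sup>1 q\<^sup>b\<close>. In the second case \<open>psi\<close> contributes \<open>- p\<^sup>-\<^sup>1 q\<^sup>a\<close> more, and \<open>- p\<^sup>-\<^sup>2 = q\<close> turns
  the total into \<open>q\<^sup>a\<^sup>+\<^sup>b\<^sup>+\<^sup>1 u\<close>, which depends on \<open>a + b\<close> only.
\<close>

lemma affine_raise_in_span:
  assumes "\<psi> \<in> VS.span {bvec (col a, col b) | a b. a + b = l}"
  shows "Act u v (affine_raise (n - 1)) \<psi> \<in> VS.span {bvec (col a, col b) | a b. a + b = Suc l}"
    (is "_ \<in> VS.span ?S")
    and "psi (Act u v (affine_raise (n - 1)) \<psi>) = (v + q ^ Suc l * u) * psi \<psi>"
proof -
  let ?A = "Act u v (affine_raise (n - 1))"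
  have "?A \<psi> \<in> VS.span ?S \<and> psi (?A \<psi>) = (v + q ^ Suc l * u) * psi \<psi>"
  proof (rule VS.span_induct[OF assms])
    show "VS.subspace {\<psi>. ?A \<psi> \<in> VS.span ?S \<and> psi (?A \<psi>) = (v + q ^ Suc l * u) * psi \<psi>}"
      by (rule VS.subspaceI)
        (auto simp: lin_zero[OF lin_free_act] lin_add[OF lin_free_act] lin_scale[OF lin_free_act]
          weighted_sum_add weighted_sum_scale algebra_simps intro: VS.span_zero VS.span_add VS.span_scale)
    fix \<phi> assume "\<phi> \<in> {bvec (col a, col b) | a b. a + b = l}"
    then obtain a b where \<phi>: "\<phi> = bvec (col a, col b)" and ab: "a + b = l" by blast
    have "?A \<phi> \<in> VS.span ?S"
      unfolding \<phi> affine_raise_last using ab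
      by (intro VS.span_add VS.span_scale VS.span_base) force+
    moreover have "psi (?A \<phi>) = (v + q ^ Suc l * u) * psi \<phi>"
    proof -
      have "inverse p * inverse p = - q"
        using p_square by (simp flip: inverse_mult_distrib)
      moreover have "q ^ b * q ^ a = q ^ l"
        using ab by (simp add: add.commute flip: power_add)
      moreover have "u * inverse p * q ^ b * (- inverse p * q ^ a * psi_coeff a)
          = - (inverse p * inverse p) * (q ^ b * q ^ a) * (u * psi_coeff a)"
        by (simp add: mult_ac)
      ultimately have "u * inverse p * q ^ b * psi_coeff (Suc a) = q ^ Suc l * u * psi_coeff a"
        by simp
      then show ?thesis
        unfolding \<phi> affine_raise_last
        by (simp only: weighted_sum_add weighted_sum_scale psi_bvec_col distrib_right)
    qed
    ultimately show "?A \<phi> \<in> VS.span ?S \<and> psi (?A \<phi>) = (v + q ^ Suc l * u) * psi \<phi>"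
      by blast
  qed
  then show "?A \<psi> \<in> VS.span ?S" "psi (?A \<psi>) = (v + q ^ Suc l * u) * psi \<psi>" by blast+
qed

end

section \<open>The spectral decomposition\<close>

text \<open>
  Any finite set containing the support will do, so that two decompositions can be compared over a
  common index set.
\<close>

lemma components_iff:
  "components M v c \<longleftrightarrow> (\<exists>S. finite S \<and> (\<forall>l. c l \<in> M l) \<and> (\<forall>l. l \<notin> S \<longrightarrow> c l = 0) \<and> v = sum c S)"
    (is "?L \<longleftrightarrow> ?R")
proof
  assume ?L
  then show ?R
    by (intro exI[of _ "{l. c l \<noteq> 0}"]) (auto simp: components_def Sum_any.expand_set)
next
  assume ?R
  then obtain S where S: "finite S" "\<forall>l. c l \<in> M l" "\<forall>l. l \<notin> S \<longrightarrow> c l = 0" "v = sum c S"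
    by blast
  then have sub: "{l. c l \<noteq> 0} \<subseteq> S" by blast
  then show ?L
    using S Sum_any.expand_superset[OF S(1) sub] finite_subset[OF sub S(1)] by (simp add: components_def)
qed

locale quantum_R = type_B +
  fixes R :: "vec2 \<Rightarrow> vec2"
  assumes R: "is_quantum_R \<kappa> \<kappa>' R"
begin

definition PR :: "vec2 \<Rightarrow> vec2" where "PR \<psi> = flip (R \<psi>)"

lemma PR_in_W2: "\<psi> \<in> W2 \<Longrightarrow> PR \<psi> \<in> W2"
  using R by (auto simp: is_quantum_R_def endomorphisms_def PR_def intro: flip_in_W2)

lemma PR_add: "\<psi> \<in> W2 \<Longrightarrow> \<phi> \<in> W2 \<Longrightarrow> PR (\<psi> + \<phi>) = PR \<psi> + PR \<phi>"
  using R by (simp add: is_quantum_R_def endomorphisms_def PR_def lin_add[OF lin_flip])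

lemma PR_scale: "\<psi> \<in> W2 \<Longrightarrow> PR (c *\<^sub>K \<psi>) = c *\<^sub>K PR \<psi>"
  using R by (simp add: is_quantum_R_def endomorphisms_def PR_def lin_scale[OF lin_flip])

lemma PR_zero: "PR 0 = 0"
  using PR_scale[OF VS.subspace_0[OF subspace_W2], of 0] by simp

lemma PR_diff: "\<psi> \<in> W2 \<Longrightarrow> \<phi> \<in> W2 \<Longrightarrow> PR (\<psi> - \<phi>) = PR \<psi> - PR \<phi>"
  using PR_add[of "\<psi> - \<phi>" \<phi>] VS.subspace_diff[OF subspace_W2] by (simp add: algebra_simps)

lemma PR_sum: "(\<And>l. l \<in> S \<Longrightarrow> f l \<in> W2) \<Longrightarrow> PR (sum f S) = (\<Sum>l\<in>S. PR (f l))"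
proof (induction S rule: infinite_finite_induct)
  case (insert l S)
  then show ?case
    using PR_add[of "f l" "sum f S"] VS.subspace_sum[OF subspace_W2, of S f] by simp
qed (simp_all add: PR_zero)

text \<open>
  Exchanging the factors turns the opposite action with parameters \<open>(x, y)\<close> into the action with
  parameters \<open>(y, x)\<close>.
\<close>

lemma PR_intertwines:
  assumes "a \<in> carrier (free_alg {0..n})" "\<psi> \<in> W2"
  shows "PR (Act xvar yvar a \<psi>) = Act yvar xvar a (PR \<psi>)"
proof -
  have "R \<psi> \<in> W2" using R assms(2) by (auto simp: is_quantum_R_def endomorphisms_def)
  moreover have "act_op \<kappa> \<kappa>' xvar yvar (coset a) (R \<psi>) = R (act \<kappa> \<kappa>' xvar yvar (coset a) \<psi>)"
    using R coset_in_UB[OF assms(1)] assms(2) by (simp add: is_quantum_R_def)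
  ultimately have "flip (Act yvar xvar a (flip (R \<psi>))) = R (Act xvar yvar a \<psi>)"
    using assms(2) by (simp add: act_coset act_op_coset)
  then show ?thesis
    unfolding PR_def by (metis flip_flip)
qed

lemma PR_commutes:
  assumes "a \<in> nonaffine" "\<psi> \<in> W2"
  shows "PR (Act xvar yvar a \<psi>) = Act xvar yvar a (PR \<psi>)"
  using PR_intertwines[OF nonaffine_in_carrier[OF assms(1)] assms(2)]
    nonaffine_act_independent[OF assms(1), of yvar xvar _ xvar yvar] by simp

lemma generator_nonaffine: "1 \<le> gen_index g \<Longrightarrow> gen_index g \<le> n \<Longrightarrow> fgen g \<in> nonaffine"
  by (intro free_alg_fgen) simp

text \<open>
  \<open>PR\<close> commutes with \<open>e\<^sub>1, ..., e\<^sub>n\<close> and \<open>k\<^sub>n\<close>, so \<open>PR \<xi>\<^sub>l\<close> is singular with the eigenvalue of \<open>\<xi>\<^sub>l\<close>.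
\<close>

lemma PR_sing_vec_proportional: "\<exists>c. PR (\<xi> l) = c *\<^sub>K \<xi> l"
proof (rule singular_proportional[OF PR_in_W2[OF sing_vec_in_W2]])
  show "Act xvar yvar (fgen (E i)) (PR (\<xi> l)) = 0" if "1 \<le> i" "i \<le> n" for i
    using PR_commutes[OF generator_nonaffine sing_vec_in_W2, of "E i" l] sing_vec_singular[OF that] that
    by (simp add: PR_zero)
  show "Act xvar yvar (fgen (K n)) (PR (\<xi> l)) = (p * p * q powi (- int l)) *\<^sub>K PR (\<xi> l)"
    using PR_commutes[OF generator_nonaffine sing_vec_in_W2, of "K n" l] fermion
    by (simp only: sing_vec_weight PR_scale sing_vec_in_W2 gen_index.simps)
qed

definition \<rho> :: "nat \<Rightarrow> fld" where "\<rho> l = (SOME c. PR (\<xi> l) = c *\<^sub>K \<xi> l)"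

lemma PR_sing_vec: "PR (\<xi> l) = \<rho> l *\<^sub>K \<xi> l"
  unfolding \<rho>_def by (rule someI_ex[OF PR_sing_vec_proportional])

lemma \<rho>_0: "\<rho> 0 = 1"
proof -
  have "\<xi> 0 = bvec (0, 0)"
    by (simp add: sing_vec_eq sing_coeff_def col_0)
  moreover have "PR (bvec (0, 0)) = bvec (0, 0)"
    using R by (simp add: is_quantum_R_def PR_def ket_label)
  ultimately have "bvec (0, 0) = \<rho> 0 *\<^sub>K (bvec (0, 0) :: vec2)"
    using PR_sing_vec[of 0] by simp
  then have "Poly_Mapping.lookup (bvec (0, 0) :: vec2) (0, 0) = Poly_Mapping.lookup (\<rho> 0 *\<^sub>K (bvec (0, 0) :: vec2)) (0, 0)"
    by (rule arg_cong)
  then show ?thesis by (simp add: lookup_bvec)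
qed

text \<open>
  Write \<open>A\<close> for \<open>e\<^sub>n\<^sub>-\<^sub>1 ... e\<^sub>1 e\<^sub>0\<close>. Modulo the image of \<open>f\<^sub>n\<close>, which \<open>PR\<close> preserves, \<open>A \<xi>\<^sub>l\<close> is a multiple
  of \<open>\<xi>\<^sub>l\<^sub>+\<^sub>1\<close>, so \<open>PR\<close> multiplies \<open>psi (A \<xi>\<^sub>l)\<close> by \<open>\<rho>\<^sub>l\<^sub>+\<^sub>1\<close>. On the other hand \<open>PR\<close> sends \<open>A \<xi>\<^sub>l\<close> to
  \<open>\<rho>\<^sub>l A \<xi>\<^sub>l\<close> with \<open>x\<close> and \<open>y\<close> exchanged in \<open>A\<close>.
\<close>

lemma \<rho>_Suc: "\<rho> (Suc l) * (yvar + q ^ Suc l * xvar) = \<rho> l * (xvar + q ^ Suc l * yvar)"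
proof -
  let ?N = "Act xvar yvar (fgen (F n)) ` W2"
  let ?A = "Act xvar yvar (affine_raise (n - 1))"
  have N: "VS.subspace ?N"
    by (rule module_hom.subspace_image[OF lin_free_act subspace_W2])
  have gens: "Act xvar yvar (fgen (F n)) (bvec (col a, col b)) \<in> ?N" for a b
    by (intro imageI bvec_in_W2 col_label)
  have psi_N: "psi (PR \<psi>) = 0" if "\<psi> \<in> ?N" for \<psi>
  proof -
    from that obtain \<phi> where "\<psi> = Act xvar yvar (fgen (F n)) \<phi>" "\<phi> \<in> W2" by blast
    then have "PR \<psi> = Act yvar xvar (fgen (F n)) (PR \<phi>)"
      by (simp add: PR_intertwines free_alg_fgen)
    then show ?thesis using psi_F_n[OF PR_in_W2] \<open>\<phi> \<in> W2\<close> by simp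
  qed
  have AW: "?A (\<xi> l) \<in> W2"
    by (intro Act_in_W2 affine_raise_in_carrier sing_vec_in_W2) simp
  note r1 = reduce_span_to_right[OF N gens affine_raise_in_span(1)[OF sing_vec_in_span]]
  note r2 = reduce_span_to_right[OF N gens sing_vec_in_span]
  let ?s = "psi (\<xi> (Suc l))" and ?t = "psi (?A (\<xi> l))"
  \<comment> \<open>The combination of \<open>?A (\<xi> l)\<close> and \<open>\<xi> (Suc l)\<close> on which \<open>psi\<close> vanishes lies in the image of \<open>f\<^sub>n\<close>,
    and so does its image under \<open>PR\<close>.\<close>
  have "?s *\<^sub>K (?A (\<xi> l) - ?t *\<^sub>K bvec (0, col (Suc l))) - ?t *\<^sub>K (\<xi> (Suc l) - ?s *\<^sub>K bvec (0, col (Suc l))) \<in> ?N"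
    by (rule VS.subspace_diff[OF N VS.subspace_scale[OF N r1] VS.subspace_scale[OF N r2]])
  then have "?s *\<^sub>K ?A (\<xi> l) - ?t *\<^sub>K \<xi> (Suc l) \<in> ?N"
    by (simp add: VS.scale_right_diff_distrib mult.commute)
  from psi_N[OF this] have "?s * psi (PR (?A (\<xi> l))) = ?t * (\<rho> (Suc l) * ?s)"
    using AW sing_vec_in_W2 VS.subspace_scale[OF subspace_W2]
    by (simp add: PR_diff PR_scale PR_sing_vec weighted_sum_diff weighted_sum_scale)
  moreover have "PR (?A (\<xi> l)) = \<rho> l *\<^sub>K Act yvar xvar (affine_raise (n - 1)) (\<xi> l)"
    by (simp add: PR_intertwines affine_raise_in_carrier sing_vec_in_W2 PR_sing_vec lin_scale[OF lin_free_act])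
  then have "psi (PR (?A (\<xi> l))) = \<rho> l * ((xvar + q ^ Suc l * yvar) * psi (\<xi> l))"
    by (simp only: weighted_sum_scale affine_raise_in_span(2)[OF sing_vec_in_span])
  moreover have "?t = (yvar + q ^ Suc l * xvar) * psi (\<xi> l)"
    by (rule affine_raise_in_span(2)[OF sing_vec_in_span])
  ultimately have "(?s * psi (\<xi> l)) * (\<rho> (Suc l) * (yvar + q ^ Suc l * xvar))
      = (?s * psi (\<xi> l)) * (\<rho> l * (xvar + q ^ Suc l * yvar))"
    by (simp only: mult_ac)
  then show ?thesis
    using psi_sing_vec_nonzero by (metis mult_cancel_left mult_eq_0_iff)
qed

lemma \<rho>_eq: "\<rho> l = (\<Prod>j = 1..l. (xvar + q ^ j * yvar) / (yvar + q ^ j * xvar))"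
proof (induction l)
  case 0
  then show ?case by (simp add: \<rho>_0)
next
  case (Suc l)
  have "\<rho> (Suc l) = \<rho> l * ((xvar + q ^ Suc l * yvar) / (yvar + q ^ Suc l * xvar))"
    using \<rho>_Suc[of l] y_plus_qx_nonzero[of "Suc l"] by (simp add: nonzero_eq_divide_eq del: power_Suc)
  then show ?case by (simp only: Suc.IH prod.nat_ivl_Suc' le_add1 plus_1_eq_Suc mult.commute)
qed

lemma \<rho>_nonzero: "\<rho> l \<noteq> 0"
  unfolding \<rho>_eq using x_plus_qy_nonzero y_plus_qx_nonzero by (simp add: prod_zero_iff)

lemma \<rho>_less_neq:
  assumes "l < k" shows "\<rho> l \<noteq> \<rho> k"
proof
  assume eq: "\<rho> l = \<rho> k"
  have "{1..k} = {1..l} \<union> {l + 1..k}" using assms by auto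
  then have "\<rho> k = \<rho> l * (\<Prod>j = l + 1..k. (xvar + q ^ j * yvar) / (yvar + q ^ j * xvar))"
    unfolding \<rho>_eq by (simp add: prod.union_disjoint)
  then have "(\<Prod>j = l + 1..k. (xvar + q ^ j * yvar) / (yvar + q ^ j * xvar)) = 1"
    using eq \<rho>_nonzero by simp
  then have "(\<Prod>j = l + 1..k. xvar + q ^ j * yvar) = (\<Prod>j = l + 1..k. yvar + q ^ j * xvar)"
    using y_plus_qx_nonzero by (simp add: prod_dividef prod_zero_iff divide_eq_1_iff)
  then show False
    using prod_x_qy_neq_prod_y_qx[of "{l + 1..k}"] assms by simp
qed

lemma \<rho>_inj: "\<rho> l = \<rho> k \<longleftrightarrow> l = k"
  using \<rho>_less_neq by (metis nat_neq_iff)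

lemma PR_on_module: "\<psi> \<in> M l \<Longrightarrow> PR \<psi> = \<rho> l *\<^sub>K \<psi>"
  unfolding sing_module_eq
  by (auto simp: PR_commutes sing_vec_in_W2 PR_sing_vec lin_scale[OF lin_free_act] simp del: One_nat_def)

text \<open>
  Eigenvectors of \<open>PR\<close> for distinct eigenvalues: \<open>PR - \<rho>\<^sub>k\<close> removes the summand \<open>k\<close> from a vanishing sum
  and rescales the others by nonzero factors.
\<close>

lemma modules_independent:
  assumes "finite S" "\<And>l. l \<in> S \<Longrightarrow> d l \<in> M l" "sum d S = 0"
  shows "\<forall>l\<in>S. d l = 0"
  using assms
proof (induction S arbitrary: d rule: finite_induct)
  case (insert k S)
  have W: "d l \<in> W2" if "l \<in> insert k S" for l
    using insert.prems(1)[OF that] sing_module_in_W2 by blast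
  have "0 = PR (sum d (insert k S))"
    using insert.prems(2) by (simp add: PR_zero)
  also have "\<dots> = (\<Sum>l\<in>insert k S. \<rho> l *\<^sub>K d l)"
    by (subst PR_sum[OF W]) (auto intro!: sum.cong PR_on_module insert.prems(1))
  finally have "(\<Sum>l\<in>insert k S. \<rho> l *\<^sub>K d l) - \<rho> k *\<^sub>K sum d (insert k S) = 0"
    by (simp only: insert.prems(2) VS.scale_zero_right) simp
  then have "(\<Sum>l\<in>S. (\<rho> l - \<rho> k) *\<^sub>K d l) = 0"
    using insert.hyps by (simp add: VS.scale_sum_right VS.scale_right_distrib VS.scale_left_diff_distrib sum_subtractf)
  then have "\<forall>l\<in>S. (\<rho> l - \<rho> k) *\<^sub>K d l = 0"
    using insert.prems(1) VS.subspace_scale[OF subspace_sing_module] by (intro insert.IH) auto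
  then have "\<forall>l\<in>S. d l = 0"
    using insert.hyps(2) \<rho>_inj by (metis VS.scale_eq_0_iff right_minus_eq)
  then show ?case
    using insert.prems(2) insert.hyps by simp
qed simp

lemma components_unique:
  assumes "components M \<psi> c" "components M \<psi> c'" shows "c = c'"
proof
  fix l
  from assms(1) obtain S where S: "finite S" "\<forall>l. c l \<in> M l" "\<forall>l. l \<notin> S \<longrightarrow> c l = 0" "\<psi> = sum c S"
    unfolding components_iff by blast
  from assms(2) obtain S' where S': "finite S'" "\<forall>l. c' l \<in> M l" "\<forall>l. l \<notin> S' \<longrightarrow> c' l = 0" "\<psi> = sum c' S'"
    unfolding components_iff by blast
  let ?T = "insert l (S \<union> S')"
  have "sum c ?T = \<psi>"
    unfolding S(4) using S(1,3) S'(1) by (intro sum.mono_neutral_right) auto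
  moreover have "sum c' ?T = \<psi>"
    unfolding S'(4) using S(1) S'(1,3) by (intro sum.mono_neutral_right) auto
  ultimately have "(\<Sum>l\<in>?T. c l - c' l) = 0"
    by (simp only: sum_subtractf diff_self)
  then have "\<forall>l\<in>?T. c l - c' l = 0"
    using S S' VS.subspace_diff[OF subspace_sing_module] by (intro modules_independent) auto
  then show "c l = c' l" by simp
qed

text \<open>
  The vectors that have a decomposition form a subspace which contains each \<open>\<xi>\<^sub>l\<close> and is stable under
  \<open>f\<^sub>1, ..., f\<^sub>n\<close>.
\<close>

lemma components_exist:
  assumes "\<psi> \<in> W2" shows "\<exists>c. components M \<psi> c"
proof -
  let ?N = "{\<psi>. \<exists>c. components M \<psi> c}"
  have image: "\<exists>d. components M (T \<psi>) d" if "lin T" "\<And>l \<phi>. \<phi> \<in> M l \<Longrightarrow> T \<phi> \<in> M l" "components M \<psi> c" for T \<psi> c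
  proof -
    from that(3) obtain S where S: "finite S" "\<forall>l. c l \<in> M l" "\<forall>l. l \<notin> S \<longrightarrow> c l = 0" "\<psi> = sum c S"
      unfolding components_iff by blast
    then have "components M (T \<psi>) (\<lambda>l. T (c l))"
      unfolding components_iff using that(2) lin_sum[OF that(1)] lin_zero[OF that(1)]
      by (intro exI[of _ S]) auto
    then show ?thesis by blast
  qed
  have "W2 \<subseteq> ?N"
  proof (rule spanned_by_singular_vectors)
    show "VS.subspace ?N"
    proof (rule VS.subspaceI; clarsimp)
      have "components M 0 (\<lambda>_. 0)"
        using VS.subspace_0[OF subspace_sing_module] by (auto simp: components_def)
      then show "\<exists>c. components M 0 c" by blast
    next
      fix \<psi> \<phi> c d assume "components M \<psi> c" "components M \<phi> d"
      then obtain S T where S: "finite S" "\<forall>l. c l \<in> M l" "\<forall>l. l \<notin> S \<longrightarrow> c l = 0" "\<psi> = sum c S"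
        and T: "finite T" "\<forall>l. d l \<in> M l" "\<forall>l. l \<notin> T \<longrightarrow> d l = 0" "\<phi> = sum d T"
        unfolding components_iff by blast
      have "sum c (S \<union> T) = \<psi>" "sum d (S \<union> T) = \<phi>"
        unfolding S(4) T(4) using S(1,3) T(1,3) by (intro sum.mono_neutral_right; auto)+
      then have "components M (\<psi> + \<phi>) (\<lambda>l. c l + d l)"
        unfolding components_iff using S T VS.subspace_add[OF subspace_sing_module]
        by (intro exI[of _ "S \<union> T"]) (auto simp: sum.distrib)
      then show "\<exists>c. components M (\<psi> + \<phi>) c" by blast
    next
      fix a \<psi> c assume "components M \<psi> c"
      then show "\<exists>d. components M (a *\<^sub>K \<psi>) d"
        using image[OF lin_scl] VS.subspace_scale[OF subspace_sing_module] by blast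
    qed
    show "Act xvar yvar (fgen (F i)) \<psi> \<in> ?N" if "1 \<le> i" "i \<le> n" "\<psi> \<in> ?N" for i \<psi>
      using that image[OF lin_free_act sing_module_closed] generator_nonaffine[of "F i"] by auto
    show "\<xi> l \<in> ?N" for l
    proof -
      have "components M (\<xi> l) (\<lambda>k. if k = l then \<xi> l else 0)"
        unfolding components_iff using sing_vec_in_module VS.subspace_0[OF subspace_sing_module]
        by (intro exI[of _ "{l}"]) auto
      then show ?thesis by blast
    qed
  qed
  then show ?thesis using assms by blast
qed

lemma direct_sum: "is_direct_sum W2 M"
  unfolding is_direct_sum_def
  using subspace_sing_module sing_module_in_W2 components_exist components_unique by blast

lemma spectral_decomposition:
  assumes "\<psi> \<in> W2"
  shows "PR \<psi> = Sum_any (\<lambda>l. \<rho> l *\<^sub>K projector M l \<psi>)"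
proof -
  obtain c where c: "components M \<psi> c" using components_exist[OF assms] by blast
  then have "(THE c. components M \<psi> c) = c" using components_unique by blast
  then have proj: "projector M l \<psi> = c l" for l by (simp add: projector_def)
  from c obtain S where S: "finite S" "\<forall>l. c l \<in> M l" "\<forall>l. l \<notin> S \<longrightarrow> c l = 0" "\<psi> = sum c S"
    unfolding components_iff by blast
  have "PR \<psi> = (\<Sum>l\<in>S. PR (c l))"
    unfolding S(4) using S(2) sing_module_in_W2 by (intro PR_sum) blast
  also have "\<dots> = (\<Sum>l\<in>S. \<rho> l *\<^sub>K c l)"
    using S(2) by (intro sum.cong refl PR_on_module) blast
  also have "\<dots> = Sum_any (\<lambda>l. \<rho> l *\<^sub>K c l)"
    using S(3) by (intro Sum_any.expand_superset[OF S(1), symmetric]) auto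
  finally show ?thesis by (simp only: proj)
qed

end

theorem proposition7p3:
  fixes \<kappa> \<kappa>' :: nat and R :: "vec2 \<Rightarrow> vec2" and z :: fld
  assumes "\<kappa> \<ge> 1" and "\<kappa>' \<ge> 1"
    and "z = xvar / yvar"
    and "is_quantum_R \<kappa> \<kappa>' R"
  shows "is_direct_sum (WW \<kappa> \<kappa>') (sing_module \<kappa> \<kappa>') \<and>
    (\<forall>\<psi> \<in> WW \<kappa> \<kappa>'. flip (R \<psi>) =
       Sum_any (\<lambda>l. (\<Prod>j = 1..l. (z + q ^ j) / (1 + q ^ j * z)) *\<^sub>K
         projector (sing_module \<kappa> \<kappa>') l \<psi>))"
proof -
  interpret quantum_R \<kappa> \<kappa>' R
    using assms by unfold_locales
  have "(z + q ^ j) / (1 + q ^ j * z) = (xvar + q ^ j * yvar) / (yvar + q ^ j * xvar)" for j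
  proof -
    have "z + q ^ j = (xvar + q ^ j * yvar) / yvar" "1 + q ^ j * z = (yvar + q ^ j * xvar) / yvar"
      unfolding assms(3) by (simp_all add: field_simps)
    then show ?thesis by simp
  qed
  then have "(\<Prod>j = 1..l. (z + q ^ j) / (1 + q ^ j * z)) = \<rho> l" for l
    by (simp only: \<rho>_eq)
  then show ?thesis
    using direct_sum spectral_decomposition by (simp only: PR_def) blast
qed

end
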